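(* Let $\gamma_2>0$, $0<9\delta<2l-n$, $\gamma=\min\{\gamma_1,\gamma_2\}$, $2\gamma_1=2l-n-8\delta$, and $\hat\gamma=(2l-1+\gamma)(2l)^{-1}$. There is $k_0=k_0(V,\gamma_2,\delta)$ such that for every $\lambda_0>k_0^{2l}$ the following holds with $k=\lambda_0^{1/(2l)}$ and any $A\in\mathbb C$ with $|\sigma||A|^2<k^{-\gamma_2}$: for each choice of sign $\pm$, the surface $\lambda^\pm(t)=\lambda_0$ ($t$ in the $(k^{-n+1-7\delta})$-neighborhood in $K$ of $\chi_q(k,\delta)$) is contained in the $C(V)\lambda_0^{-\hat\gamma}$-neighborhood of the surface $\hat\lambda^\pm(t)=\lambda_0$, where $C(V)$ is a constant depending on $V$.
   Context: Setting. $l,n$ are fixed positive integers with $2l>n$; $\sigma\in\mathbb R$; $Q=[0,2\pi]^n$; $K=[0,1)^n$. $V(x)=\sum_{m\in\mathbb Z^n,\,0<|m|\le R_0}v_me^{i\langle m,x\rangle}$ is a real-valued trigonometric polynomial, not identically zero, and $q\in\mathbb Z^n\setminus\{0\}$ is fixed with $v_q\neq0$. For a $2\pi$-periodic $W$ with Fourier coefficients $w_m$, $\|W\|_*=\sum_{m}|w_m|$. For $j\in\mathbb Z^n$: $P_j(t)=j+t$, $p_j(t)=|P_j(t)|$. $H_0(t)$ is $(-\Delta)^l$ in $L^2(Q)$ with the quasi-periodic conditions $\partial_{x_s}^ru(x_1,\dots,x_s+2\pi,\dots,x_n)=e^{2\pi i t_s}\partial_{x_s}^ru(x)$, $s=1,\dots,n$,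 $r=0,\dots,2l-1$. Operators are written as matrices in the basis $e^{i\langle P_s(t),x\rangle}$, $s\in\mathbb Z^n$: $H_0(t)=\mathrm{diag}(p_s^{2l}(t))$ and multiplication by $W$ is $(w_{s-r})_{s,r}$. Resonant set. $S(k)$ is the sphere of radius $k$ centered at $0$, $S_q(k,n-2+\delta)=\{x\in S(k):\big||x|^2-|x-q|^2\big|<4k^{-n+2-\delta}\}$, and $\mathcal K:\mathbb R^n\to K$, $\mathcal KP_m(t)=t$. $\chi_q(k,\delta)$ is a subset of $\mathcal KS_q(k,n-2+\delta)$ such that for each $t\in\chi_q(k,\delta)$: there is $j\in\mathbb Z^n$ with $P_j(t)\in S_q(k,n-2+\delta)$; $|p_{j-q}^2(t)-p_j^2(t)|<4k^{-n+2-\delta}$; and $\min_{i\ne j,j-q}|p_j^2(t)-p_i^2(t)|>2k^{-n+2-6\delta}$. It has asymptotically full measure in $\mathcal KS_q(k,n-2+\delta)$ (relative measure of the complement $O(k^{-\delta/2})$). For $t$ near $\chi_q(k,\delta)$, $j$ is the index attached to a nearby point of $\chi_q(k,\delta)$. For $t$ in the $(2k^{-n+1-7\delta})$-neighborhood of $\chi_q(k,\delta)$ and $z$ on either circle $C_1^\pm=\{z:|z-\hat\lambda^\pm(t)|=d\}$, $d=\frac1{10}|v_q|$, one has $2|p_m^{2l}(t)-z|\ge k^{2l-n-6\delta}$ for $m\neq j,j-q$. Model operator. $\hat\lambda^\pm(t)=a\pm b$, $2a=p_j^{2l}+p_{j-q}^{2l}$, $2b=(4|v_q|^2+(p_j^{2l}-p_{j-q}^{2l})^2)^{1/2}$,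 are the eigenvalues of $\begin{pmatrix}p_j^{2l}(t)&v_q\\ v_{-q}&p_{j-q}^{2l}(t)\end{pmatrix}$. In "the surface $\hat\lambda^\pm(t)=\lambda_0$" this explicit function is considered for $t\in\mathbb R^n$ with $j$ held fixed (the index $j$ of the piece of surface under consideration). $P_q$ is the diagonal projection onto coordinates $j,j-q$, $\hat H_q(t)=H_0(t)+P_qVP_q$, and $\hat E^\pm(t)$ is the rank-one spectral projection of $\hat H_q(t)$ for $\hat\lambda^\pm(t)$ (supported on coordinates $j,j-q$). Construction of $\lambda^\pm$. For periodic $W$ with $\|W\|_*<\infty$ put $Y=W-P_qVP_q$ and (whenever the series converge) $\hat E^\pm_W=\hat E^\pm+\sum_{r\ge1}\hat G^\pm_{W,r}$, $\lambda_W^\pm=\hat\lambda^\pm+\sum_{r\ge1}\hat g^\pm_{W,r}$, where $\hat G^\pm_{W,r}=\frac{(-1)^{r+1}}{2\pi i}\oint_{C_1^\pm}((\hat H_q-z)^{-1}Y)^r(\hat H_q-z)^{-1}dz$, $\hat g^\pm_{W,r}=\frac{(-1)^r}{2\pi ir}\mathrm{Tr}\oint_{C_1^\pm}((\hat H_q-z)^{-1}Y)^rdz$. For $A\in\mathbb C$ put $u_W^\pm(x)=A\sum_{s}(\hat E_W^\pm)_{sj}e^{i\langle P_s(t),x\rangle}$, $\hat{\mathcal M}^\pm W=V+\sigma|u_W^\pm|^2$, $W_0^\pm=V$, $W_m^\pm=\hat{\mathcal M}^\pm W_{m-1}^\pm$. $W^\pm$ is the $\|\cdot\|_*$-limit of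 $W_m^\pm$ and $\lambda^\pm(t)=\lambda^\pm_{W^\pm}(t)$; it is the eigenvalue of $H_0(t)+W^\pm$ such that $u^\pm=u^\pm_{W^\pm}$ solves $(-\Delta)^lu^\pm+Vu^\pm+\sigma|u^\pm|^2u^\pm=\lambda^\pm u^\pm$. *)

theory Defs
  imports "HOL-Complex_Analysis.Complex_Analysis"
begin

section \<open>Periodic functions and Fourier coefficients\<close>

definition rvec :: "int ^ 'n \<Rightarrow> real ^ 'n" where
  "rvec m = (\<chi> i. real_of_int (m $ i))"

definition Qbox :: "(real ^ 'n) set" where
  "Qbox = cbox 0 (\<chi> i. 2 * pi)"

definition Kcell :: "(real ^ 'n) set" where
  "Kcell = {t. \<forall>i. 0 \<le> t $ i \<and> t $ i < 1}"

definition fourier :: "(real ^ 'n \<Rightarrow> real) \<Rightarrow> int ^ 'n \<Rightarrow> complex" where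
  "fourier W m = complex_of_real (1 / (2 * pi) ^ CARD('n)) *
     integral Qbox (\<lambda>x. complex_of_real (W x) * cis (- (rvec m \<bullet> x)))"

definition star_space :: "(real ^ 'n \<Rightarrow> real) set" where
  "star_space = {W. (\<forall>x i. W (x + axis i (2 * pi)) = W x) \<and>
     W absolutely_integrable_on Qbox \<and> (\<lambda>m. cmod (fourier W m)) summable_on UNIV}"

definition star_norm :: "(real ^ 'n \<Rightarrow> real) \<Rightarrow> real" where
  "star_norm W = (\<Sum>\<^sub>\<infinity>m. cmod (fourier W m))"

text \<open>The limit is unique up to equality of all Fourier coefficients, and only these coefficients
  are used below. The differences are required to lie in \<^const>\<open>star_space\<close> because
  \<^const>\<open>infsum\<close> is 0 on non-summable families.\<close>

definition star_limit :: "(nat \<Rightarrow> real ^ 'n \<Rightarrow> real) \<Rightarrow> real ^ 'n \<Rightarrow> real" where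
  "star_limit Ws = (SOME W. W \<in> star_space \<and> (\<forall>m. (\<lambda>x. Ws m x - W x) \<in> star_space) \<and>
     (\<lambda>m. star_norm (\<lambda>x. Ws m x - W x)) \<longlonglongrightarrow> 0)"


section \<open>Operators as infinite matrices\<close>

type_synonym 'n zmat = "int ^ 'n \<Rightarrow> int ^ 'n \<Rightarrow> complex"

definition zone :: "'n zmat" where
  "zone s r = (if s = r then 1 else 0)"

definition zmult :: "'n zmat \<Rightarrow> 'n zmat \<Rightarrow> 'n zmat" where
  "zmult M N s r = (\<Sum>\<^sub>\<infinity>m. M s m * N m r)"

primrec zpow :: "'n zmat \<Rightarrow> nat \<Rightarrow> 'n zmat" where
  "zpow M 0 = zone"
| "zpow M (Suc r) = zmult M (zpow M r)"

definition zapply :: "'n zmat \<Rightarrow> (int ^ 'n \<Rightarrow> complex) \<Rightarrow> int ^ 'n \<Rightarrow> complex" where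
  "zapply M x s = (\<Sum>\<^sub>\<infinity>r. M s r * x r)"

text \<open>Used for matrices with finitely many nonzero entries in each row and each column, for which
  a two-sided inverse is unique.\<close>

definition zinv :: "'n zmat \<Rightarrow> 'n zmat" where
  "zinv M = (THE R. zmult M R = zone \<and> zmult R M = zone)"

text \<open>The orthogonal projection onto the eigenspace of \<open>H\<close> for \<open>\<mu>\<close> within the vectors supported
  on the coordinates in \<open>J\<close>.\<close>

definition spec_proj :: "'n zmat \<Rightarrow> (int ^ 'n) set \<Rightarrow> real \<Rightarrow> 'n zmat" where
  "spec_proj H J \<mu> = (THE E. (\<forall>s r. s \<notin> J \<or> r \<notin> J \<longrightarrow> E s r = 0) \<and>
     (\<forall>s r. E r s = cnj (E s r)) \<and> zmult E E = E \<and>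
     (\<forall>x. (\<forall>s. s \<notin> J \<longrightarrow> x s = 0) \<longrightarrow>
        (zapply E x = x \<longleftrightarrow> zapply H x = (\<lambda>s. complex_of_real \<mu> * x s))))"

definition mult_op :: "(real ^ 'n \<Rightarrow> real) \<Rightarrow> 'n zmat" where
  "mult_op W s r = fourier W (s - r)"

definition Pt :: "int ^ 'n \<Rightarrow> real ^ 'n \<Rightarrow> real ^ 'n" where
  "Pt j t = rvec j + t"

definition pt :: "int ^ 'n \<Rightarrow> real ^ 'n \<Rightarrow> real" where
  "pt j t = norm (Pt j t)"

definition H0 :: "nat \<Rightarrow> real ^ 'n \<Rightarrow> 'n zmat" where
  "H0 l t s r = (if s = r then complex_of_real (pt s t ^ (2 * l)) else 0)"


section \<open>The model operator\<close>

definition PVP :: "(real ^ 'n \<Rightarrow> real) \<Rightarrow> int ^ 'n \<Rightarrow> int ^ 'n \<Rightarrow> 'n zmat" where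
  "PVP V q j s r = (if s \<in> {j, j - q} \<and> r \<in> {j, j - q} then mult_op V s r else 0)"

definition Hhat :: "nat \<Rightarrow> (real ^ 'n \<Rightarrow> real) \<Rightarrow> int ^ 'n \<Rightarrow> int ^ 'n \<Rightarrow> real ^ 'n \<Rightarrow> 'n zmat" where
  "Hhat l V q j t s r = H0 l t s r + PVP V q j s r"

text \<open>Here and below the sign \<open>\<plusminus>\<close> is the real number \<open>\<epsilon> \<in> {1, -1}\<close>.\<close>

definition lamhat ::
    "nat \<Rightarrow> (real ^ 'n \<Rightarrow> real) \<Rightarrow> int ^ 'n \<Rightarrow> real \<Rightarrow> int ^ 'n \<Rightarrow> real ^ 'n \<Rightarrow> real" where
  "lamhat l V q \<epsilon> j t =
     (pt j t ^ (2 * l) + pt (j - q) t ^ (2 * l)) / 2 +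
     \<epsilon> * (sqrt (4 * (cmod (fourier V q))\<^sup>2 + (pt j t ^ (2 * l) - pt (j - q) t ^ (2 * l))\<^sup>2) / 2)"

definition Ehat ::
    "nat \<Rightarrow> (real ^ 'n \<Rightarrow> real) \<Rightarrow> int ^ 'n \<Rightarrow> real \<Rightarrow> int ^ 'n \<Rightarrow> real ^ 'n \<Rightarrow> 'n zmat" where
  "Ehat l V q \<epsilon> j t = spec_proj (Hhat l V q j t) {j, j - q} (lamhat l V q \<epsilon> j t)"

definition radius_d :: "(real ^ 'n \<Rightarrow> real) \<Rightarrow> int ^ 'n \<Rightarrow> real" where
  "radius_d V q = cmod (fourier V q) / 10"

definition C1 ::
    "nat \<Rightarrow> (real ^ 'n \<Rightarrow> real) \<Rightarrow> int ^ 'n \<Rightarrow> real \<Rightarrow> int ^ 'n \<Rightarrow> real ^ 'n \<Rightarrow> real \<Rightarrow> complex" where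
  "C1 l V q \<epsilon> j t = circlepath (complex_of_real (lamhat l V q \<epsilon> j t)) (radius_d V q)"

definition resolvent ::
    "nat \<Rightarrow> (real ^ 'n \<Rightarrow> real) \<Rightarrow> int ^ 'n \<Rightarrow> int ^ 'n \<Rightarrow> real ^ 'n \<Rightarrow> complex \<Rightarrow> 'n zmat" where
  "resolvent l V q j t z = zinv (\<lambda>s r. Hhat l V q j t s r - z * zone s r)"


section \<open>Perturbation series and successive approximations\<close>

definition Yop :: "(real ^ 'n \<Rightarrow> real) \<Rightarrow> int ^ 'n \<Rightarrow> int ^ 'n \<Rightarrow> (real ^ 'n \<Rightarrow> real) \<Rightarrow> 'n zmat" where
  "Yop V q j W s r = mult_op W s r - PVP V q j s r"

definition Ghat ::
    "nat \<Rightarrow> (real ^ 'n \<Rightarrow> real) \<Rightarrow> int ^ 'n \<Rightarrow> real \<Rightarrow> int ^ 'n \<Rightarrow> real ^ 'n \<Rightarrow>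
     (real ^ 'n \<Rightarrow> real) \<Rightarrow> nat \<Rightarrow> 'n zmat" where
  "Ghat l V q \<epsilon> j t W r s s' = (-1) ^ (r + 1) / (2 * complex_of_real pi * \<i>) *
     contour_integral (C1 l V q \<epsilon> j t)
       (\<lambda>z. zmult (zpow (zmult (resolvent l V q j t z) (Yop V q j W)) r) (resolvent l V q j t z) s s')"

definition ghat ::
    "nat \<Rightarrow> (real ^ 'n \<Rightarrow> real) \<Rightarrow> int ^ 'n \<Rightarrow> real \<Rightarrow> int ^ 'n \<Rightarrow> real ^ 'n \<Rightarrow>
     (real ^ 'n \<Rightarrow> real) \<Rightarrow> nat \<Rightarrow> complex" where
  "ghat l V q \<epsilon> j t W r = (-1) ^ r / (2 * complex_of_real pi * \<i> * of_nat r) *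
     (\<Sum>\<^sub>\<infinity>s. contour_integral (C1 l V q \<epsilon> j t)
       (\<lambda>z. zpow (zmult (resolvent l V q j t z) (Yop V q j W)) r s s))"

definition E_W ::
    "nat \<Rightarrow> (real ^ 'n \<Rightarrow> real) \<Rightarrow> int ^ 'n \<Rightarrow> real \<Rightarrow> int ^ 'n \<Rightarrow> real ^ 'n \<Rightarrow>
     (real ^ 'n \<Rightarrow> real) \<Rightarrow> 'n zmat" where
  "E_W l V q \<epsilon> j t W s r = Ehat l V q \<epsilon> j t s r + (\<Sum>i. Ghat l V q \<epsilon> j t W (Suc i) s r)"

definition lam_W ::
    "nat \<Rightarrow> (real ^ 'n \<Rightarrow> real) \<Rightarrow> int ^ 'n \<Rightarrow> real \<Rightarrow> int ^ 'n \<Rightarrow> real ^ 'n \<Rightarrow>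
     (real ^ 'n \<Rightarrow> real) \<Rightarrow> complex" where
  "lam_W l V q \<epsilon> j t W =
     complex_of_real (lamhat l V q \<epsilon> j t) + (\<Sum>i. ghat l V q \<epsilon> j t W (Suc i))"

definition u_W ::
    "nat \<Rightarrow> (real ^ 'n \<Rightarrow> real) \<Rightarrow> int ^ 'n \<Rightarrow> complex \<Rightarrow> real \<Rightarrow> int ^ 'n \<Rightarrow> real ^ 'n \<Rightarrow>
     (real ^ 'n \<Rightarrow> real) \<Rightarrow> real ^ 'n \<Rightarrow> complex" where
  "u_W l V q A \<epsilon> j t W x = A * (\<Sum>\<^sub>\<infinity>s. E_W l V q \<epsilon> j t W s j * cis (Pt s t \<bullet> x))"

definition Mhat ::
    "nat \<Rightarrow> (real ^ 'n \<Rightarrow> real) \<Rightarrow> int ^ 'n \<Rightarrow> real \<Rightarrow> complex \<Rightarrow> real \<Rightarrow> int ^ 'n \<Rightarrow> real ^ 'n \<Rightarrow>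
     (real ^ 'n \<Rightarrow> real) \<Rightarrow> real ^ 'n \<Rightarrow> real" where
  "Mhat l V q \<sigma> A \<epsilon> j t W x = V x + \<sigma> * (cmod (u_W l V q A \<epsilon> j t W x))\<^sup>2"

definition W_lim ::
    "nat \<Rightarrow> (real ^ 'n \<Rightarrow> real) \<Rightarrow> int ^ 'n \<Rightarrow> real \<Rightarrow> complex \<Rightarrow> real \<Rightarrow> int ^ 'n \<Rightarrow> real ^ 'n \<Rightarrow>
     real ^ 'n \<Rightarrow> real" where
  "W_lim l V q \<sigma> A \<epsilon> j t = star_limit (\<lambda>m. (Mhat l V q \<sigma> A \<epsilon> j t ^^ m) V)"

definition lam ::
    "nat \<Rightarrow> (real ^ 'n \<Rightarrow> real) \<Rightarrow> int ^ 'n \<Rightarrow> real \<Rightarrow> complex \<Rightarrow> real \<Rightarrow> int ^ 'n \<Rightarrow> real ^ 'n \<Rightarrow>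
     complex" where
  "lam l V q \<sigma> A \<epsilon> j t = lam_W l V q \<epsilon> j t (W_lim l V q \<sigma> A \<epsilon> j t)"


section \<open>The resonant set\<close>

definition Sq :: "int ^ 'n \<Rightarrow> real \<Rightarrow> real \<Rightarrow> (real ^ 'n) set" where
  "Sq q k \<xi> = {x \<in> sphere 0 k. \<bar>(norm x)\<^sup>2 - (norm (x - rvec q))\<^sup>2\<bar> < 4 * k powr (- \<xi>)}"

definition Kmap :: "real ^ 'n \<Rightarrow> real ^ 'n" where
  "Kmap x = (\<chi> i. frac (x $ i))"

definition resonant_index ::
    "int ^ 'n \<Rightarrow> real \<Rightarrow> real \<Rightarrow> real ^ 'n \<Rightarrow> int ^ 'n \<Rightarrow> bool" where
  "resonant_index q k \<delta> t j \<longleftrightarrow>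
     Pt j t \<in> Sq q k (real CARD('n) - 2 + \<delta>) \<and>
     \<bar>(pt (j - q) t)\<^sup>2 - (pt j t)\<^sup>2\<bar> < 4 * k powr (- real CARD('n) + 2 - \<delta>) \<and>
     (\<forall>i. i \<noteq> j \<and> i \<noteq> j - q \<longrightarrow>
        \<bar>(pt j t)\<^sup>2 - (pt i t)\<^sup>2\<bar> > 2 * k powr (- real CARD('n) + 2 - 6 * \<delta>))"

text \<open>The part of the \<open>\<rho>\<close>-neighborhood of \<open>X\<close> in \<^const>\<open>Kcell\<close> to which the index \<open>j\<close> is
  attached.\<close>

definition resonant_nbhd ::
    "int ^ 'n \<Rightarrow> real \<Rightarrow> real \<Rightarrow> (real ^ 'n) set \<Rightarrow> int ^ 'n \<Rightarrow> real \<Rightarrow> (real ^ 'n) set" where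
  "resonant_nbhd q k \<delta> X j \<rho> =
     {t \<in> Kcell. \<exists>t\<^sub>0\<in>X. resonant_index q k \<delta> t\<^sub>0 j \<and> dist t t\<^sub>0 < \<rho>}"

text \<open>The last clause, separation of the other unperturbed eigenvalues from the circles around
  \<^const>\<open>lamhat\<close>, does not follow from \<^const>\<open>resonant_index\<close>: there only the distance to
  \<open>(pt j t)\<^sup>2\<close> is controlled, while the resonance width is of larger order in \<open>k\<close> than the gap.\<close>

definition resonant_set ::
    "nat \<Rightarrow> (real ^ 'n \<Rightarrow> real) \<Rightarrow> int ^ 'n \<Rightarrow> real \<Rightarrow> real \<Rightarrow> (real ^ 'n) set \<Rightarrow> bool" where
  "resonant_set l V q k \<delta> X \<longleftrightarrow>
     X \<subseteq> Kmap ` Sq q k (real CARD('n) - 2 + \<delta>) \<and>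
     (\<forall>t\<in>X. \<exists>j. resonant_index q k \<delta> t j) \<and>
     (\<forall>j. \<forall>t\<in>resonant_nbhd q k \<delta> X j (2 * k powr (- real CARD('n) + 1 - 7 * \<delta>)).
        \<forall>\<epsilon>\<in>{1, -1}. \<forall>z. cmod (z - complex_of_real (lamhat l V q \<epsilon> j t)) = radius_d V q \<longrightarrow>
          (\<forall>m. m \<noteq> j \<and> m \<noteq> j - q \<longrightarrow>
             2 * cmod (complex_of_real (pt m t ^ (2 * l)) - z)
               \<ge> k powr (2 * real l - real CARD('n) - 6 * \<delta>)))"

end

theory Submission
  imports Defs
begin

text \<open>
  Since \<open>\<lambda>\<^sup>\<plusminus> = \<Lambda>\<close> on the surface, it is enough that \<open>\<lambda>\<^sup>\<plusminus>(t)\<close> and the model eigenvalue differ by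
  \<open>O(k powr (-\<gamma>))\<close> and that the model eigenvalue grows at rate \<open>k ^ (2 * l - 1)\<close> along the ray through
  \<open>Pt j t\<close>; the intermediate value theorem on that ray gives the point of the model surface.

  For the first part, all operators are majorized entrywise by nonnegative matrices, measured by weighted
  column sums with weight 1 on \<open>J = {j, j - q}\<close> and \<open>sqrt g\<close> off \<open>J\<close>, where \<open>g\<close> is the
  gap between the circle and the other diagonal entries. In this norm resolvent times perturbation has size
  \<open>\<kappa> = O(\<eta> + 1 / sqrt g)\<close>, where \<open>\<eta>\<close> is the distance from \<open>W\<close> to \<open>V\<close>, because the block of
  \<open>V\<close> on \<open>J\<close> belongs to the model operator. A contour integral only sees those closed paths of
  the \<open>r\<close>-th power that pass through \<open>J\<close>, as all other terms are holomorphic in the disc; cyclicity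
  of the trace bounds their sum by \<open>r * 2 * \<kappa> ^ r\<close>, so no trace norm of the resolvent is needed. The same
  norm makes the column of the spectral projection summable and Lipschitz in \<open>W\<close>, so that the iteration
  is a contraction in the Wiener algebra and its limit stays at distance \<open>\<eta> = O(\<bar>\<sigma>\<bar> * \<bar>A\<bar>\<^sup>2)\<close> from \<open>V\<close>.
\<close>

section \<open>Nonnegative matrices and weighted column sums\<close>

text \<open>\<open>zmult\<close> is an \<open>infsum\<close>, which is 0 on non-summable families,
  so its products are in general neither associative nor distributive. Majorants therefore live in
  \<open>ennreal\<close>, where Tonelli makes every regrouping unconditional; finiteness is asked
  for only where a difference of two products has to be split. The weight \<open>sqrt g\<close> is
  the balanced choice. A step of the perturbation that leaves \<open>J\<close> is damped by the
  resolvent entry \<open>1 / g\<close> and charged \<open>sqrt g\<close>; a step that enters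
  \<open>J\<close> meets a resolvent entry of order \<open>1 / d\<close> but is divided by
  \<open>sqrt g\<close>. Both cost \<open>1 / sqrt g\<close>. With
  \<open>g = k powr \<beta> / 2\<close> this is of order \<open>k powr (- \<beta> / 2)\<close>, and
  \<open>\<beta> / 2\<close> is \<open>\<gamma>\<^sub>1 + \<delta>\<close>; the nonlinear term
  contributes \<open>k powr (- \<gamma>\<^sub>2)\<close>. Hence the minimum in
  \<open>\<gamma>\<close>. The radius \<open>d\<close> varies with \<open>q\<close>, but it lies
  between a positive minimum over the finitely many nonzero Fourier coefficients of \<open>V\<close>
  and \<open>star_norm V\<close>; this is why one constant serves all \<open>q\<close>.\<close>

abbreviation esum :: "('a \<Rightarrow> ennreal) \<Rightarrow> ennreal" where
  "esum f \<equiv> integral\<^sup>N (count_space UNIV) f"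

lemma esum_swap: "esum (\<lambda>x. esum (\<lambda>y. f x y)) = esum (\<lambda>y. esum (\<lambda>x. f x y))"
  using nn_integral_fst_count_space[of "\<lambda>(x, y). f x y"]
    nn_integral_snd_count_space[of "\<lambda>(x, y). f x y"] by simp

lemma esum_point_le: "f x \<le> esum f"
  by (rule nn_integral_ge_point) simp

lemma esum_mono: "(\<And>x. f x \<le> g x) \<Longrightarrow> esum f \<le> esum g"
  by (rule nn_integral_mono)

lemma esum_pair: "esum (\<lambda>(x, y). f x y) = esum (\<lambda>x. esum (\<lambda>y. f x y))"
  using nn_integral_fst_count_space[of "\<lambda>(x, y). f x y"] by simp

lemma summable_esumI:
  fixes f :: "'a \<Rightarrow> 'b::banach"
  assumes "esum (\<lambda>x. ennreal (norm (f x))) < \<infinity>"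
  shows "(\<lambda>x. norm (f x)) summable_on UNIV" "f summable_on UNIV"
proof -
  obtain B where B: "esum (\<lambda>x. ennreal (norm (f x))) = ennreal B" "B \<ge> 0"
    using assms by (metis ennreal_cases less_irrefl infinity_ennreal_def)
  have "sum (\<lambda>x. norm (f x)) F \<le> B" if "finite F" for F
  proof -
    have "ennreal (sum (\<lambda>x. norm (f x)) F) = (\<integral>\<^sup>+x. ennreal (norm (f x)) \<partial>count_space F)"
      by (simp add: nn_integral_count_space_finite that)
    also have "\<dots> \<le> ennreal B"
      unfolding B(1)[symmetric]
      by (subst nn_integral_count_space_indicator) (auto intro!: nn_integral_mono split: split_indicator simp: NO_MATCH_def)
    finally show ?thesis using B(2) by (simp add: ennreal_le_iff)
  qed
  then show "(\<lambda>x. norm (f x)) summable_on UNIV"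
    by (intro nonneg_bdd_above_summable_on) (auto intro!: bdd_aboveI)
  then show "f summable_on UNIV"
    by (rule abs_summable_summable)
qed

lemma esum_eq_infsum:
  fixes f :: "'a \<Rightarrow> real"
  assumes "f summable_on UNIV" "\<And>x. f x \<ge> 0"
  shows "esum (\<lambda>x. ennreal (f x)) = ennreal (infsum f UNIV)"
proof -
  have "(\<lambda>x. norm (f x)) summable_on UNIV"
    using assms by simp
  then have a: "Infinite_Set_Sum.abs_summable_on f UNIV"
    using abs_summable_equivalent by blast
  then have "esum (\<lambda>x. ennreal (f x)) = ennreal (infsetsum f UNIV)"
    unfolding infsetsum_def abs_summable_on_def
    by (intro nn_integral_eq_integral) (use assms in auto)
  then show ?thesis
    using infsetsum_infsum[OF a] by simp
qed

text \<open>Summability can stay open: a divergent \<open>esum\<close> equals \<open>top\<close> and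
  bounds everything.\<close>

lemma infsum_le_esum:
  fixes f :: "'a \<Rightarrow> 'b::banach"
  shows "ennreal (norm (infsum f UNIV)) \<le> esum (\<lambda>x. ennreal (norm (f x)))"
proof (cases "esum (\<lambda>x. ennreal (norm (f x))) < \<infinity>")
  case True
  from summable_esumI(1)[OF this]
  show ?thesis
    by (subst esum_eq_infsum) (auto intro!: ennreal_leI norm_infsum_bound)
qed (simp add: not_less top_unique)

lemma suminf_le_esum:
  fixes f :: "nat \<Rightarrow> 'b::banach"
  assumes "(\<Sum>i. ennreal (norm (f i))) < \<infinity>"
  shows "summable f" "ennreal (norm (suminf f)) \<le> (\<Sum>i. ennreal (norm (f i)))"
proof -
  have s: "summable (\<lambda>i. norm (f i))"
    using assms by (intro summable_suminf_not_top) auto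
  show "summable f" using s by (rule summable_norm_cancel)
  show "ennreal (norm (suminf f)) \<le> (\<Sum>i. ennreal (norm (f i)))"
    using s by (subst suminf_ennreal2) (auto intro!: ennreal_leI summable_norm)
qed


section \<open>Algebra of matrices with entries in [0, infinity]\<close>

type_synonym 'i emat = "'i \<Rightarrow> 'i \<Rightarrow> ennreal"

definition emult :: "'i emat \<Rightarrow> 'i emat \<Rightarrow> 'i emat" where
  "emult a b s r = esum (\<lambda>m. a s m * b m r)"

definition eadd :: "'i emat \<Rightarrow> 'i emat \<Rightarrow> 'i emat" where
  "eadd a b s r = a s r + b s r"

definition eone :: "'i emat" where
  "eone s r = (if s = r then 1 else 0)"

primrec epow :: "'i emat \<Rightarrow> nat \<Rightarrow> 'i emat" where
  "epow a 0 = eone"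
| "epow a (Suc n) = emult a (epow a n)"

lemma emult_assoc: "emult (emult a b) c = emult a (emult b c)"
  unfolding emult_def
  by (intro ext, simp add: nn_integral_cmult[symmetric] nn_integral_multc[symmetric] mult.assoc)
    (rule esum_swap)

lemma esum_delta: "esum (\<lambda>m. (if m = s then f m else 0)) = f s"
proof -
  have "esum (\<lambda>m. (if m = s then f m else 0)) = (\<Sum>m\<in>{s}. if m = s then f m else 0)"
    by (rule nn_integral_count_space') auto
  then show ?thesis by simp
qed

lemma emult_eone_left [simp]: "emult eone a = a"
proof (intro ext)
  fix s r
  have "emult eone a s r = esum (\<lambda>m. (if m = s then a m r else 0))"
    unfolding emult_def eone_def by (intro nn_integral_cong) auto
  then show "emult eone a s r = a s r" by (simp add: esum_delta)
qed

lemma emult_eone_right [simp]: "emult a eone = a"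
proof (intro ext)
  fix s r
  have "emult a eone s r = esum (\<lambda>m. (if m = r then a s m else 0))"
    unfolding emult_def eone_def by (intro nn_integral_cong) auto
  then show "emult a eone s r = a s r" by (simp add: esum_delta)
qed

lemma epow_Suc2: "epow a (Suc n) = emult (epow a n) a"
  by (induction n) (simp_all add: emult_assoc[symmetric])

lemma epow_add: "epow a (m + n) = emult (epow a m) (epow a n)"
  by (induction m) (simp_all add: emult_assoc)

lemma emult_mono: "a \<le> a' \<Longrightarrow> b \<le> b' \<Longrightarrow> emult a b \<le> emult a' b'"
  unfolding emult_def le_fun_def by (auto intro!: esum_mono mult_mono)

lemma epow_mono: "a \<le> a' \<Longrightarrow> epow a n \<le> epow a' n"
  by (induction n) (auto intro: emult_mono)

lemma emult_eadd_left: "emult (eadd a b) c = eadd (emult a c) (emult b c)"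
  unfolding emult_def eadd_def by (simp add: distrib_right nn_integral_add)

lemma emult_eadd_right: "emult a (eadd b c) = eadd (emult a b) (emult a c)"
  unfolding emult_def eadd_def by (simp add: distrib_left nn_integral_add)


text \<open>\<open>B\<close> bounds the norm of \<open>a\<close> as an operator on the
  \<open>w\<close>-weighted \<open>l^1\<close> space; on such spaces it is enough to test unit
  vectors, that is, columns.\<close>

definition col_bound :: "('i \<Rightarrow> ennreal) \<Rightarrow> 'i emat \<Rightarrow> ennreal \<Rightarrow> bool" where
  "col_bound w a B \<longleftrightarrow> (\<forall>r. esum (\<lambda>s. w s * a s r) \<le> B * w r)"

lemma col_bound_emult:
  assumes "col_bound w a A" "col_bound w b B"
  shows "col_bound w (emult a b) (A * B)"
  unfolding col_bound_def
proof
  fix r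
  have "esum (\<lambda>s. w s * emult a b s r) = esum (\<lambda>s. esum (\<lambda>m. (w s * a s m) * b m r))"
    unfolding emult_def by (simp add: nn_integral_cmult[symmetric] mult.assoc)
  also have "\<dots> = esum (\<lambda>m. esum (\<lambda>s. (w s * a s m) * b m r))"
    by (rule esum_swap)
  also have "\<dots> = esum (\<lambda>m. esum (\<lambda>s. (w s * a s m)) * b m r)"
    by (simp add: nn_integral_multc)
  also have "\<dots> \<le> esum (\<lambda>m. (A * w m) * b m r)"
    using assms(1) by (intro esum_mono mult_right_mono) (auto simp: col_bound_def)
  also have "\<dots> = A * esum (\<lambda>m. w m * b m r)"
    by (simp add: nn_integral_cmult mult.assoc)
  also have "\<dots> \<le> A * (B * w r)"
    using assms(2) by (intro mult_left_mono) (auto simp: col_bound_def)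
  finally show "esum (\<lambda>s. w s * emult a b s r) \<le> A * B * w r"
    by (simp add: mult.assoc)
qed

lemma col_bound_eone: "col_bound w eone 1"
  unfolding col_bound_def
proof
  fix r
  have "esum (\<lambda>s. w s * eone s r) = esum (\<lambda>s. if s = r then w s else 0)"
    unfolding eone_def by (intro nn_integral_cong) auto
  then show "esum (\<lambda>s. w s * eone s r) \<le> 1 * w r" by (simp add: esum_delta)
qed

lemma col_bound_epow: "col_bound w a A \<Longrightarrow> col_bound w (epow a n) (A ^ n)"
  by (induction n) (auto intro: col_bound_emult col_bound_eone)

lemma col_bound_eadd:
  "col_bound w a A \<Longrightarrow> col_bound w b B \<Longrightarrow> col_bound w (eadd a b) (A + B)"
  unfolding col_bound_def eadd_def
  by (auto simp: distrib_left distrib_right nn_integral_add intro!: add_mono)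

lemma col_bound_mono:
  "col_bound w a A \<Longrightarrow> b \<le> a \<Longrightarrow> A \<le> B \<Longrightarrow> col_bound w b B"
  unfolding col_bound_def
proof
  fix r
  assume *: "\<forall>r. esum (\<lambda>s. w s * a s r) \<le> A * w r" "b \<le> a" "A \<le> B"
  have "esum (\<lambda>s. w s * b s r) \<le> esum (\<lambda>s. w s * a s r)"
    using *(2) by (intro esum_mono mult_left_mono) (auto simp: le_fun_def)
  also have "\<dots> \<le> A * w r" using *(1) by blast
  also have "\<dots> \<le> B * w r" using *(3) by (intro mult_right_mono) auto
  finally show "esum (\<lambda>s. w s * b s r) \<le> B * w r" .
qed

lemma col_bound_entry:
  assumes "col_bound w a A"
  shows "w s * a s r \<le> A * w r"
  using assms esum_point_le[of "\<lambda>s. w s * a s r" s] unfolding col_bound_def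
  by (meson order_trans)

text \<open>On the diagonal the two weights cancel, so traces are bounded by the operator norm
  without any ratio of weights.\<close>

lemma col_bound_diag:
  assumes "col_bound w a A" "w s \<noteq> 0" "w s < \<infinity>"
  shows "a s s \<le> A"
proof -
  have "w s * a s s \<le> w s * A"
    using col_bound_entry[OF assms(1), of s s] by (simp add: mult.commute)
  then show ?thesis
    using assms(2,3) by (simp add: ennreal_mult_le_mult_iff)
qed


text \<open>Majorant of \<open>T ^ n - T' ^ n\<close> when \<open>a'\<close>, \<open>c\<close> and \<open>a\<close> majorize
  \<open>T'\<close>, \<open>T - T'\<close> and \<open>T\<close>.\<close>

primrec epow_diff :: "'i emat \<Rightarrow> 'i emat \<Rightarrow> 'i emat \<Rightarrow> nat \<Rightarrow> 'i emat" where
  "epow_diff a' c a 0 = (\<lambda>s r. 0)"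
| "epow_diff a' c a (Suc n) = eadd (emult a' (epow_diff a' c a n)) (emult c (epow a n))"

lemma col_bound_epow_diff:
  assumes "col_bound w a' K" "col_bound w a K" "col_bound w c B"
  shows "col_bound w (epow_diff a' c a n) (of_nat n * K ^ (n - 1) * B)"
proof (induction n)
  case 0
  show ?case by (simp add: col_bound_def)
next
  case (Suc n)
  have "col_bound w (epow_diff a' c a (Suc n)) (K * (of_nat n * K ^ (n - 1) * B) + B * K ^ n)"
    using col_bound_eadd[OF col_bound_emult[OF assms(1) Suc.IH]
        col_bound_emult[OF assms(3) col_bound_epow[OF assms(2)]]] by simp
  moreover have "K * (of_nat n * K ^ (n - 1) * B) + B * K ^ n = of_nat (Suc n) * K ^ n * B"
    by (cases n) (simp_all add: distrib_left distrib_right mult_ac)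
  ultimately show ?case by simp
qed

definition etrace :: "'i emat \<Rightarrow> ennreal" where
  "etrace a = esum (\<lambda>s. a s s)"

lemma etrace_emult: "etrace (emult a b) = etrace (emult b a)"
  unfolding etrace_def emult_def by (subst esum_swap) (simp add: mult.commute)

text \<open>A closed path through the rows of \<open>c\<close> is counted, by cyclicity, from a point of \<open>J\<close>.\<close>

lemma etrace_epow_diff:
  assumes K: "col_bound w a K" and a: "a = eadd a' c"
    and J: "finite J" "\<And>s r. s \<notin> J \<Longrightarrow> c s r = 0" "\<And>s. s \<in> J \<Longrightarrow> w s \<noteq> 0 \<and> w s < \<infinity>"
  shows "etrace (emult (epow a' i) (epow_diff a' c a n)) \<le> of_nat n * of_nat (card J) * K ^ (n + i)"
proof (induction n arbitrary: i)
  case 0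
  show ?case by (simp add: etrace_def emult_def)
next
  case (Suc n)
  have le: "a' \<le> a" "c \<le> a"
    unfolding a eadd_def le_fun_def by auto
  \<comment> \<open>This is the new term of the telescoping difference. After the rotation
    \<open>c\<close> stands first, and its vanishing rows leave only \<open>card J\<close> diagonal
    entries.\<close>
  have "etrace (emult (epow a' i) (emult c (epow a n))) = etrace (emult c (emult (epow a n) (epow a' i)))"
    by (subst etrace_emult) (simp add: emult_assoc)
  also have "\<dots> = (\<Sum>s\<in>J. emult c (emult (epow a n) (epow a' i)) s s)"
    unfolding etrace_def
    by (rule nn_integral_count_space') (use J in \<open>auto simp: emult_def\<close>)
  also have "\<dots> \<le> (\<Sum>s\<in>J. epow a (Suc n + i) s s)"
  proof (rule sum_mono)
    fix s
    have "emult c (emult (epow a n) (epow a' i)) \<le> emult a (emult (epow a n) (epow a i))"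
      using le by (intro emult_mono epow_mono) auto
    then show "emult c (emult (epow a n) (epow a' i)) s s \<le> epow a (Suc n + i) s s"
      by (simp add: epow_add le_fun_def)
  qed
  also have "\<dots> \<le> (\<Sum>s\<in>J. K ^ (Suc n + i))"
    using J(3) by (intro sum_mono col_bound_diag[OF col_bound_epow[OF K]]) auto
  finally have 1: "etrace (emult (epow a' i) (emult c (epow a n))) \<le> of_nat (card J) * K ^ (Suc n + i)"
    by simp
  have 2: "etrace (emult (epow a' (Suc i)) (epow_diff a' c a n)) \<le> of_nat n * of_nat (card J) * K ^ (n + Suc i)"
    by (rule Suc.IH)
  have "emult (epow a' i) (epow_diff a' c a (Suc n)) =
     eadd (emult (epow a' (Suc i)) (epow_diff a' c a n)) (emult (epow a' i) (emult c (epow a n)))"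
    by (simp add: emult_eadd_right epow_Suc2 emult_assoc del: epow.simps)
  then have "etrace (emult (epow a' i) (epow_diff a' c a (Suc n))) =
     etrace (emult (epow a' (Suc i)) (epow_diff a' c a n)) + etrace (emult (epow a' i) (emult c (epow a n)))"
    unfolding etrace_def eadd_def by (simp add: nn_integral_add)
  also have "\<dots> \<le> of_nat n * of_nat (card J) * K ^ (n + Suc i) + of_nat (card J) * K ^ (Suc n + i)"
    using 1 2 by (rule add_mono[rotated])
  finally show ?case by (simp add: ring_distribs add.commute)
qed

section \<open>Majorized families of operators\<close>

text \<open>Admissible weights and a finite bound together force finite entries, which is what
  permits splitting an \<open>infsum\<close> of differences.\<close>

definition col_bounded :: "('i \<Rightarrow> ennreal) \<Rightarrow> 'i emat \<Rightarrow> bool" where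
  "col_bounded w a \<longleftrightarrow> (\<forall>s. w s \<noteq> 0 \<and> w s \<noteq> top) \<and> (\<exists>A. A \<noteq> top \<and> col_bound w a A)"

lemma col_bounded_finite:
  assumes "col_bounded w a"
  shows "a s r \<noteq> top"
proof
  assume top: "a s r = top"
  obtain A where A: "A \<noteq> top" "col_bound w a A" and w: "w s \<noteq> 0" "w r \<noteq> top"
    using assms unfolding col_bounded_def by blast
  have "w s * a s r \<le> A * w r" by (rule col_bound_entry[OF A(2)])
  also have "\<dots> < top" using A(1) w(2) by (auto simp: ennreal_mult_less_top less_top)
  finally show False using top w(1) by (simp add: ennreal_mult_eq_top_iff)
qed

lemma col_bounded_emult: "col_bounded w a \<Longrightarrow> col_bounded w b \<Longrightarrow> col_bounded w (emult a b)"
  unfolding col_bounded_def using col_bound_emult[of w a _ b]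
  by (metis ennreal_mult_eq_top_iff)

lemma col_bounded_epow: "col_bounded w a \<Longrightarrow> col_bounded w (epow a n)"
proof (induction n)
  case 0
  then show ?case unfolding col_bounded_def epow.simps
    using col_bound_eone[of w] ennreal_one_neq_top by blast
qed (auto intro: col_bounded_emult)



definition majorized :: "'n zmat \<Rightarrow> (int ^ 'n) emat \<Rightarrow> bool" where
  "majorized M a \<longleftrightarrow> (\<forall>s r. ennreal (cmod (M s r)) \<le> a s r)"

lemma majorized_esum:
  assumes "majorized M a" "majorized N b"
  shows "esum (\<lambda>m. ennreal (cmod (M s m * N m r))) \<le> emult a b s r"
  unfolding emult_def using assms
  by (intro esum_mono) (auto simp: norm_mult ennreal_mult majorized_def intro!: mult_mono)

lemma zmult_summable:
  assumes "majorized M a" "majorized N b" "emult a b s r \<noteq> top"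
  shows "(\<lambda>m. M s m * N m r) summable_on UNIV"
  using majorized_esum[OF assms(1,2), of s r] assms(3)
  by (intro summable_esumI(2)) (simp add: less_top[symmetric] top_unique neq_top_trans)

lemma majorized_zmult:
  assumes "majorized M a" "majorized N b"
  shows "majorized (zmult M N) (emult a b)"
  unfolding majorized_def zmult_def[abs_def]
  using order_trans[OF infsum_le_esum majorized_esum[OF assms]] by blast

lemma majorized_zone: "majorized zone eone"
  unfolding majorized_def zone_def eone_def by auto

lemma majorized_zpow: "majorized T a \<Longrightarrow> majorized (zpow T n) (epow a n)"
  by (induction n) (auto intro: majorized_zmult majorized_zone)

lemma majorized_add:
  assumes "majorized M a" "majorized N b"
  shows "majorized (\<lambda>s r. M s r + N s r) (eadd a b)"
  unfolding majorized_def eadd_def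
proof (intro allI)
  fix s r
  have "ennreal (cmod (M s r + N s r)) \<le> ennreal (cmod (M s r)) + ennreal (cmod (N s r))"
    by (simp add: ennreal_leI norm_triangle_ineq flip: ennreal_plus)
  also have "\<dots> \<le> a s r + b s r"
    using assms by (intro add_mono) (auto simp: majorized_def)
  finally show "ennreal (cmod (M s r + N s r)) \<le> a s r + b s r" .
qed

lemma infsum_diff:
  fixes f g :: "'a \<Rightarrow> 'b::banach"
  assumes "f summable_on A" "g summable_on A"
  shows "(\<Sum>\<^sub>\<infinity>x\<in>A. f x - g x) = infsum f A - infsum g A"
  using infsum_add[of f A "\<lambda>x. - g x"] assms by (simp add: infsum_uminus summable_on_uminus)

lemma zmult_diff_right:
  assumes "majorized M a" "majorized N b" "majorized N' b'"
    "emult a b s r \<noteq> top" "emult a b' s r \<noteq> top"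
  shows "zmult M (\<lambda>s r. N s r - N' s r) s r = zmult M N s r - zmult M N' s r"
  unfolding zmult_def right_diff_distrib
  by (intro infsum_diff zmult_summable[OF assms(1,2,4)] zmult_summable[OF assms(1,3,5)])

lemma zmult_diff_left:
  assumes "majorized N b" "majorized M a" "majorized M' a'"
    "emult a b s r \<noteq> top" "emult a' b s r \<noteq> top"
  shows "zmult (\<lambda>s r. M s r - M' s r) N s r = zmult M N s r - zmult M' N s r"
  unfolding zmult_def left_diff_distrib
  by (intro infsum_diff zmult_summable[OF assms(2,1,4)] zmult_summable[OF assms(3,1,5)])

text \<open>The recursion of \<open>epow_diff\<close> mirrors T^(n+1) - T'^(n+1) = T' (T^n - T'^n) +
  (T - T') T^n. The column bounds supply the summability behind this identity.\<close>

lemma majorized_zpow_diff: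
  assumes T: "majorized T a" and T': "majorized T' a'" and D: "majorized (\<lambda>s r. T s r - T' s r) c"
    and b: "col_bounded w a" "col_bounded w a'" "col_bounded w c"
  shows "majorized (\<lambda>s r. zpow T n s r - zpow T' n s r) (epow_diff a' c a n)"
proof (induction n)
  case 0
  show ?case by (simp add: majorized_def)
next
  case (Suc n)
  let ?P = "zpow T n" and ?P' = "zpow T' n"
  note P = majorized_zpow[OF T, of n] and P' = majorized_zpow[OF T', of n]
  have fin: "emult a' (epow a n) s r \<noteq> top" "emult a' (epow a' n) s r \<noteq> top"
    "emult a (epow a n) s r \<noteq> top" for s r
    by (intro col_bounded_finite[of w] col_bounded_emult col_bounded_epow b)+
  have "zpow T (Suc n) s r - zpow T' (Suc n) s r =
      zmult T' (\<lambda>s r. ?P s r - ?P' s r) s r + zmult (\<lambda>s r. T s r - T' s r) ?P s r" for s r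
    by (simp add: zmult_diff_right[OF T' P P' fin(1,2)] zmult_diff_left[OF P T T' fin(3,1)])
  then show ?case
    by (auto intro!: majorized_add majorized_zmult Suc.IH T' D P)
qed


text \<open>One predicate for two uses: a circle has empty interior, so there only continuity is
  asserted, while on a closed disc it means holomorphic inside and continuous up to the
  boundary.\<close>

definition majorized_on :: "complex set \<Rightarrow> (complex \<Rightarrow> 'n zmat) \<Rightarrow> (int ^ 'n) emat \<Rightarrow> bool" where
  "majorized_on S F a \<longleftrightarrow> (\<forall>z\<in>S. majorized (F z) a) \<and>
     (\<forall>s r. continuous_on S (\<lambda>z. F z s r) \<and> (\<lambda>z. F z s r) holomorphic_on interior S)"

text \<open>Weierstrass M-test along the filter of finite partial sums. Continuity passes to the
  uniform limit on \<open>S\<close>, holomorphy on small closed balls inside the interior.\<close>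

lemma infsum_continuous_holomorphic:
  fixes f :: "'i \<Rightarrow> complex \<Rightarrow> complex"
  assumes f: "\<And>m. continuous_on S (f m)" "\<And>m. f m holomorphic_on interior S"
    and M: "\<And>m z. z \<in> S \<Longrightarrow> ennreal (cmod (f m z)) \<le> M m" "esum M \<noteq> top"
  shows "continuous_on S (\<lambda>z. \<Sum>\<^sub>\<infinity>m. f m z) \<and> (\<lambda>z. \<Sum>\<^sub>\<infinity>m. f m z) holomorphic_on interior S"
proof -
  have fin: "M m \<noteq> top" for m
    using esum_point_le[of M m] M(2) by (auto simp: top_unique)
  then have M': "M m = ennreal (enn2real (M m))" for m
    by (simp add: less_top)
  have sm: "(\<lambda>m. enn2real (M m)) summable_on UNIV"
    using M(2) by (intro summable_esumI(2)) (simp add: M'[symmetric] less_top)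
  have le: "cmod (f m z) \<le> enn2real (M m)" if "z \<in> S" for m z
    using M(1)[OF that, of m] by (subst (asm) M') simp
  have ul: "uniform_limit S (\<lambda>X z. \<Sum>m\<in>X. f m z) (\<lambda>z. \<Sum>\<^sub>\<infinity>m. f m z) (finite_subsets_at_top UNIV)"
    by (rule Weierstrass_m_test_general[OF le sm])
  have "continuous_on S (\<lambda>z. \<Sum>\<^sub>\<infinity>m. f m z)"
    by (rule uniform_limit_theorem[OF _ ul]) (auto intro!: always_eventually continuous_on_sum f)
  moreover have "(\<lambda>z. \<Sum>\<^sub>\<infinity>m. f m z) holomorphic_on interior S"
  proof -
    have "\<exists>e>0. (\<lambda>z. \<Sum>\<^sub>\<infinity>m. f m z) holomorphic_on ball z e" if z: "z \<in> interior S" for z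
    proof -
      obtain e where e: "e > 0" "cball z e \<subseteq> interior S"
        using z open_contains_cball[of "interior S"] by auto
      then have eS: "cball z e \<subseteq> S" using interior_subset by blast
      show ?thesis
      proof (rule holomorphic_uniform_limit[of z e "\<lambda>X z. \<Sum>m\<in>X. f m z" "finite_subsets_at_top UNIV"])
        show "\<forall>\<^sub>F X in finite_subsets_at_top UNIV. continuous_on (cball z e) (\<lambda>z. \<Sum>m\<in>X. f m z) \<and>
            (\<lambda>z. \<Sum>m\<in>X. f m z) holomorphic_on ball z e"
          using e eS ball_subset_cball[of z e]
          by (intro always_eventually allI conjI continuous_on_sum holomorphic_on_sum
              continuous_on_subset[OF f(1)] holomorphic_on_subset[OF f(2)]) auto
        show "uniform_limit (cball z e) (\<lambda>X z. \<Sum>m\<in>X. f m z) (\<lambda>z. \<Sum>\<^sub>\<infinity>m. f m z) (finite_subsets_at_top UNIV)"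
          using ul eS by (rule uniform_limit_on_subset)
      qed (use e in auto)
    qed
    then show ?thesis
      by (metis (no_types, lifting) analytic_imp_holomorphic analytic_on_def)
  qed
  ultimately show ?thesis ..
qed

lemma majorized_on_zmult:
  assumes "majorized_on S F a" "majorized_on S G b" "\<And>s r. emult a b s r \<noteq> top"
  shows "majorized_on S (\<lambda>z. zmult (F z) (G z)) (emult a b)"
proof -
  have "continuous_on S (\<lambda>z. \<Sum>\<^sub>\<infinity>m. F z s m * G z m r) \<and>
      (\<lambda>z. \<Sum>\<^sub>\<infinity>m. F z s m * G z m r) holomorphic_on interior S" for s r
  proof (rule infsum_continuous_holomorphic)
    show "esum (\<lambda>m. a s m * b m r) \<noteq> top"
      using assms(3)[of s r] by (simp add: emult_def)
    show "ennreal (cmod (F z s m * G z m r)) \<le> a s m * b m r" if "z \<in> S" for m z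
      using assms(1,2) that
      by (auto simp: norm_mult ennreal_mult majorized_on_def majorized_def intro!: mult_mono)
  qed (use assms in \<open>auto simp: majorized_on_def intro!: continuous_intros holomorphic_intros\<close>)
  with assms show ?thesis
    by (auto simp: majorized_on_def zmult_def intro!: majorized_zmult)
qed

lemma majorized_on_zpow:
  assumes "majorized_on S T a" "col_bounded w a"
  shows "majorized_on S (\<lambda>z. zpow (T z) n) (epow a n)"
proof (induction n)
  case 0
  show ?case by (auto simp: majorized_on_def majorized_zone)
next
  case (Suc n)
  have "majorized_on S (\<lambda>z. zmult (T z) (zpow (T z) n)) (emult a (epow a n))"
    by (rule majorized_on_zmult[OF assms(1) Suc.IH])
      (intro col_bounded_finite[of w] col_bounded_emult col_bounded_epow assms(2))
  then show ?case by simp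
qed

lemma majorized_on_subset: "majorized_on S F a \<Longrightarrow> S' \<subseteq> S \<Longrightarrow> majorized_on S' F a"
  unfolding majorized_on_def
  by (meson continuous_on_subset holomorphic_on_subset interior_mono subsetD)

lemma contour_integrable_majorized:
  assumes "majorized_on (sphere c d) F a" "d > 0"
  shows "(\<lambda>z. F z s r) contour_integrable_on circlepath c d"
  using assms by (intro contour_integrable_continuous_circlepath) (auto simp: majorized_on_def)

text \<open>The degenerate cases agree with the bound: the contour integral of a non-integrable
  function is 0 by convention, and an infinite majorant stays infinite because
  \<open>d > 0\<close>.\<close>

lemma contour_integral_majorized:
  assumes "\<And>z. z \<in> sphere c d \<Longrightarrow> majorized (F z) a" "d > 0"
  shows "ennreal (cmod (contour_integral (circlepath c d) (\<lambda>z. F z s r))) \<le> ennreal (2 * pi * d) * a s r"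
proof (cases "a s r = top \<or> \<not> (\<lambda>z. F z s r) contour_integrable_on circlepath c d")
  case True
  then show ?thesis
    using assms(2) by (auto simp: not_integrable_contour_integral ennreal_mult_top)
next
  case False
  then obtain B where B: "a s r = ennreal B" "B \<ge> 0" by (cases "a s r") auto
  have "cmod (contour_integral (circlepath c d) (\<lambda>z. F z s r)) \<le> B * (2 * pi * d)"
  proof (rule has_contour_integral_bound_circlepath)
    show "((\<lambda>z. F z s r) has_contour_integral contour_integral (circlepath c d) (\<lambda>z. F z s r)) (circlepath c d)"
      using False by (simp add: has_contour_integral_integral)
    show "cmod (F z s r) \<le> B" if "cmod (z - c) = d" for z
    proof -
      have "z \<in> sphere c d" using that by (simp add: dist_norm norm_minus_commute)
      then have "ennreal (cmod (F z s r)) \<le> ennreal B"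
        using assms(1)[of z] B(1) by (metis majorized_def)
      then show ?thesis using B(2) by simp
    qed
  qed (use assms B in auto)
  then show ?thesis
    using assms(2) B by (simp add: mult.commute flip: ennreal_mult)
qed

text \<open>Cauchy's theorem with mere continuity on the circle itself: the integral formula at the
  center is applied to \<open>F\<close> times \<open>u - c\<close>, whose value there is 0.\<close>

lemma contour_integral_disc_zero:
  assumes "majorized_on (cball c d) F a" "d > 0"
  shows "contour_integral (circlepath c d) (\<lambda>z. F z s r) = 0"
proof -
  have F: "continuous_on (cball c d) (\<lambda>z. F z s r)" "(\<lambda>z. F z s r) holomorphic_on ball c d"
    using assms by (auto simp: majorized_on_def)
  have "((\<lambda>u. F u s r * (u - c) / (u - c)) has_contour_integral 2 * of_real pi * \<i> * (F c s r * (c - c)))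
      (circlepath c d)"
    by (rule Cauchy_integral_circlepath) (use F assms in \<open>auto intro!: continuous_intros holomorphic_intros\<close>)
  then have "((\<lambda>z. F z s r) has_contour_integral 2 * of_real pi * \<i> * (F c s r * (c - c))) (circlepath c d)"
    by (rule has_contour_integral_eq) (use assms in auto)
  then have "((\<lambda>z. F z s r) has_contour_integral 0) (circlepath c d)"
    by simp
  then show ?thesis by (rule contour_integral_unique)
qed

section \<open>Fourier series and the Wiener algebra\<close>

lemma lborel_integral_prod:
  fixes f :: "'a::euclidean_space \<Rightarrow> real \<Rightarrow> complex"
  assumes f: "\<And>b. b \<in> Basis \<Longrightarrow> integrable lborel (f b)"
  shows "(\<integral>x. (\<Prod>b\<in>Basis. f b (x \<bullet> b)) \<partial>lborel) = (\<Prod>b\<in>Basis. \<integral>x. f b x \<partial>lborel)"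
proof -
  interpret product_sigma_finite "\<lambda>_::'a. lborel :: real measure"
    by unfold_locales
  have [measurable]: "f b \<in> borel_measurable borel" if "b \<in> Basis" for b
    using borel_measurable_integrable[OF f[OF that]] by simp
  have "(\<integral>x. (\<Prod>b\<in>Basis. f b (x \<bullet> b)) \<partial>lborel) =
      (\<integral>x. (\<Prod>b\<in>Basis. f b ((\<Sum>b'\<in>Basis. x b' *\<^sub>R b') \<bullet> b)) \<partial>(\<Pi>\<^sub>M b\<in>(Basis::'a set). lborel))"
    by (subst lborel_eq, subst integral_distr) auto
  also have "\<dots> = (\<integral>x. (\<Prod>b\<in>Basis. f b (x b)) \<partial>(\<Pi>\<^sub>M b\<in>(Basis::'a set). lborel))"
    by (intro Bochner_Integration.integral_cong refl prod.cong) (simp add: inner_sum_left_Basis)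
  also have "\<dots> = (\<Prod>b\<in>Basis. \<integral>x. f b x \<partial>lborel)"
    by (rule product_integral_prod) (use f in auto)
  finally show ?thesis .
qed

lemma cis_sum: "finite A \<Longrightarrow> cis (\<Sum>x\<in>A. f x) = (\<Prod>x\<in>A. cis (f x))"
  by (induction A rule: finite_induct) (auto simp: cis_mult[symmetric])

lemma rvec_simps [simp]:
  "rvec (m + n) = rvec m + rvec n" "rvec (m - n) = rvec m - rvec n" "rvec (- m) = - rvec m" "rvec 0 = 0"
  "rvec m = rvec n \<longleftrightarrow> m = n"
  by (simp_all add: rvec_def vec_eq_iff)

lemma integral_cis_period:
  fixes n :: int
  shows "integral {0..2 * pi} (\<lambda>x. cis (n * x)) = (if n = 0 then 2 * pi else 0)"
proof (cases "n = 0")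
  case False
  have "((\<lambda>x. cis (n * x)) has_integral
      cis (n * (2 * pi)) / (\<i> * n) - cis (real_of_int n * 0) / (\<i> * n)) {0..2 * pi}"
  proof (rule fundamental_theorem_of_calculus)
    fix x :: real
    have "((\<lambda>z. exp (\<i> * n * z) / (\<i> * n)) has_field_derivative exp (\<i> * n * of_real x)) (at (of_real x))"
      using False by (auto intro!: derivative_eq_intros)
    from has_vector_derivative_real_field[OF this]
    show "((\<lambda>x. cis (n * x) / (\<i> * n)) has_vector_derivative cis (n * x)) (at x within {0..2 * pi})"
      by (simp add: cis_conv_exp mult.assoc)
  qed simp
  moreover have "cis (n * (2 * pi)) = 1"
    using cis_multiple_2pi[of n] by (simp add: mult_ac)
  ultimately show ?thesis using False by (auto dest: integral_unique)
qed (simp add: scaleR_conv_of_real)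

text \<open>The character factorizes over the coordinates, so Fubini reduces orthogonality to one
  period in each variable.\<close>

lemma integral_Qbox_cis:
  "integral Qbox (\<lambda>x::real^'n. cis (rvec m \<bullet> x)) = (if m = 0 then (2 * pi) ^ CARD('n) else 0)"
proof -
  have int: "set_integrable lborel {0..2 * pi} (\<lambda>x. cis (c * x))" for c :: real
    unfolding set_integrable_def by (intro borel_integrable_compact continuous_intros) auto
  have ind: "indicator Qbox x = (\<Prod>b\<in>Basis. indicator {0..2 * pi} (x \<bullet> b) :: real)" for x :: "real^'n"
  proof -
    have "x \<in> Qbox \<longleftrightarrow> (\<forall>b\<in>Basis. x \<bullet> b \<in> {0..2 * pi})"
      by (auto simp: Qbox_def mem_box_cart Basis_vec_def inner_axis)
    then show ?thesis
      by (auto simp: indicator_def prod_zero_iff)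
  qed
  have "integral Qbox (\<lambda>x::real^'n. cis (rvec m \<bullet> x)) = (LINT x : Qbox | lborel. cis (rvec m \<bullet> x))"
    by (rule set_borel_integral_eq_integral(2)[symmetric])
      (auto simp: Qbox_def set_integrable_def intro!: borel_integrable_compact continuous_intros)
  also have "\<dots> = (\<integral>x. (\<Prod>b\<in>Basis. indicator {0..2 * pi} (x \<bullet> b) *\<^sub>R cis ((rvec m \<bullet> b) * (x \<bullet> b))) \<partial>lborel)"
    unfolding set_lebesgue_integral_def
  proof (intro Bochner_Integration.integral_cong refl)
    fix x :: "real^'n"
    have "cis (rvec m \<bullet> x) = (\<Prod>b\<in>Basis. cis ((rvec m \<bullet> b) * (x \<bullet> b)))"
      by (subst euclidean_inner) (simp add: cis_sum)
    then show "indicator Qbox x *\<^sub>R cis (rvec m \<bullet> x) =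
        (\<Prod>b\<in>Basis. indicator {0..2 * pi} (x \<bullet> b) *\<^sub>R cis ((rvec m \<bullet> b) * (x \<bullet> b)))"
      by (simp add: ind scaleR_conv_of_real prod.distrib)
  qed
  also have "\<dots> = (\<Prod>b\<in>Basis. LINT x : {0..2 * pi} | lborel. cis ((rvec m \<bullet> b) * x))"
    unfolding set_lebesgue_integral_def
    by (rule lborel_integral_prod) (use int in \<open>simp add: set_integrable_def\<close>)
  also have "\<dots> = (\<Prod>b\<in>Basis. integral {0..2 * pi} (\<lambda>x. cis ((rvec m \<bullet> b) * x)))"
    by (simp add: set_borel_integral_eq_integral(2)[OF int])
  also have "\<dots> = (\<Prod>b\<in>(\<lambda>i. axis i 1 :: real^'n) ` UNIV. integral {0..2 * pi} (\<lambda>x. cis ((rvec m \<bullet> b) * x)))"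
    by (intro prod.cong) (auto simp: Basis_vec_def)
  also have "\<dots> = (\<Prod>i\<in>UNIV. integral {0..2 * pi} (\<lambda>x. cis ((rvec m \<bullet> axis i 1) * x)))"
    by (subst prod.reindex) (auto simp: inj_on_def axis_eq_axis)
  also have "\<dots> = (\<Prod>i\<in>UNIV. if m $ i = 0 then complex_of_real (2 * pi) else 0)"
    by (intro prod.cong refl) (simp add: inner_axis rvec_def integral_cis_period)
  also have "\<dots> = (if m = 0 then (2 * pi) ^ CARD('n) else 0)"
    by (auto simp: vec_eq_iff)
  finally show ?thesis .
qed

text \<open>The Wiener norm on coefficient families. With values in \<open>ennreal\<close> it makes
  sense before summability is known; on \<open>star_space\<close> it agrees with
  \<open>star_norm\<close>.\<close>

definition fnorm :: "(int ^ 'n \<Rightarrow> complex) \<Rightarrow> ennreal" where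
  "fnorm c = esum (\<lambda>m. ennreal (cmod (c m)))"

lemma fnorm_triangle: "fnorm (\<lambda>m. c m + d m) \<le> fnorm c + fnorm d"
proof -
  have "fnorm (\<lambda>m. c m + d m) \<le> esum (\<lambda>m. ennreal (cmod (c m)) + ennreal (cmod (d m)))"
    unfolding fnorm_def
    by (intro esum_mono) (simp add: ennreal_leI norm_triangle_ineq flip: ennreal_plus)
  also have "\<dots> = fnorm c + fnorm d"
    by (simp add: nn_integral_add fnorm_def)
  finally show ?thesis .
qed

lemma fourier_integrable:
  fixes W :: "real ^ 'n \<Rightarrow> real"
  assumes "W absolutely_integrable_on Qbox"
  shows "(\<lambda>x. complex_of_real (W x) * cis (- (rvec m \<bullet> x))) integrable_on Qbox"
proof -
  have "(\<lambda>x. cis (- (rvec m \<bullet> x))) \<in> borel_measurable (lebesgue_on Qbox)"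
    unfolding Qbox_def
    by (intro continuous_imp_measurable_on_sets_lebesgue continuous_intros) auto
  moreover have "(\<lambda>x. complex_of_real (W x)) absolutely_integrable_on Qbox"
    using absolutely_integrable_linear[OF assms bounded_linear_of_real] by (simp add: o_def)
  ultimately have "(\<lambda>x. cis (- (rvec m \<bullet> x)) * complex_of_real (W x)) absolutely_integrable_on Qbox"
    by (intro absolutely_integrable_bounded_measurable_product[where h="(*)"])
      (auto intro!: bilinear_times boundedI[where B=1] simp: Qbox_def)
  then show ?thesis
    by (simp add: mult.commute absolutely_integrable_on_def)
qed

lemma fourier_diff:
  assumes "f absolutely_integrable_on Qbox" "g absolutely_integrable_on Qbox"
  shows "fourier (\<lambda>x. f x - g x) m = fourier f m - fourier g m"
  unfolding fourier_def
  by (simp add: left_diff_distrib Henstock_Kurzweil_Integration.integral_diff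
      fourier_integrable[OF assms(1)] fourier_integrable[OF assms(2)] right_diff_distrib)

lemma fourier_uminus_index: "fourier W (- m) = cnj (fourier W m)"
  unfolding fourier_def
  by (simp add: integral_cnj Henstock_Kurzweil_Integration.integral_cnj cis_cnj)

lemma star_space_fnorm:
  assumes "f \<in> star_space"
  shows "fnorm (fourier f) = ennreal (star_norm f)" "fnorm (fourier f) \<noteq> top"
  using assms esum_eq_infsum[of "\<lambda>m. cmod (fourier f m)"]
  by (auto simp: star_space_def fnorm_def star_norm_def)

lemma star_spaceI:
  assumes "\<And>x i. W (x + axis i (2 * pi)) = W x" "W absolutely_integrable_on Qbox" "fnorm (fourier W) \<noteq> top"
  shows "W \<in> star_space"
  using assms summable_esumI(1)[of "fourier W"]
  by (auto simp: star_space_def fnorm_def less_top)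

lemma star_space_diff:
  assumes "f \<in> star_space" "g \<in> star_space"
  shows "(\<lambda>x. f x - g x) \<in> star_space"
    and "fourier (\<lambda>x. f x - g x) = (\<lambda>m. fourier f m - fourier g m)"
proof -
  have ai: "f absolutely_integrable_on Qbox" "g absolutely_integrable_on Qbox"
    using assms by (auto simp: star_space_def)
  show 1: "fourier (\<lambda>x. f x - g x) = (\<lambda>m. fourier f m - fourier g m)"
    using fourier_diff[OF ai] by auto
  have "fnorm (\<lambda>m. fourier f m + - fourier g m) \<le> fnorm (fourier f) + fnorm (\<lambda>m. - fourier g m)"
    by (rule fnorm_triangle)
  also have "fnorm (\<lambda>m. - fourier g m) = fnorm (fourier g)"
    by (simp add: fnorm_def)
  finally have "fnorm (\<lambda>m. fourier f m - fourier g m) \<noteq> top"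
    using star_space_fnorm(2)[OF assms(1)] star_space_fnorm(2)[OF assms(2)]
    by (auto simp: top_unique)
  then show "(\<lambda>x. f x - g x) \<in> star_space"
    using assms by (intro star_spaceI set_integral_diff ai) (auto simp: star_space_def 1)
qed

text \<open>Frequencies may repeat: the squared modulus of \<open>u\<close> is a series over pairs
  \<open>(s, r)\<close> with frequency \<open>s - r\<close>, and the tail of the iteration has one
  more index. A Fourier coefficient is then the sum over a fibre of \<open>\<phi>\<close>, and the
  Wiener norm is at most the full absolute sum. Uniform convergence gives continuity and termwise
  integration.\<close>

lemma cis_series_star_space:
  fixes f :: "real ^ 'n \<Rightarrow> real" and c :: "'i \<Rightarrow> complex" and \<phi> :: "'i \<Rightarrow> int ^ 'n"
  assumes f: "\<And>x. complex_of_real (f x) = (\<Sum>\<^sub>\<infinity>i. c i * cis (rvec (\<phi> i) \<bullet> x))"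
    and c: "esum (\<lambda>i. ennreal (cmod (c i))) \<noteq> top"
  shows "f \<in> star_space" "fourier f m = (\<Sum>\<^sub>\<infinity>i. if \<phi> i = m then c i else 0)"
    and "fnorm (fourier f) \<le> esum (\<lambda>i. ennreal (cmod (c i)))"
proof -
  have sc: "(\<lambda>i. cmod (c i)) summable_on UNIV"
    using summable_esumI(1)[of c] c by (simp add: less_top)
  have per: "f (x + axis i (2 * pi)) = f x" for x i
  proof -
    have "cis (rvec (\<phi> k) \<bullet> (x + axis i (2 * pi))) = cis (rvec (\<phi> k) \<bullet> x)" for k
      using cis_multiple_2pi[of "of_int (\<phi> k $ i)"]
      by (simp add: inner_add_right inner_axis rvec_def cis_mult[symmetric] mult_ac)
    then have "complex_of_real (f (x + axis i (2 * pi))) = complex_of_real (f x)"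
      by (simp add: f)
    then show ?thesis by simp
  qed
  have ul: "uniform_limit UNIV (\<lambda>X x. \<Sum>i\<in>X. c i * cis (rvec (\<phi> i) \<bullet> x))
      (\<lambda>x. \<Sum>\<^sub>\<infinity>i. c i * cis (rvec (\<phi> i) \<bullet> x)) (finite_subsets_at_top UNIV)"
    by (rule Weierstrass_m_test_general[OF _ sc]) (simp add: norm_mult)
  then have ul: "uniform_limit UNIV (\<lambda>X x. \<Sum>i\<in>X. c i * cis (rvec (\<phi> i) \<bullet> x))
      (\<lambda>x. complex_of_real (f x)) (finite_subsets_at_top UNIV)"
    by (simp add: f)
  have "continuous_on UNIV (\<lambda>x. complex_of_real (f x))"
    by (rule uniform_limit_theorem[OF _ ul]) (auto intro!: always_eventually continuous_intros)
  then have "continuous_on UNIV (\<lambda>x. Re (complex_of_real (f x)))"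
    by (rule continuous_on_Re)
  then have ai: "f absolutely_integrable_on Qbox"
    unfolding Qbox_def
    by (intro absolutely_integrable_continuous) (auto intro: continuous_on_subset)
  have coeff: "fourier f m = (\<Sum>\<^sub>\<infinity>i. if \<phi> i = m then c i else 0)" for m
  proof -
    let ?N = "(2 * pi) ^ CARD('n)"
    have "uniform_limit Qbox (\<lambda>X x. (\<Sum>i\<in>X. c i * cis (rvec (\<phi> i) \<bullet> x)) * cis (- (rvec m \<bullet> x)))
      (\<lambda>x. complex_of_real (f x) * cis (- (rvec m \<bullet> x))) (finite_subsets_at_top UNIV)"
    proof (rule uniform_limitI)
      fix e :: real assume "e > 0"
      from uniform_limitD[OF ul this]
      show "\<forall>\<^sub>F X in finite_subsets_at_top UNIV. \<forall>x\<in>Qbox.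
         dist ((\<Sum>i\<in>X. c i * cis (rvec (\<phi> i) \<bullet> x)) * cis (- (rvec m \<bullet> x)))
          (complex_of_real (f x) * cis (- (rvec m \<bullet> x))) < e"
        by eventually_elim (auto simp: dist_norm norm_mult simp flip: left_diff_distrib)
    qed
    note ul' = this
    have cont: "continuous_on Qbox (\<lambda>x. (\<Sum>i\<in>X. c i * cis (rvec (\<phi> i) \<bullet> x)) * cis (- (rvec m \<bullet> x)))" for X
      by (intro continuous_intros)
    obtain I J where I: "\<And>X. ((\<lambda>x. (\<Sum>i\<in>X. c i * cis (rvec (\<phi> i) \<bullet> x)) * cis (- (rvec m \<bullet> x))) has_integral I X) Qbox"
      and J: "((\<lambda>x. complex_of_real (f x) * cis (- (rvec m \<bullet> x))) has_integral J) Qbox"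
      and lim: "(I \<longlongrightarrow> J) (finite_subsets_at_top UNIV)"
      unfolding Qbox_def
      by (rule uniform_limit_integral_cbox[OF ul'[unfolded Qbox_def] cont[unfolded Qbox_def]]) auto
    have "I X = (\<Sum>i\<in>X. if \<phi> i = m then c i * ?N else 0)" for X
    proof -
      have "I X = integral Qbox (\<lambda>x. \<Sum>i\<in>X. c i * cis (rvec (\<phi> i - m) \<bullet> x))"
        using integral_unique[OF I[of X]]
        by (simp add: sum_distrib_right mult.assoc cis_mult inner_diff_left)
      also have "\<dots> = (\<Sum>i\<in>X. integral Qbox (\<lambda>x. c i * cis (rvec (\<phi> i - m) \<bullet> x)))"
        by (cases "finite X", subst integral_sum)
          (auto simp: Qbox_def intro!: integrable_continuous continuous_intros)
      also have "\<dots> = (\<Sum>i\<in>X. if \<phi> i = m then c i * ?N else 0)"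
        by (intro sum.cong refl) (simp add: integral_Qbox_cis del: rvec_simps)
      finally show ?thesis .
    qed
    then have "I = (\<lambda>X. \<Sum>i\<in>X. if \<phi> i = m then c i * ?N else 0)" by auto
    with lim have "((\<lambda>i. if \<phi> i = m then c i * ?N else 0) has_sum J) UNIV"
      by (simp add: has_sum_def)
    then have "((\<lambda>i. (1 / ?N) * (if \<phi> i = m then c i * ?N else 0)) has_sum (1 / ?N) * J) UNIV"
      by (rule has_sum_cmult_right)
    also have "(\<lambda>i. (1 / ?N) * (if \<phi> i = m then c i * ?N else 0)) = (\<lambda>i. if \<phi> i = m then c i else 0)"
      by (auto simp: fun_eq_iff)
    finally have "(\<Sum>\<^sub>\<infinity>i. if \<phi> i = m then c i else 0) = (1 / ?N) * J"
      by (rule infsumI)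
    then show ?thesis
      using integral_unique[OF J] by (simp add: fourier_def)
  qed
  then show "fourier f m = (\<Sum>\<^sub>\<infinity>i. if \<phi> i = m then c i else 0)" .
  have "fnorm (fourier f) \<le> esum (\<lambda>m. esum (\<lambda>i. ennreal (cmod (if \<phi> i = m then c i else 0))))"
    unfolding fnorm_def coeff by (intro esum_mono infsum_le_esum)
  also have "\<dots> = esum (\<lambda>i. esum (\<lambda>m. ennreal (cmod (if \<phi> i = m then c i else 0))))"
    by (rule esum_swap)
  also have "\<dots> = esum (\<lambda>i. esum (\<lambda>m. if m = \<phi> i then ennreal (cmod (c i)) else 0))"
    by (intro nn_integral_cong) auto
  also have "\<dots> = esum (\<lambda>i. ennreal (cmod (c i)))"
    by (simp add: esum_delta)
  finally show le: "fnorm (fourier f) \<le> esum (\<lambda>i. ennreal (cmod (c i)))" .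
  show "f \<in> star_space"
    by (rule star_spaceI[OF per ai]) (use le c in \<open>auto simp: top_unique\<close>)
qed

lemma infsum_finite_support:
  fixes f :: "'a \<Rightarrow> 'b::{comm_monoid_add, t2_space}"
  assumes "finite F" "\<And>x. x \<notin> F \<Longrightarrow> f x = 0"
  shows "infsum f UNIV = sum f F"
  using infsum_cong_neutral[of F UNIV f f] assms by auto

lemma trig_polynomial_star_space:
  fixes V :: "real ^ 'n \<Rightarrow> real"
  assumes "finite F" "\<And>x. complex_of_real (V x) = (\<Sum>m\<in>F. v m * cis (rvec m \<bullet> x))"
  shows "V \<in> star_space" "fourier V m = (if m \<in> F then v m else 0)"
proof -
  let ?c = "\<lambda>m. if m \<in> F then v m else 0"
  have s: "complex_of_real (V x) = (\<Sum>\<^sub>\<infinity>m. ?c m * cis (rvec m \<bullet> x))" for x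
    using infsum_finite_support[OF assms(1), of "\<lambda>m. ?c m * cis (rvec m \<bullet> x)"] assms(2)[of x] by simp
  have "esum (\<lambda>m. ennreal (cmod (?c m))) = (\<Sum>m\<in>F. ennreal (cmod (?c m)))"
    by (rule nn_integral_count_space') (use assms in auto)
  then have fin: "esum (\<lambda>m. ennreal (cmod (?c m))) \<noteq> top"
    using assms(1) by simp
  show "V \<in> star_space"
    by (rule cis_series_star_space(1)[OF s fin])
  have "fourier V m = (\<Sum>\<^sub>\<infinity>i. if i = m then ?c i else 0)"
    by (rule cis_series_star_space(2)[OF s fin])
  also have "\<dots> = ?c m"
    by (subst infsum_finite_support[of "{m}"]) auto
  finally show "fourier V m = ?c m" .
qed

lemma infsum_product_esum:
  fixes a :: "'a \<Rightarrow> complex" and b :: "'b \<Rightarrow> complex"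
  assumes "esum (\<lambda>i. ennreal (cmod (a i))) \<noteq> top" "esum (\<lambda>i. ennreal (cmod (b i))) \<noteq> top"
  shows "infsum a UNIV * infsum b UNIV = (\<Sum>\<^sub>\<infinity>(i, j). a i * b j)"
    and "esum (\<lambda>(i, j). ennreal (cmod (a i * b j))) =
      esum (\<lambda>i. ennreal (cmod (a i))) * esum (\<lambda>i. ennreal (cmod (b i)))"
    and "(\<lambda>(i, j). a i * b j) summable_on UNIV"
proof -
  show e: "esum (\<lambda>(i, j). ennreal (cmod (a i * b j))) =
      esum (\<lambda>i. ennreal (cmod (a i))) * esum (\<lambda>i. ennreal (cmod (b i)))"
    by (simp add: esum_pair norm_mult ennreal_mult nn_integral_cmult nn_integral_multc)
  have "esum (\<lambda>p. ennreal (cmod (case p of (i, j) \<Rightarrow> a i * b j))) < top"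
    using e assms by (auto simp: case_prod_beta' less_top[symmetric] ennreal_mult_eq_top_iff)
  then show s: "(\<lambda>(i, j). a i * b j) summable_on UNIV"
    by (intro summable_esumI(2)) auto
  have sa: "a summable_on UNIV" "b summable_on UNIV"
    using assms by (auto intro!: summable_esumI(2) simp: less_top)
  have "infsum (\<lambda>(i, j). a i * b j) (UNIV \<times> UNIV) = (\<Sum>\<^sub>\<infinity>i. \<Sum>\<^sub>\<infinity>j. a i * b j)"
    using infsum_Sigma_banach[of "\<lambda>(i, j). a i * b j" UNIV "\<lambda>_. UNIV"] s by simp
  also have "\<dots> = infsum a UNIV * infsum b UNIV"
    using sa by (simp add: infsum_cmult_right infsum_cmult_left)
  finally show "infsum a UNIV * infsum b UNIV = (\<Sum>\<^sub>\<infinity>(i, j). a i * b j)"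
    by simp
qed

text \<open>The quasi-periodic phases cancel in the product with the conjugate, which leaves integer
  frequencies \<open>s - r\<close>; so the nonlinear term is a periodic potential.\<close>

lemma norm_cis_series_squared:
  fixes e :: "int ^ 'n \<Rightarrow> complex"
  assumes e: "fnorm e \<noteq> top"
  shows "complex_of_real ((cmod (A * (\<Sum>\<^sub>\<infinity>s. e s * cis (Pt s t \<bullet> x))))\<^sup>2) =
      (\<Sum>\<^sub>\<infinity>(s, r). of_real ((cmod A)\<^sup>2) * (e s * cnj (e r)) * cis (rvec (s - r) \<bullet> x))"
    and "(\<lambda>(s, r). of_real ((cmod A)\<^sup>2) * (e s * cnj (e r)) * cis (rvec (s - r) \<bullet> x)) summable_on UNIV"
proof -
  let ?a = "\<lambda>s. e s * cis (Pt s t \<bullet> x)"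
  have a: "esum (\<lambda>s. ennreal (cmod (?a s))) \<noteq> top" "esum (\<lambda>s. ennreal (cmod (cnj (?a s)))) \<noteq> top"
    using e by (simp_all add: norm_mult fnorm_def)
  have eq: "(\<lambda>(s, r). of_real ((cmod A)\<^sup>2) * (e s * cnj (e r)) * cis (rvec (s - r) \<bullet> x)) =
      (\<lambda>p. of_real ((cmod A)\<^sup>2) * (case p of (s, r) \<Rightarrow> ?a s * cnj (?a r)))"
  proof -
    have "cis (rvec (s - r) \<bullet> x) = cis (Pt s t \<bullet> x) * cnj (cis (Pt r t \<bullet> x))" for s r
      by (simp add: cis_cnj cis_mult Pt_def inner_add_left inner_diff_left)
    then show ?thesis by (auto simp: fun_eq_iff)
  qed
  show "(\<lambda>(s, r). of_real ((cmod A)\<^sup>2) * (e s * cnj (e r)) * cis (rvec (s - r) \<bullet> x)) summable_on UNIV"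
    unfolding eq by (intro summable_on_cmult_right infsum_product_esum(3) a)
  have "complex_of_real ((cmod (A * infsum ?a UNIV))\<^sup>2) =
      of_real ((cmod A)\<^sup>2) * (infsum ?a UNIV * cnj (infsum ?a UNIV))"
    by (simp add: norm_mult power_mult_distrib complex_norm_square[of "infsum ?a UNIV"] del: of_real_power)
  also have "infsum ?a UNIV * cnj (infsum ?a UNIV) = (\<Sum>\<^sub>\<infinity>(s, r). ?a s * cnj (?a r))"
    unfolding infsum_cnj[symmetric] by (rule infsum_product_esum(1)[OF a])
  also have "of_real ((cmod A)\<^sup>2) * \<dots> =
     (\<Sum>\<^sub>\<infinity>(s, r). of_real ((cmod A)\<^sup>2) * (e s * cnj (e r)) * cis (rvec (s - r) \<bullet> x))"
    unfolding eq by (intro infsum_cmult_right[symmetric] infsum_product_esum(3) a)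
  finally show "complex_of_real ((cmod (A * infsum ?a UNIV))\<^sup>2) =
      (\<Sum>\<^sub>\<infinity>(s, r). of_real ((cmod A)\<^sup>2) * (e s * cnj (e r)) * cis (rvec (s - r) \<bullet> x))" .
qed

text \<open>With \<open>g = 0\<close> this bounds the single potential \<open>\<sigma> * |u|^2\<close>.\<close>

lemma norm_cis_series_squared_diff:
  fixes e g :: "int ^ 'n \<Rightarrow> complex" and \<sigma> :: real and A :: complex
  assumes e: "fnorm e \<noteq> top" "fnorm g \<noteq> top"
  defines "c \<equiv> \<lambda>(s, r). of_real (\<sigma> * (cmod A)\<^sup>2) * (e s * cnj (e r) - g s * cnj (g r))"
  shows "complex_of_real (\<sigma> * (cmod (A * (\<Sum>\<^sub>\<infinity>s. e s * cis (Pt s t \<bullet> x))))\<^sup>2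
        - \<sigma> * (cmod (A * (\<Sum>\<^sub>\<infinity>s. g s * cis (Pt s t \<bullet> x))))\<^sup>2) =
      (\<Sum>\<^sub>\<infinity>p. c p * cis (rvec (fst p - snd p) \<bullet> x))"
    and "esum (\<lambda>p. ennreal (cmod (c p))) \<le>
       ennreal (\<bar>\<sigma>\<bar> * (cmod A)\<^sup>2) * (fnorm (\<lambda>m. e m - g m) * (fnorm e + fnorm g))"
proof -
  let ?f = "\<lambda>e. \<lambda>(s, r). of_real ((cmod A)\<^sup>2) * (e s * cnj (e r)) * cis (rvec (s - r) \<bullet> x)"
  have "complex_of_real (\<sigma> * (cmod (A * (\<Sum>\<^sub>\<infinity>s. e s * cis (Pt s t \<bullet> x))))\<^sup>2
        - \<sigma> * (cmod (A * (\<Sum>\<^sub>\<infinity>s. g s * cis (Pt s t \<bullet> x))))\<^sup>2) = of_real \<sigma> * (infsum (?f e) UNIV - infsum (?f g) UNIV)"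
    by (simp only: norm_cis_series_squared(1)[OF e(1)] norm_cis_series_squared(1)[OF e(2)] of_real_diff of_real_mult
      right_diff_distrib)
  also have "\<dots> = of_real \<sigma> * (\<Sum>\<^sub>\<infinity>p. ?f e p - ?f g p)"
    by (simp only: infsum_diff[OF norm_cis_series_squared(2)[OF e(1)] norm_cis_series_squared(2)[OF e(2)]])
  also have "\<dots> = (\<Sum>\<^sub>\<infinity>p. of_real \<sigma> * (?f e p - ?f g p))"
    by (rule infsum_cmult_right'[symmetric])
  also have "\<dots> = (\<Sum>\<^sub>\<infinity>p. c p * cis (rvec (fst p - snd p) \<bullet> x))"
    by (intro infsum_cong) (auto simp: c_def algebra_simps)
  finally show "complex_of_real (\<sigma> * (cmod (A * (\<Sum>\<^sub>\<infinity>s. e s * cis (Pt s t \<bullet> x))))\<^sup>2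
        - \<sigma> * (cmod (A * (\<Sum>\<^sub>\<infinity>s. g s * cis (Pt s t \<bullet> x))))\<^sup>2) =
      (\<Sum>\<^sub>\<infinity>p. c p * cis (rvec (fst p - snd p) \<bullet> x))" .
  let ?n = "\<lambda>e m. ennreal (cmod (e m))"
  have le: "ennreal (cmod (c (s, r))) \<le> ennreal (\<bar>\<sigma>\<bar> * (cmod A)\<^sup>2) *
      (ennreal (cmod (e s - g s)) * ?n e r + ?n g s * ennreal (cmod (e r - g r)))" for s r
  proof -
    have "e s * cnj (e r) - g s * cnj (g r) = (e s - g s) * cnj (e r) + g s * cnj (e r - g r)"
      by (simp add: algebra_simps)
    then have "cmod (e s * cnj (e r) - g s * cnj (g r)) \<le> cmod (e s - g s) * cmod (e r) + cmod (g s) * cmod (e r - g r)"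
      using norm_triangle_ineq[of "(e s - g s) * cnj (e r)" "g s * cnj (e r - g r)"]
      by (simp only: norm_mult complex_mod_cnj)
    then have "cmod (c (s, r)) \<le> \<bar>\<sigma>\<bar> * (cmod A)\<^sup>2 * (cmod (e s - g s) * cmod (e r) + cmod (g s) * cmod (e r - g r))"
      by (simp add: c_def norm_mult mult_left_mono norm_power)
    then show ?thesis
      by (subst ennreal_mult[symmetric] ennreal_plus[symmetric], simp, simp)+ (auto intro!: ennreal_leI)
  qed
  have "esum (\<lambda>p. ennreal (cmod (c p))) = esum (\<lambda>s. esum (\<lambda>r. ennreal (cmod (c (s, r)))))"
    using esum_pair[of "\<lambda>s r. ennreal (cmod (c (s, r)))"] by (simp add: case_prod_unfold)
  also have "\<dots> \<le> esum (\<lambda>s. esum (\<lambda>r. ennreal (\<bar>\<sigma>\<bar> * (cmod A)\<^sup>2) *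
      (ennreal (cmod (e s - g s)) * ?n e r + ?n g s * ennreal (cmod (e r - g r)))))"
    by (intro esum_mono le)
  also have "\<dots> = ennreal (\<bar>\<sigma>\<bar> * (cmod A)\<^sup>2) * (fnorm (\<lambda>m. e m - g m) * (fnorm e + fnorm g))"
    by (simp add: nn_integral_cmult nn_integral_multc nn_integral_add fnorm_def distrib_left mult_ac)
  finally show "esum (\<lambda>p. ennreal (cmod (c p))) \<le>
       ennreal (\<bar>\<sigma>\<bar> * (cmod A)\<^sup>2) * (fnorm (\<lambda>m. e m - g m) * (fnorm e + fnorm g))" .
qed

text \<open>The limit is built as an actual function: the telescoping series of increments converges
  pointwise. Each tail is rewritten as a single absolutely convergent exponential series over pairs
  of step and index, so membership in \<open>star_space\<close> and the tail estimate come from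
  \<open>cis_series_star_space\<close>.\<close>

lemma star_limit_exists:
  fixes W :: "nat \<Rightarrow> real ^ 'n \<Rightarrow> real" and c :: "nat \<Rightarrow> 'p \<Rightarrow> complex" and \<phi> :: "'p \<Rightarrow> int ^ 'n"
  assumes W0: "W 0 \<in> star_space"
    and step: "\<And>i x. complex_of_real (W (Suc i) x - W i x) = (\<Sum>\<^sub>\<infinity>p. c i p * cis (rvec (\<phi> p) \<bullet> x))"
    and c: "\<And>i. esum (\<lambda>p. ennreal (cmod (c i p))) \<le> ennreal (B i)" and B: "summable B" "\<And>i. B i \<ge> 0"
  shows "\<exists>f\<in>star_space. \<forall>m. (\<lambda>x. W m x - f x) \<in> star_space \<and>
     fnorm (fourier (\<lambda>x. W m x - f x)) \<le> ennreal (\<Sum>i. B (i + m))"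
proof -
  define D where "D i x = W (Suc i) x - W i x" for i x
  have D: "complex_of_real (D i x) = (\<Sum>\<^sub>\<infinity>p. c i p * cis (rvec (\<phi> p) \<bullet> x))" for i x
    using step by (simp add: D_def)
  have cB: "esum (\<lambda>(i, p). ennreal (cmod (c (i + m) p))) \<le> ennreal (\<Sum>i. B (i + m))" for m
  proof -
    have "esum (\<lambda>(i, p). ennreal (cmod (c (i + m) p))) \<le> esum (\<lambda>i. ennreal (B (i + m)))"
      unfolding esum_pair by (intro esum_mono c)
    also have "\<dots> = ennreal (\<Sum>i. B (i + m))"
      unfolding nn_integral_count_space_nat
      by (intro suminf_ennreal2 B summable_ignore_initial_segment)
    finally show ?thesis .
  qed
  have sB: "D i x \<le> B i \<and> - D i x \<le> B i" for i x
  proof -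
    have "ennreal (cmod (complex_of_real (D i x))) \<le> esum (\<lambda>p. ennreal (cmod (c i p * cis (rvec (\<phi> p) \<bullet> x))))"
      unfolding D by (rule infsum_le_esum)
    also have "\<dots> \<le> ennreal (B i)" using c[of i] by (simp add: norm_mult)
    finally show ?thesis using B(2)[of i] by (auto simp: abs_le_iff)
  qed
  have sD: "summable (\<lambda>i. D i x)" for x
    by (rule summable_comparison_test[OF _ B(1)]) (use sB in \<open>auto simp: abs_le_iff\<close>)
  have tail: "complex_of_real (\<Sum>i. D (i + m) x) = (\<Sum>\<^sub>\<infinity>(i, p). c (i + m) p * cis (rvec (\<phi> p) \<bullet> x))" for m x
  proof -
    have "esum (\<lambda>q. ennreal (cmod (case q of (i, p) \<Rightarrow> c (i + m) p * cis (rvec (\<phi> p) \<bullet> x)))) < top"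
      using le_less_trans[OF cB[of m]] by (simp add: case_prod_beta' norm_mult less_top)
    then have s: "(\<lambda>(i, p). c (i + m) p * cis (rvec (\<phi> p) \<bullet> x)) summable_on UNIV"
      by (intro summable_esumI(2)) auto
    have "((\<lambda>i. complex_of_real (D (i + m) x)) has_sum (\<Sum>\<^sub>\<infinity>(i, p). c (i + m) p * cis (rvec (\<phi> p) \<bullet> x))) UNIV"
    proof (rule has_sum_SigmaD[where B="\<lambda>_. UNIV" and f="\<lambda>(i, p). c (i + m) p * cis (rvec (\<phi> p) \<bullet> x)"])
      show "((\<lambda>(i, p). c (i + m) p * cis (rvec (\<phi> p) \<bullet> x)) has_sum
        (\<Sum>\<^sub>\<infinity>(i, p). c (i + m) p * cis (rvec (\<phi> p) \<bullet> x))) (UNIV \<times> UNIV)"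
        using s by simp
      show "((\<lambda>p. case (i, p) of (i, p) \<Rightarrow> c (i + m) p * cis (rvec (\<phi> p) \<bullet> x)) has_sum
        complex_of_real (D (i + m) x)) UNIV" for i
        unfolding D using s summable_on_SigmaD1[of "\<lambda>i p. c (i + m) p * cis (rvec (\<phi> p) \<bullet> x)" UNIV "\<lambda>_. UNIV" i]
        by simp
    qed
    from has_sum_imp_sums[OF this] have "(\<Sum>i. complex_of_real (D (i + m) x)) = (\<Sum>\<^sub>\<infinity>(i, p). c (i + m) p * cis (rvec (\<phi> p) \<bullet> x))"
      by (rule sums_unique[symmetric])
    then show ?thesis
      by (subst suminf_of_real[OF summable_ignore_initial_segment[OF sD]]) simp
  qed
  define R where "R m x = (\<Sum>i. D (i + m) x)" for m x
  have R: "R m \<in> star_space" "fnorm (fourier (R m)) \<le> ennreal (\<Sum>i. B (i + m))" for m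
  proof -
    have s: "complex_of_real (R m x) = (\<Sum>\<^sub>\<infinity>q. (\<lambda>(i, p). c (i + m) p) q * cis (rvec (\<phi> (snd q)) \<bullet> x))" for x
      unfolding R_def tail by (simp add: case_prod_beta')
    have le: "esum (\<lambda>q. ennreal (cmod ((\<lambda>(i, p). c (i + m) p) q))) \<le> ennreal (\<Sum>i. B (i + m))"
      using cB[of m] by (simp add: case_prod_beta')
    then have fin: "esum (\<lambda>q. ennreal (cmod ((\<lambda>(i, p). c (i + m) p) q))) \<noteq> top"
      by (metis ennreal_neq_top neq_top_trans)
    show "R m \<in> star_space"
      by (rule cis_series_star_space(1)[OF s fin])
    show "fnorm (fourier (R m)) \<le> ennreal (\<Sum>i. B (i + m))"
      by (rule order_trans[OF cis_series_star_space(3)[OF s fin] le])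
  qed
  define f where "f m x = W m x + R m x" for m x
  \<comment> \<open>Partial sum plus tail does not depend on the place of the cut, so
    \<open>f 0\<close> serves as the limit for every \<open>m\<close>.\<close>
  have fm: "f m = f 0" for m
  proof (induction m)
    case (Suc m)
    have "R m x = D m x + R (Suc m) x" for x
      using suminf_split_head[OF summable_ignore_initial_segment[OF sD], of m x] by (simp add: R_def)
    with Suc show ?case by (auto simp: fun_eq_iff f_def D_def)
  qed simp
  have neg: "(\<lambda>x. W m x - f 0 x) = (\<lambda>x. 0 - R m x)" for m
  proof
    fix x show "W m x - f 0 x = 0 - R m x"
      using fun_cong[OF fm[of m], of x] by (simp add: f_def)
  qed
  have zero: "(\<lambda>x::real^'n. 0::real) \<in> star_space" "fourier (\<lambda>x::real^'n. 0) = (\<lambda>m. 0)"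
    using trig_polynomial_star_space[of "{}" "\<lambda>x. 0"] by auto
  have "f 0 = (\<lambda>x. W 0 x - (0 - R 0 x))" by (auto simp: f_def)
  then have "f 0 \<in> star_space"
    using star_space_diff(1)[OF W0 star_space_diff(1)[OF zero(1) R(1)[of 0]]] by simp
  moreover have "(\<lambda>x. W m x - f 0 x) \<in> star_space \<and>
     fnorm (fourier (\<lambda>x. W m x - f 0 x)) \<le> ennreal (\<Sum>i. B (i + m))" for m
    unfolding neg using star_space_diff[OF zero(1) R(1)[of m]] R(2)[of m] by (simp add: zero fnorm_def)
  ultimately show ?thesis by blast
qed

text \<open>Existence makes the choice in \<open>star_limit\<close> meaningful, but the chosen
  function is known only through convergence. Its distance to \<open>V\<close> is therefore
  estimated through an iterate that is \<open>e\<close>-close to it.\<close>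

lemma star_limit_correct:
  fixes W :: "nat \<Rightarrow> real ^ 'n \<Rightarrow> real" and c :: "nat \<Rightarrow> 'p \<Rightarrow> complex" and \<phi> :: "'p \<Rightarrow> int ^ 'n"
  assumes W0: "W 0 \<in> star_space"
    and step: "\<And>i x. complex_of_real (W (Suc i) x - W i x) = (\<Sum>\<^sub>\<infinity>p. c i p * cis (rvec (\<phi> p) \<bullet> x))"
    and c: "\<And>i. esum (\<lambda>p. ennreal (cmod (c i p))) \<le> ennreal (B i)" and B: "summable B" "\<And>i. B i \<ge> 0"
    and V: "V \<in> star_space" "\<And>m. W m \<in> star_space"
      "\<And>m. fnorm (\<lambda>i. fourier (W m) i - fourier V i) \<le> \<eta>"
  shows "star_limit W \<in> star_space" "fnorm (\<lambda>i. fourier (star_limit W) i - fourier V i) \<le> \<eta>"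
proof -
  let ?P = "\<lambda>f. f \<in> star_space \<and> (\<forall>m. (\<lambda>x. W m x - f x) \<in> star_space) \<and>
     (\<lambda>m. star_norm (\<lambda>x. W m x - f x)) \<longlonglongrightarrow> 0"
  obtain f where f: "f \<in> star_space" "\<And>m. (\<lambda>x. W m x - f x) \<in> star_space"
    "\<And>m. fnorm (fourier (\<lambda>x. W m x - f x)) \<le> ennreal (\<Sum>i. B (i + m))"
    using star_limit_exists[OF W0 step c B] by blast
  have nn: "(\<Sum>i. B (i + m)) \<ge> 0" for m
    by (intro suminf_nonneg summable_ignore_initial_segment B)
  have le: "star_norm (\<lambda>x. W m x - f x) \<le> (\<Sum>i. B (i + m))" for m
    using f(3)[of m] nn[of m] unfolding star_space_fnorm(1)[OF f(2)] by simp
  have ge: "star_norm (\<lambda>x. W m x - f x) \<ge> 0" for m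
    by (simp add: star_norm_def infsum_nonneg)
  have "(\<lambda>m. star_norm (\<lambda>x. W m x - f x)) \<longlonglongrightarrow> 0"
    by (rule tendsto_sandwich[OF _ _ tendsto_const suminf_exist_split2[OF B(1)]]) (auto simp: le ge)
  with f have "?P f" by blast
  then have P: "?P (star_limit W)"
    unfolding star_limit_def by (rule someI[of ?P])
  then show L: "star_limit W \<in> star_space" by blast
  show "fnorm (\<lambda>i. fourier (star_limit W) i - fourier V i) \<le> \<eta>"
  proof (rule ennreal_le_epsilon)
    fix e :: real assume "e > 0"
    then obtain m where m: "star_norm (\<lambda>x. W m x - star_limit W x) < e"
      using P by (metis (no_types, lifting) LIMSEQ_iff abs_less_iff diff_zero order_refl real_norm_def)
    have "fnorm (\<lambda>i. (fourier (W m) i - fourier V i) + (fourier (star_limit W) i - fourier (W m) i)) \<le>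
      fnorm (\<lambda>i. fourier (W m) i - fourier V i) + fnorm (\<lambda>i. fourier (star_limit W) i - fourier (W m) i)"
      by (rule fnorm_triangle)
    also have "fnorm (\<lambda>i. fourier (star_limit W) i - fourier (W m) i) = fnorm (fourier (\<lambda>x. W m x - star_limit W x))"
      by (simp add: star_space_diff(2)[OF V(2) L] fnorm_def norm_minus_commute)
    also have "\<dots> \<le> ennreal e"
      using P m by (subst star_space_fnorm(1)) (auto intro!: ennreal_leI)
    finally show "fnorm (\<lambda>i. fourier (star_limit W) i - fourier V i) \<le> \<eta> + ennreal e"
      using V(3)[of m] by (simp add: add_mono order_trans)
  qed
qed

section \<open>The model operator and its resolvent\<close>

lemma zmult_finite:
  assumes "finite F" "\<And>m. m \<notin> F \<Longrightarrow> M s m * N m r = 0"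
  shows "zmult M N s r = (\<Sum>m\<in>F. M s m * N m r)"
  unfolding zmult_def using infsum_cong_neutral[of F UNIV "\<lambda>m. M s m * N m r" "\<lambda>m. M s m * N m r"] assms by auto

definition block_diag :: "(int ^ 'n) set \<Rightarrow> 'n zmat \<Rightarrow> bool" where
  "block_diag J M \<longleftrightarrow> (\<forall>s r. s \<noteq> r \<longrightarrow> s \<notin> J \<or> r \<notin> J \<longrightarrow> M s r = 0)"

lemma zmult_block_diag:
  assumes "finite J" "block_diag J M"
  shows "zmult M N s r = (if s \<in> J then \<Sum>m\<in>J. M s m * N m r else M s s * N s r)"
proof (cases "s \<in> J")
  case True
  then have "M s m = 0" if "m \<notin> J" for m
    using assms(2) that unfolding block_diag_def by metis
  with True show ?thesis
    using assms by (subst zmult_finite[of J]) auto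
next
  case False
  then have "M s m = 0" if "m \<noteq> s" for m
    using assms(2) that unfolding block_diag_def by metis
  with False show ?thesis
    by (subst zmult_finite[of "{s}"]) auto
qed

lemma zmult_block_diag_right:
  assumes "finite J" "block_diag J M"
  shows "zmult N M s r = (if r \<in> J then \<Sum>m\<in>J. N s m * M m r else N s r * M r r)"
proof (cases "r \<in> J")
  case True
  then have "M m r = 0" if "m \<notin> J" for m
    using assms(2) that unfolding block_diag_def by metis
  with True show ?thesis
    using assms by (subst zmult_finite[of J]) auto
next
  case False
  then have "M m r = 0" if "m \<noteq> r" for m
    using assms(2) that unfolding block_diag_def by metis
  with False show ?thesis
    by (subst zmult_finite[of "{r}"]) auto
qed

text \<open>Rows of block diagonal matrices are finite, so all sums that occur are finite and
  \<open>N\<close> may be arbitrary.\<close>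

lemma zmult_block_diag_assoc:
  assumes J: "finite J" and "block_diag J R" "block_diag J M"
  shows "zmult (zmult R M) N = zmult R (zmult M N)"
proof (intro ext)
  fix s r
  have RM: "block_diag J (zmult R M)"
    unfolding block_diag_def
  proof (intro allI impI)
    fix s r assume "s \<noteq> r" "s \<notin> J \<or> r \<notin> J"
    then show "zmult R M s r = 0"
      unfolding zmult_block_diag[OF J assms(2)]
      using assms(3) \<open>s \<noteq> r\<close> unfolding block_diag_def
      by (auto intro!: sum.neutral) metis
  qed
  show "zmult (zmult R M) N s r = zmult R (zmult M N) s r"
    by (simp add: zmult_block_diag[OF J RM] zmult_block_diag[OF J assms(2)] zmult_block_diag[OF J assms(3)]
        sum_distrib_left sum_distrib_right mult.assoc) (rule impI, rule sum.swap)
qed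

lemma zmult_zone [simp]: "zmult zone M = M" "zmult M zone = M"
proof -
  have "zmult zone M s r = M s r" for s r
    by (subst zmult_finite[of "{s}"]) (auto simp: zone_def)
  then show "zmult zone M = M" by auto
  have "zmult M zone s r = M s r" for s r
    by (subst zmult_finite[of "{r}"]) (auto simp: zone_def)
  then show "zmult M zone = M" by auto
qed

text \<open>The usual uniqueness of inverses, R' = (R M) R' = R (M R'). The competitor R' is
  arbitrary, so the associativity has to come from the block diagonal shape of \<open>R\<close> and
  \<open>M\<close>.\<close>

lemma zinv_eqI:
  assumes "finite J" "block_diag J M" "block_diag J R" "zmult M R = zone" "zmult R M = zone"
  shows "zinv M = R"
  unfolding zinv_def
proof (rule the_equality)
  fix R' assume "zmult M R' = zone \<and> zmult R' M = zone"
  then have "R' = zmult (zmult R M) R'" using assms(5) by simp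
  also have "\<dots> = zmult R (zmult M R')"
    by (rule zmult_block_diag_assoc) (use assms in auto)
  finally show "R' = R" using \<open>zmult M R' = zone \<and> zmult R' M = zone\<close> by simp
qed (use assms in auto)

text \<open>Two orthogonal projections with the same fixed vectors agree: EF = F and FE = E, and EF
  is the adjoint of FE.\<close>

lemma spec_proj_eqI:
  assumes J: "finite J" and E: "\<And>s r. s \<notin> J \<or> r \<notin> J \<Longrightarrow> E s r = 0" "\<And>s r. E r s = cnj (E s r)"
    "zmult E E = E"
    and eig: "\<And>x. (\<And>s. s \<notin> J \<Longrightarrow> x s = 0) \<Longrightarrow>
      zapply E x = x \<longleftrightarrow> zapply H x = (\<lambda>s. complex_of_real \<mu> * x s)"
  shows "spec_proj H J \<mu> = E"
  unfolding spec_proj_def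
proof (rule the_equality)
  show "(\<forall>s r. s \<notin> J \<or> r \<notin> J \<longrightarrow> E s r = 0) \<and> (\<forall>s r. E r s = cnj (E s r)) \<and> zmult E E = E \<and>
     (\<forall>x. (\<forall>s. s \<notin> J \<longrightarrow> x s = 0) \<longrightarrow>
        (zapply E x = x \<longleftrightarrow> zapply H x = (\<lambda>s. complex_of_real \<mu> * x s)))"
    using E eig by blast
next
  fix F assume F: "(\<forall>s r. s \<notin> J \<or> r \<notin> J \<longrightarrow> F s r = 0) \<and> (\<forall>s r. F r s = cnj (F s r)) \<and> zmult F F = F \<and>
     (\<forall>x. (\<forall>s. s \<notin> J \<longrightarrow> x s = 0) \<longrightarrow>
        (zapply F x = x \<longleftrightarrow> zapply H x = (\<lambda>s. complex_of_real \<mu> * x s)))"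
  have F0: "F s r = 0" if "s \<notin> J \<or> r \<notin> J" for s r using F that by metis
  have Fc: "cnj (F s r) = F r s" for s r using F by metis
  have Ec: "cnj (E s r) = E r s" for s r using E(2) by metis
  have FF: "zmult F F = F" using F by (elim conjE)
  have fix_iff: "zapply E x = x \<longleftrightarrow> zapply F x = x" if "\<And>s. s \<notin> J \<Longrightarrow> x s = 0" for x
  proof -
    have "\<forall>x. (\<forall>s. s \<notin> J \<longrightarrow> x s = 0) \<longrightarrow>
        (zapply F x = x \<longleftrightarrow> zapply H x = (\<lambda>s. complex_of_real \<mu> * x s))"
      using F by (elim conjE)
    then have "(zapply F x = x) = (zapply H x = (\<lambda>s. complex_of_real \<mu> * x s))"
      by (rule allE[of _ x], elim mp) (simp add: that)
    moreover have "(zapply E x = x) = (zapply H x = (\<lambda>s. complex_of_real \<mu> * x s))"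
      by (rule eig) (rule that)
    ultimately show ?thesis by (rule trans[OF _ sym, rotated])
  qed
  have col: "zapply M (\<lambda>s. N s r) = (\<lambda>s. zmult M N s r)" for M N :: "'a zmat" and r
    by (simp add: zapply_def[abs_def] zmult_def)
  have "zmult E F s r = F s r" for s r
  proof -
    have "zapply F (\<lambda>s. F s r) = (\<lambda>s. F s r)" unfolding col FF ..
    then have "zapply E (\<lambda>s. F s r) = (\<lambda>s. F s r)" by (rule fix_iff[THEN iffD2, rotated]) (simp add: F0)
    then show ?thesis unfolding col by (rule fun_cong)
  qed
  moreover have "zmult F E s r = E s r" for s r
  proof -
    have "zapply E (\<lambda>s. E s r) = (\<lambda>s. E s r)" unfolding col E(3) ..
    then have "zapply F (\<lambda>s. E s r) = (\<lambda>s. E s r)" by (rule fix_iff[THEN iffD1, rotated]) (simp add: E(1))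
    then show ?thesis unfolding col by (rule fun_cong)
  qed
  moreover have "zmult E F s r = cnj (zmult F E r s)" for s r
    unfolding zmult_def infsum_cnj[symmetric] by (simp add: Fc Ec mult.commute)
  ultimately show "F = E"
    by (intro ext) (metis Ec)
qed

text \<open>The two eigenvalues enter through the trace and the determinant of the 2 by 2 block
  rather than through the root formula, so either one may play the role of \<open>\<mu>\<close>, the
  center of the circle. The term \<open>cmod v / 10\<close> in the gap is the radius of that
  circle.\<close>

locale two_level =
  fixes j j' :: "int ^ 'n" and p :: "int ^ 'n \<Rightarrow> real" and v :: complex and \<mu> \<nu> g :: real
  assumes neq: "j \<noteq> j'" and v: "v \<noteq> 0"
    and sum_eq: "\<mu> + \<nu> = p j + p j'" and prod_eq: "\<mu> * \<nu> = p j * p j' - (cmod v)\<^sup>2"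
    and g: "g \<ge> 1" and gap: "\<And>s. s \<noteq> j \<Longrightarrow> s \<noteq> j' \<Longrightarrow> \<bar>p s - \<mu>\<bar> \<ge> g + cmod v / 10"
begin

definition "J = {j, j'}"
definition "d = cmod v / 10"

definition H :: "'n zmat" where
  "H s r = (if s = r then of_real (p s) else if s = j \<and> r = j' then v else if s = j' \<and> r = j then cnj v else 0)"

text \<open>The argument is the eigenvalue that is annihilated: the denominator is the other
  eigenvalue minus \<open>\<alpha>\<close>, so \<open>E \<nu>\<close> is the projection for
  \<open>\<mu>\<close> and \<open>E \<mu>\<close> the one for \<open>\<nu>\<close>.\<close>

definition E :: "real \<Rightarrow> 'n zmat" where
  "E \<alpha> s r = (if s \<in> J \<and> r \<in> J then (H s r - of_real \<alpha> * zone s r) / of_real (\<mu> + \<nu> - 2 * \<alpha>) else 0)"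

text \<open>Candidate for the resolvent: the spectral decomposition on \<open>J\<close> and
  reciprocals of the diagonal elsewhere.\<close>

definition R :: "complex \<Rightarrow> 'n zmat" where
  "R z s r = (if s \<in> J \<and> r \<in> J then E \<nu> s r / (of_real \<mu> - z) + E \<mu> s r / (of_real \<nu> - z)
     else if s = r then 1 / (of_real (p s) - z) else 0)"

text \<open>The part of the resolvent without a pole in the closed disc.\<close>

definition R0 :: "complex \<Rightarrow> 'n zmat" where
  "R0 z s r = (if s \<in> J then 0 else R z s r)"

lemma J: "finite J" "s \<in> J \<longleftrightarrow> s = j \<or> s = j'" "card J = 2"
  using neq by (auto simp: J_def)

lemma d_pos: "d > 0"
  using v by (simp add: d_def)

lemma sum_J: "(\<Sum>m\<in>J. f m) = f j + f j'"
  using neq by (simp add: J_def)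

lemma diff_sq: "(\<mu> - \<nu>)\<^sup>2 = (p j - p j')\<^sup>2 + 4 * (cmod v)\<^sup>2"
proof -
  have "(\<mu> - \<nu>)\<^sup>2 = (\<mu> + \<nu>)\<^sup>2 - 4 * (\<mu> * \<nu>)" by (simp add: power2_eq_square algebra_simps)
  then show ?thesis unfolding sum_eq prod_eq by (simp add: power2_eq_square algebra_simps)
qed

lemma diff_ge: "\<bar>\<mu> - \<nu>\<bar> \<ge> 2 * cmod v"
proof -
  have "(2 * cmod v)\<^sup>2 \<le> \<bar>\<mu> - \<nu>\<bar>\<^sup>2" by (simp add: diff_sq power_mult_distrib)
  then show ?thesis by (rule power2_le_imp_le) simp
qed

lemma lam_neq: "\<mu> \<noteq> \<nu>"
  using diff_ge v by auto

lemma v_cnj: "v * cnj v = of_real (p j) * of_real (p j') - of_real \<mu> * of_real \<nu>"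
proof -
  have "v * cnj v = of_real ((cmod v)\<^sup>2)" by (rule complex_norm_square[symmetric])
  also have "\<dots> = of_real (p j * p j' - \<mu> * \<nu>)" using prod_eq by simp
  finally show ?thesis by simp
qed

lemma lam'_eq: "complex_of_real \<nu> = of_real (p j) + of_real (p j') - of_real \<mu>"
  using sum_eq by (simp flip: of_real_add of_real_diff)

lemma H_J: "H j j = of_real (p j)" "H j' j' = of_real (p j')" "H j j' = v" "H j' j = cnj v"
  using neq by (auto simp: H_def)

lemma zone_J: "zone j j = (1::complex)" "zone j' j' = (1::complex)" "zone j j' = (0::complex)" "zone j' j = (0::complex)"
  using neq by (auto simp: zone_def)

lemma E_lam': "s \<in> J \<Longrightarrow> r \<in> J \<Longrightarrow> E \<nu> s r = (H s r - of_real \<nu> * zone s r) / of_real (\<mu> - \<nu>)"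
  and E_lam: "s \<in> J \<Longrightarrow> r \<in> J \<Longrightarrow> E \<mu> s r = - (H s r - of_real \<mu> * zone s r) / of_real (\<mu> - \<nu>)"
  by (simp_all add: E_def) (metis minus_diff_eq minus_divide_divide)

lemma E_out: "s \<notin> J \<or> r \<notin> J \<Longrightarrow> E \<alpha> s r = 0"
  by (auto simp: E_def)

lemma E_sum: "s \<in> J \<Longrightarrow> r \<in> J \<Longrightarrow> E \<nu> s r + E \<mu> s r = zone s r"
  using lam_neq by (simp add: E_lam E_lam' divide_simps) (simp add: algebra_simps)

lemma E_idem: "zmult (E \<nu>) (E \<nu>) = E \<nu>"
proof (intro ext)
  fix s r
  have D: "complex_of_real (\<mu> - \<nu>) \<noteq> 0" using lam_neq by simp
  have *: "E \<nu> s j * E \<nu> j r + E \<nu> s j' * E \<nu> j' r = E \<nu> s r" if sr: "s \<in> J" "r \<in> J"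
  proof -
    have "(H s j - of_real \<nu> * zone s j) * (H j r - of_real \<nu> * zone j r) +
        (H s j' - of_real \<nu> * zone s j') * (H j' r - of_real \<nu> * zone j' r) =
        of_real (\<mu> - \<nu>) * (H s r - of_real \<nu> * zone s r)"
      using sr v_cnj by (auto simp: J H_J zone_J lam'_eq) (simp_all add: algebra_simps)
    then show ?thesis
      using D sr by (simp add: E_lam' J divide_simps)
  qed
  show "zmult (E \<nu>) (E \<nu>) s r = E \<nu> s r"
  proof (cases "s \<in> J \<and> r \<in> J")
    case True
    then show ?thesis
      by (subst zmult_finite[of J]) (auto simp: J(1) sum_J E_out *)
  next
    case False
    then show ?thesis
      by (subst zmult_finite[of J]) (auto simp: J(1) E_out intro!: sum.neutral)
  qed
qed

lemma H_E:
  assumes "s \<in> J" "r \<in> J" "{\<alpha>, \<beta>} = {\<mu>, \<nu>}"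
  shows "(\<Sum>m\<in>J. H s m * E \<beta> m r) = of_real \<alpha> * E \<beta> s r"
proof -
  have "H s j * (H j r - of_real \<beta> * zone j r) + H s j' * (H j' r - of_real \<beta> * zone j' r) =
      of_real \<alpha> * (H s r - of_real \<beta> * zone s r)"
    using assms v_cnj by (auto simp: J H_J zone_J doubleton_eq_iff lam'_eq) (simp_all add: algebra_simps)
  with assms(1,2) show ?thesis
    by (simp add: sum_J E_def J flip: add_divide_distrib)
qed

lemma spec_proj_H: "spec_proj H J \<mu> = E \<nu>"
proof (rule spec_proj_eqI)
  show "E \<nu> r s = cnj (E \<nu> s r)" for s r
    by (auto simp: E_def H_def zone_def)
  fix x :: "int ^ 'n \<Rightarrow> complex"
  assume x: "\<And>s. s \<notin> J \<Longrightarrow> x s = 0"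
  have app: "zapply M x s = M s j * x j + M s j' * x j'" for M :: "'n zmat" and s
  proof -
    have "zapply M x s = (\<Sum>r\<in>J. M s r * x r)"
      unfolding zapply_def by (rule infsum_finite_support) (use x J in auto)
    then show ?thesis by (simp add: sum_J)
  qed
  have D: "complex_of_real (\<mu> - \<nu>) \<noteq> 0" using lam_neq by simp
  have "zapply (E \<nu>) x s = x s \<longleftrightarrow> zapply H x s = of_real \<mu> * x s" for s
  proof (cases "s \<in> J")
    case True
    have "zapply (E \<nu>) x s = (zapply H x s - of_real \<nu> * x s) / of_real (\<mu> - \<nu>)"
      using True by (auto simp: app E_lam' J zone_J add_divide_distrib diff_divide_distrib algebra_simps)
    then show ?thesis using D by (simp add: divide_eq_eq) (auto simp: algebra_simps)
  next
    case False
    then show ?thesis using x[of s] by (auto simp: app E_def H_def J)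
  qed
  then show "zapply (E \<nu>) x = x \<longleftrightarrow> zapply H x = (\<lambda>s. complex_of_real \<mu> * x s)"
    by (simp add: fun_eq_iff)
qed (auto simp: J(1) E_idem E_def)

lemma block_diag_HR: "block_diag J (\<lambda>s r. H s r - z * zone s r)" "block_diag J (R z)"
  using neq by (auto simp: block_diag_def H_def zone_def R_def J_def)

text \<open>The eigenvalues of the block are at least \<open>2 * cmod v\<close>, that is 20 radii,
  apart, and the gap hypothesis already contains the radius.\<close>

lemma dist_ge:
  assumes "cmod (z - of_real \<mu>) \<le> d"
  shows "cmod (of_real \<nu> - z) \<ge> d" "s \<notin> J \<Longrightarrow> cmod (of_real (p s) - z) \<ge> g"
proof -
  have "\<bar>x - \<mu>\<bar> \<le> cmod (of_real x - z) + cmod (z - of_real \<mu>)" for x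
    using norm_triangle_ineq[of "of_real x - z" "z - of_real \<mu>"] by (simp flip: of_real_diff)
  from this[of \<nu>] this[of "p s"]
  show "cmod (of_real \<nu> - z) \<ge> d" "s \<notin> J \<Longrightarrow> cmod (of_real (p s) - z) \<ge> g"
    using assms diff_ge gap[of s] v by (auto simp: J d_def)
qed

lemma dist_circle:
  assumes "cmod (z - of_real \<mu>) = d"
  shows "of_real \<mu> - z \<noteq> 0" "of_real \<nu> - z \<noteq> 0" "s \<notin> J \<Longrightarrow> of_real (p s) - z \<noteq> 0"
  using assms dist_ge(1)[of z] dist_ge(2)[of z s] d_pos g by auto

lemma resolvent_H:
  assumes z: "cmod (z - of_real \<mu>) = d"
  shows "zinv (\<lambda>s r. H s r - z * zone s r) = R z"
proof (rule zinv_eqI[OF J(1) block_diag_HR])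
  note nz = dist_circle[OF z]
  have aux: "c * e / (c - z) - z * (e / (c - z)) = e" if "c - z \<noteq> 0" for c e :: complex
  proof -
    have "c * e / (c - z) - z * (e / (c - z)) = (c * e - z * e) / (c - z)"
      by (simp only: diff_divide_distrib times_divide_eq_right)
    then show ?thesis using that by (simp flip: left_diff_distrib)
  qed
  have HR: "zmult (\<lambda>s r. H s r - z * zone s r) (R z) s r = zone s r" for s r
  proof (cases "s \<in> J")
    case s: True
    show ?thesis
    proof (cases "r \<in> J")
      case r: True
      have "(\<Sum>m\<in>J. (H s m - z * zone s m) * R z m r) =
        (\<Sum>m\<in>J. H s m * E \<nu> m r) / (of_real \<mu> - z) + (\<Sum>m\<in>J. H s m * E \<mu> m r) / (of_real \<nu> - z) - z * R z s r"
        using s r by (auto simp: sum_J R_def J zone_J algebra_simps add_divide_distrib diff_divide_distrib)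
      also have "\<dots> = (of_real \<mu> * E \<nu> s r / (of_real \<mu> - z) - z * (E \<nu> s r / (of_real \<mu> - z))) +
          (of_real \<nu> * E \<mu> s r / (of_real \<nu> - z) - z * (E \<mu> s r / (of_real \<nu> - z)))"
        using s r by (subst (1 2) H_E) (auto simp: R_def ring_distribs)
      also have "\<dots> = zone s r"
        unfolding aux[OF nz(1)] aux[OF nz(2)] by (rule E_sum[OF s r])
      finally show ?thesis using s by (simp add: zmult_block_diag[OF J(1) block_diag_HR(1)])
    next
      case False
      then show ?thesis using s
        unfolding zmult_block_diag[OF J(1) block_diag_HR(1)]
        by (auto simp: R_def zone_def intro!: sum.neutral)
    qed
  next
    case False
    then show ?thesis using nz(3)[of s]
      unfolding zmult_block_diag[OF J(1) block_diag_HR(1)]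
      by (auto simp: R_def zone_def H_def)
  qed
  then show "zmult (\<lambda>s r. H s r - z * zone s r) (R z) = zone" by auto
  have H_cnj: "H r s = cnj (H s r)" for s r by (auto simp: H_def)
  \<comment> \<open>The adjoint of \<open>H_E\<close>, since \<open>H\<close> and both
    \<open>E \<beta>\<close> are Hermitian.\<close>
  have EH: "(\<Sum>m\<in>J. E \<beta> s m * H m r) = of_real \<alpha> * E \<beta> s r"
    if "s \<in> J" "r \<in> J" "{\<alpha>, \<beta>} = {\<mu>, \<nu>}" for s r \<alpha> \<beta>
  proof -
    have E_cnj: "E \<beta> r s = cnj (E \<beta> s r)" for s r
      by (auto simp: E_def H_def zone_def)
    have "(\<Sum>m\<in>J. E \<beta> s m * H m r) = cnj (\<Sum>m\<in>J. H r m * E \<beta> m s)"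
      by (auto simp: mult.commute intro!: sum.cong) (metis H_cnj E_cnj)
    also have "\<dots> = of_real \<alpha> * E \<beta> s r"
      using that E_cnj[of s r] by (subst H_E) auto
    finally show ?thesis .
  qed
  have RH: "zmult (R z) (\<lambda>s r. H s r - z * zone s r) s r = zone s r" for s r
  proof (cases "r \<in> J")
    case r: True
    show ?thesis
    proof (cases "s \<in> J")
      case s: True
      have "(\<Sum>m\<in>J. R z s m * (H m r - z * zone m r)) =
        (\<Sum>m\<in>J. E \<nu> s m * H m r) / (of_real \<mu> - z) + (\<Sum>m\<in>J. E \<mu> s m * H m r) / (of_real \<nu> - z) - z * R z s r"
        using s r by (auto simp: sum_J R_def J zone_J algebra_simps add_divide_distrib diff_divide_distrib)
      also have "\<dots> = (of_real \<mu> * E \<nu> s r / (of_real \<mu> - z) - z * (E \<nu> s r / (of_real \<mu> - z))) +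
          (of_real \<nu> * E \<mu> s r / (of_real \<nu> - z) - z * (E \<mu> s r / (of_real \<nu> - z)))"
        using s r by (subst (1 2) EH) (auto simp: R_def ring_distribs)
      also have "\<dots> = zone s r"
        unfolding aux[OF nz(1)] aux[OF nz(2)] by (rule E_sum[OF s r])
      finally show ?thesis using r by (simp add: zmult_block_diag_right[OF J(1) block_diag_HR(1)])
    next
      case False
      then show ?thesis using r
        unfolding zmult_block_diag_right[OF J(1) block_diag_HR(1)]
        by (auto simp: R_def zone_def intro!: sum.neutral)
    qed
  next
    case False
    then show ?thesis using nz(3)[of r]
      unfolding zmult_block_diag_right[OF J(1) block_diag_HR(1)]
      by (auto simp: R_def zone_def H_def)
  qed
  then show "zmult (R z) (\<lambda>s r. H s r - z * zone s r) = zone" by auto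
qed

text \<open>The diagonal entries are \<open>x\<close> and \<open>y\<close> with sum 1 and product
  \<open>(cmod v)\<^sup>2 / D\<^sup>2\<close>, which is nonnegative, so both lie in [0, 1]. The
  off-diagonal entries have modulus \<open>cmod v / \<bar>D\<bar>\<close>, controlled by
  \<open>diff_ge\<close>.\<close>

lemma E_le_1: "cmod (E \<nu> s r) \<le> 1" "cmod (E \<mu> s r) \<le> 1"
proof -
  define D where "D = \<mu> - \<nu>"
  have D: "D \<noteq> 0" using lam_neq by (simp add: D_def)
  define x where "x = (p j - \<nu>) / D"
  define y where "y = (p j' - \<nu>) / D"
  have 1: "x + y = 1" using D sum_eq by (simp add: x_def y_def D_def flip: add_divide_distrib)
  have "(p j - \<nu>) * (p j' - \<nu>) = p j * p j' - \<nu> * (p j + p j') + \<nu> * \<nu>" by (simp add: algebra_simps)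
  also have "\<dots> = (cmod v)\<^sup>2" unfolding sum_eq[symmetric] using prod_eq by (simp add: algebra_simps)
  finally have "x * y \<ge> 0" using D by (simp add: x_def y_def flip: power2_eq_square)
  with 1 have xy: "0 \<le> x" "x \<le> 1" "0 \<le> y" "y \<le> 1"
    by (auto simp: zero_le_mult_iff)
  have vD: "cmod v \<le> \<bar>D\<bar>" using diff_ge norm_ge_zero[of v] by (simp add: D_def)
  have E': "cmod (E \<nu> j j) = \<bar>x\<bar>" "cmod (E \<nu> j' j') = \<bar>y\<bar>" "cmod (E \<nu> j j') \<le> 1" "cmod (E \<nu> j' j) \<le> 1"
    using D vD by (simp_all add: E_lam' J H_J zone_J x_def y_def norm_divide divide_simps flip: D_def of_real_diff)
  have E: "cmod (E \<mu> j j) = \<bar>y\<bar>" "cmod (E \<mu> j' j') = \<bar>x\<bar>" "cmod (E \<mu> j j') \<le> 1" "cmod (E \<mu> j' j) \<le> 1"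
  proof -
    have "E \<mu> j j = of_real y" "E \<mu> j' j' = of_real x"
      using D sum_eq by (simp_all add: E_lam J H_J zone_J x_def y_def flip: D_def of_real_diff of_real_divide of_real_minus)
    then show "cmod (E \<mu> j j) = \<bar>y\<bar>" "cmod (E \<mu> j' j') = \<bar>x\<bar>" by simp_all
    show "cmod (E \<mu> j j') \<le> 1" "cmod (E \<mu> j' j) \<le> 1"
      using D vD by (simp_all add: E_lam J H_J zone_J norm_divide divide_simps flip: D_def of_real_diff)
  qed
  show "cmod (E \<nu> s r) \<le> 1" "cmod (E \<mu> s r) \<le> 1"
  proof -
    show "cmod (E \<nu> s r) \<le> 1"
    proof (cases "s \<in> J \<and> r \<in> J")
      case True
      then show ?thesis using E' xy by (auto simp: J)
    qed (auto simp: E_def)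
    show "cmod (E \<mu> s r) \<le> 1"
    proof (cases "s \<in> J \<and> r \<in> J")
      case True
      then show ?thesis using E xy by (auto simp: J)
    qed (auto simp: E_def)
  qed
qed


section \<open>Majorants of the resolvent and the weighted norm\<close>

definition rho0 :: "(int ^ 'n) emat" where
  "rho0 s r = (if s \<notin> J \<and> s = r then ennreal (1 / g) else 0)"

text \<open>The value \<open>2 / d\<close> comes from two spectral projections with entries at most
  1, each divided by a distance of at least \<open>d\<close>.\<close>

definition rhoJ :: "(int ^ 'n) emat" where
  "rhoJ s r = (if s \<in> J \<and> r \<in> J then ennreal (2 / d) else 0)"

definition rho :: "(int ^ 'n) emat" where
  "rho = eadd rho0 rhoJ"

definition w :: "int ^ 'n \<Rightarrow> ennreal" where
  "w s = (if s \<in> J then 1 else ennreal (sqrt g))"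

lemma w: "w s \<ge> 1" "w s \<noteq> 0" "w s \<noteq> top"
proof -
  show "w s \<ge> 1" using g by (simp add: w_def ennreal_1[symmetric] del: ennreal_1)
  then show "w s \<noteq> 0" by auto
  show "w s \<noteq> top" by (simp add: w_def)
qed

lemma col_boundedI: "col_bound w a A \<Longrightarrow> A \<noteq> top \<Longrightarrow> col_bounded w a"
  unfolding col_bounded_def using w by blast

lemma R_bound:
  assumes z: "cmod (z - of_real \<mu>) = d"
  shows "cmod (R z s r) \<le> (if s \<in> J \<and> r \<in> J then 2 / d else if s = r then 1 / g else 0)"
proof (cases "s \<in> J \<and> r \<in> J")
  case True
  have "cmod (R z s r) \<le> cmod (E \<nu> s r) / cmod (of_real \<mu> - z) + cmod (E \<mu> s r) / cmod (of_real \<nu> - z)"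
    using True norm_triangle_ineq[of "E \<nu> s r / (of_real \<mu> - z)" "E \<mu> s r / (of_real \<nu> - z)"]
    by (simp add: R_def norm_divide)
  also have "\<dots> \<le> 1 / d + 1 / d"
    using z dist_ge(1)[of z] d_pos E_le_1[of s r] by (intro add_mono frac_le) (auto simp: norm_minus_commute)
  finally show ?thesis using True by simp
next
  case False
  then show ?thesis
    using dist_ge(2)[of z s] z g by (auto simp: R_def norm_divide intro!: divide_left_mono mult_pos_pos)
qed

lemma majorized_R:
  assumes "cmod (z - of_real \<mu>) = d"
  shows "majorized (R z) rho"
  unfolding majorized_def
proof (intro allI)
  fix s r
  show "ennreal (cmod (R z s r)) \<le> rho s r"
    using R_bound[OF assms, of s r]
    by (auto simp: rho_def eadd_def rho0_def rhoJ_def intro!: ennreal_leI split: if_splits)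
qed

lemma majorized_R_diff:
  assumes "cmod (z - of_real \<mu>) = d"
  shows "majorized (\<lambda>s r. R z s r - R0 z s r) rhoJ"
  unfolding majorized_def
proof (intro allI)
  fix s r
  show "ennreal (cmod (R z s r - R0 z s r)) \<le> rhoJ s r"
    using R_bound[OF assms, of s r]
    by (auto simp: R0_def rhoJ_def intro!: ennreal_leI split: if_splits)
qed

lemma majorized_on_R: "majorized_on (sphere (of_real \<mu>) d) R rho"
  unfolding majorized_on_def
proof (intro conjI ballI allI)
  fix z assume "z \<in> sphere (complex_of_real \<mu>) d"
  then show "majorized (R z) rho" by (intro majorized_R) (simp add: dist_norm norm_minus_commute)
next
  fix s r
  show "continuous_on (sphere (of_real \<mu>) d) (\<lambda>z. R z s r)"
  proof (cases "s \<in> J \<and> r \<in> J")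
    case True
    have "of_real \<mu> - z \<noteq> 0" "of_real \<nu> - z \<noteq> 0" if "z \<in> sphere (complex_of_real \<mu>) d" for z
      using dist_circle[of z] that by (auto simp: dist_norm norm_minus_commute)
    with True show ?thesis unfolding R_def by (auto intro!: continuous_intros)
  next
    case False
    show ?thesis
    proof (cases "s = r")
      case True
      have "of_real (p s) - z \<noteq> 0" if "z \<in> sphere (complex_of_real \<mu>) d" for z
        using dist_circle(3)[of z s] that True False by (auto simp: dist_norm norm_minus_commute)
      with False True show ?thesis unfolding R_def by (auto intro!: continuous_intros)
    next
      case neq: False
      then have "(\<lambda>z. R z s r) = (\<lambda>z. 0)" using False by (auto simp: R_def fun_eq_iff)
      then show ?thesis by (simp only: continuous_on_const)
    qed
  qed
  show "(\<lambda>z. R z s r) holomorphic_on interior (sphere (of_real \<mu>) d)"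
  proof -
    have "negligible (interior (sphere (complex_of_real \<mu>) d))"
      by (rule negligible_subset[OF negligible_sphere interior_subset])
    then have "interior (sphere (complex_of_real \<mu>) d) = {}"
      using open_not_negligible[OF open_interior] by blast
    then show ?thesis by (simp only: holomorphic_on_empty)
  qed
qed

lemma majorized_on_R0: "majorized_on (cball (of_real \<mu>) d) R0 rho0"
  unfolding majorized_on_def
proof (intro conjI ballI allI)
  fix z assume z: "z \<in> cball (complex_of_real \<mu>) d"
  show "majorized (R0 z) rho0"
    unfolding majorized_def
  proof (intro allI)
    fix s r
    show "ennreal (cmod (R0 z s r)) \<le> rho0 s r"
    proof (cases "s \<notin> J \<and> s = r")
      case True
      have "g \<le> cmod (of_real (p s) - z)"
        using True z by (intro dist_ge(2)) (auto simp: dist_norm norm_minus_commute)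
      then have "1 / cmod (of_real (p s) - z) \<le> 1 / g"
        using g by (intro divide_left_mono mult_pos_pos) auto
      then show ?thesis using True by (simp add: R0_def R_def rho0_def norm_divide ennreal_leI)
    qed (auto simp: R0_def R_def)
  qed
next
  fix s r
  have nz: "of_real (p s) - z \<noteq> 0" if "z \<in> cball (complex_of_real \<mu>) d" "s \<notin> J" for z
    using dist_ge(2)[of z s] that g by (auto simp: dist_norm norm_minus_commute)
  show "continuous_on (cball (of_real \<mu>) d) (\<lambda>z. R0 z s r)"
  proof (cases "s \<in> J \<or> s \<noteq> r")
    case True
    then have "(\<lambda>z. R0 z s r) = (\<lambda>z. 0)" by (auto simp: R0_def R_def)
    then show ?thesis by (simp only: continuous_on_const)
  next
    case False
    then show ?thesis unfolding R0_def R_def using nz by (auto intro!: continuous_intros)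
  qed
  show "(\<lambda>z. R0 z s r) holomorphic_on interior (cball (of_real \<mu>) d)"
  proof (cases "s \<in> J \<or> s \<noteq> r")
    case True
    then have "(\<lambda>z. R0 z s r) = (\<lambda>z. 0)" by (auto simp: R0_def R_def)
    then show ?thesis by (simp only: holomorphic_on_const)
  next
    case False
    then show ?thesis unfolding R0_def R_def using nz by (auto intro!: holomorphic_intros)
  qed
qed

lemma esum_J: "esum (\<lambda>s. if s \<in> J then f s else 0) = f j + f j'"
proof -
  have "esum (\<lambda>s. if s \<in> J then f s else 0) = (\<Sum>s\<in>J. if s \<in> J then f s else 0)"
    by (rule nn_integral_count_space') (use J(1) in auto)
  then show ?thesis by (simp add: sum_J J)
qed

lemma emult_rho:
  "emult rho y s r = (if s \<in> J then ennreal (2 / d) * (y j r + y j' r) else ennreal (1 / g) * y s r)"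
proof (cases "s \<in> J")
  case True
  have "emult rho y s r = esum (\<lambda>m. if m \<in> J then ennreal (2 / d) * y m r else 0)"
    unfolding emult_def rho_def rhoJ_def rho0_def eadd_def using True by (intro nn_integral_cong) auto
  then show ?thesis using True unfolding esum_J by (simp add: distrib_left)
next
  case False
  have "emult rho y s r = esum (\<lambda>m. if m = s then ennreal (1 / g) * y m r else 0)"
    unfolding emult_def rho_def rhoJ_def rho0_def eadd_def using False by (intro nn_integral_cong) auto
  then show ?thesis using False by (simp add: esum_delta)
qed

lemma sqrt_g: "ennreal (1 / sqrt g) * ennreal (sqrt g) = 1" "ennreal (sqrt g) * ennreal (1 / g) = ennreal (1 / sqrt g)"
  using g by (auto simp: real_sqrt_ge_zero real_div_sqrt divide_simps power2_eq_square simp flip: ennreal_mult)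

text \<open>The weight trades the size of the entries of \<open>y\<close> between \<open>J\<close> and its complement against
  the size \<open>1 / g\<close> of the resolvent off \<open>J\<close>; only the entries within \<open>J\<close> keep their full size.\<close>

lemma col_bound_rho_mult:
  assumes N: "\<And>r. esum (\<lambda>s. y s r) \<le> N" and \<eta>: "\<And>r. r \<in> J \<Longrightarrow> y j r + y j' r \<le> \<eta>"
  shows "col_bound w (emult rho y) (ennreal (4 / d) * (\<eta> + N * ennreal (1 / sqrt g)) + N * ennreal (1 / sqrt g))"
  unfolding col_bound_def
proof
  fix r
  let ?\<theta> = "ennreal (1 / sqrt g)"
  have S: "y j r + y j' r \<le> (\<eta> + N * ?\<theta>) * w r"
  proof (cases "r \<in> J")
    case True
    then show ?thesis using \<eta>[of r] by (simp add: w_def add_increasing2)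
  next
    case False
    have "y j r + y j' r = esum (\<lambda>s. if s \<in> J then y s r else 0)"
      by (simp add: esum_J)
    also have "\<dots> \<le> esum (\<lambda>s. y s r)"
      by (intro esum_mono) auto
    also have "\<dots> \<le> N * (?\<theta> * ennreal (sqrt g))"
      using N[of r] by (simp add: sqrt_g)
    also have "\<dots> \<le> (\<eta> + N * ?\<theta>) * w r"
      using False by (simp add: w_def distrib_right mult.assoc)
    finally show ?thesis .
  qed
  have "esum (\<lambda>s. w s * emult rho y s r) \<le>
      esum (\<lambda>s. (if s \<in> J then ennreal (2 / d) * (y j r + y j' r) else 0) + ?\<theta> * y s r)"
    by (intro esum_mono) (auto simp: emult_rho w_def mult.assoc[symmetric] sqrt_g)
  also have "\<dots> = 2 * (ennreal (2 / d) * (y j r + y j' r)) + ?\<theta> * esum (\<lambda>s. y s r)"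
    by (simp add: nn_integral_add nn_integral_cmult esum_J mult_2)
  also have "2 * (ennreal (2 / d) * (y j r + y j' r)) = ennreal (4 / d) * (y j r + y j' r)"
    using d_pos by (simp add: mult.assoc[symmetric] ennreal_numeral[symmetric] del: ennreal_numeral flip: ennreal_mult)
  also have "ennreal (4 / d) * (y j r + y j' r) + ?\<theta> * esum (\<lambda>s. y s r) \<le>
      ennreal (4 / d) * ((\<eta> + N * ?\<theta>) * w r) + ?\<theta> * (N * w r)"
    using S N[of r] w(1)[of r] by (intro add_mono mult_left_mono) (auto intro: order_trans[OF _ mult_left_mono[of 1 "w r" N, simplified]])
  also have "\<dots> = (ennreal (4 / d) * (\<eta> + N * ?\<theta>) + N * ?\<theta>) * w r"
    by (simp add: distrib_left distrib_right mult_ac)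
  finally show "esum (\<lambda>s. w s * emult rho y s r) \<le> (ennreal (4 / d) * (\<eta> + N * ?\<theta>) + N * ?\<theta>) * w r" .
qed

lemma col_bound_rho: "col_bound w rho (ennreal (4 / d) + 1)"
  unfolding col_bound_def
proof
  fix r
  have "esum (\<lambda>s. w s * rho s r) \<le> esum (\<lambda>s. (if s \<in> J then ennreal (2 / d) else 0) + (if s = r then w r else 0))"
  proof (intro esum_mono)
    fix s
    have "ennreal (1 / g) \<le> 1" using g by (simp add: ennreal_1[symmetric] del: ennreal_1)
    then have "w s * ennreal (1 / g) \<le> w s * 1" by (rule mult_left_mono) simp
    then show "w s * rho s r \<le> (if s \<in> J then ennreal (2 / d) else 0) + (if s = r then w r else 0)"
      by (auto simp: rho_def eadd_def rho0_def rhoJ_def) (auto simp: w_def)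
  qed
  also have "\<dots> = 2 * ennreal (2 / d) + w r"
    by (simp add: nn_integral_add esum_delta esum_J mult_2)
  also have "2 * ennreal (2 / d) = ennreal (4 / d)"
    using d_pos by (simp add: ennreal_numeral[symmetric] del: ennreal_numeral flip: ennreal_mult)
  also have "ennreal (4 / d) + w r \<le> (ennreal (4 / d) + 1) * w r"
    using w(1)[of r] by (simp add: distrib_right) (metis mult.right_neutral mult_left_mono zero_le)
  finally show "esum (\<lambda>s. w s * rho s r) \<le> (ennreal (4 / d) + 1) * w r" .
qed

lemma col_bounded_rho: "col_bounded w rho"
  by (rule col_boundedI[OF col_bound_rho]) simp

lemma rho_split: "emult rho y = eadd (emult rho0 y) (emult rhoJ y)"
  by (simp add: rho_def emult_eadd_left)

lemma majorized_on_const: "majorized Y y \<Longrightarrow> majorized_on S (\<lambda>z. Y) y"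
  by (simp add: majorized_on_def)

text \<open>Powers of \<open>R0\<close> times \<open>Y\<close> describe the paths that avoid
  \<open>J\<close>; they are holomorphic in the disc and integrate to 0. Subtracting them replaces a
  trace over all lattice points by the trace of \<open>epow_diff\<close>, which is finite. The
  factor \<open>n\<close> counts the terms of the telescoping difference and 2 is
  \<open>card J\<close>.\<close>

lemma trace_bound:
  assumes Y: "majorized Y y" and K: "col_bound w (emult rho y) K" "K \<noteq> top"
  shows "ennreal (cmod (\<Sum>\<^sub>\<infinity>s. contour_integral (circlepath (of_real \<mu>) d)
      (\<lambda>z. zpow (zmult (R z) Y) n s s))) \<le> ennreal (2 * pi * d) * (of_nat n * 2 * K ^ n)"
proof -
  let ?C = "circlepath (of_real \<mu>) d" and ?a = "emult rho y" and ?az = "emult rho0 y" and ?aJ = "emult rhoJ y"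
  let ?T = "\<lambda>z. zmult (R z) Y" and ?Tz = "\<lambda>z. zmult (R0 z) Y"
  have ba: "col_bounded w ?a" by (rule col_boundedI[OF K])
  have le: "?az \<le> ?a" "?aJ \<le> ?a"
    unfolding rho_split eadd_def le_fun_def by auto
  have b0: "col_bounded w ?az" "col_bounded w ?aJ"
    by (rule col_boundedI[OF col_bound_mono[OF K(1) le(1) order_refl] K(2)],
        rule col_boundedI[OF col_bound_mono[OF K(1) le(2) order_refl] K(2)])
  note fin = col_bounded_finite[OF ba] col_bounded_finite[OF b0(1)] col_bounded_finite[OF b0(2)]
  have T: "majorized_on (sphere (of_real \<mu>) d) ?T ?a"
    by (rule majorized_on_zmult[OF majorized_on_R majorized_on_const[OF Y] fin(1)])
  have T0: "majorized_on (cball (of_real \<mu>) d) ?Tz ?az"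
    by (rule majorized_on_zmult[OF majorized_on_R0 majorized_on_const[OF Y] fin(2)])
  have T0': "majorized_on (sphere (of_real \<mu>) d) ?Tz ?az"
    by (rule majorized_on_subset[OF T0 sphere_cball])
  have maj: "majorized (\<lambda>s r. zpow (?T z) n s r - zpow (?Tz z) n s r) (epow_diff ?az ?aJ ?a n)"
    if z: "z \<in> sphere (of_real \<mu>) d" for z
  proof (rule majorized_zpow_diff[OF _ _ _ ba b0])
    show "majorized (?T z) ?a" "majorized (?Tz z) ?az" using T T0' z by (auto simp: majorized_on_def)
    have z': "cmod (z - of_real \<mu>) = d" using z by (simp add: dist_norm norm_minus_commute)
    have R0: "majorized (R0 z) rho0" using majorized_on_R0 z by (auto simp: majorized_on_def)
    have "?T z s r - ?Tz z s r = zmult (\<lambda>s r. R z s r - R0 z s r) Y s r" for s r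
      by (rule zmult_diff_left[OF Y majorized_R[OF z'] R0 fin(1,2), symmetric])
    then show "majorized (\<lambda>s r. ?T z s r - ?Tz z s r) ?aJ"
      using majorized_zmult[OF majorized_R_diff[OF z'] Y] by simp
  qed
  have int: "contour_integral ?C (\<lambda>z. zpow (?T z) n s s) =
      contour_integral ?C (\<lambda>z. zpow (?T z) n s s - zpow (?Tz z) n s s)" for s
  proof -
    have "contour_integral ?C (\<lambda>z. zpow (?Tz z) n s s) = 0"
      by (rule contour_integral_disc_zero[OF majorized_on_zpow[OF T0 b0(1)] d_pos])
    moreover have "(\<lambda>z. zpow (?T z) n s s) contour_integrable_on ?C"
      by (rule contour_integrable_majorized[OF majorized_on_zpow[OF T ba] d_pos])
    moreover have "(\<lambda>z. zpow (?Tz z) n s s) contour_integrable_on ?C"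
      by (rule contour_integrable_majorized[OF majorized_on_zpow[OF T0' b0(1)] d_pos])
    ultimately show ?thesis by (simp add: contour_integral_diff)
  qed
  have "ennreal (cmod (\<Sum>\<^sub>\<infinity>s. contour_integral ?C (\<lambda>z. zpow (?T z) n s s))) \<le>
      esum (\<lambda>s. ennreal (cmod (contour_integral ?C (\<lambda>z. zpow (?T z) n s s))))"
    by (rule infsum_le_esum)
  also have "\<dots> \<le> esum (\<lambda>s. ennreal (2 * pi * d) * epow_diff ?az ?aJ ?a n s s)"
    unfolding int by (intro esum_mono contour_integral_majorized[OF maj d_pos])
  \<comment> \<open>The zeroth power is inserted to match \<open>etrace_epow_diff\<close>, whose
    exponent \<open>i\<close> exists for the sake of its induction.\<close>
  also have "\<dots> = ennreal (2 * pi * d) * etrace (emult (epow ?az 0) (epow_diff ?az ?aJ ?a n))"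
    by (simp add: etrace_def nn_integral_cmult)
  also have "etrace (emult (epow ?az 0) (epow_diff ?az ?aJ ?a n)) \<le> of_nat n * of_nat (card J) * K ^ (n + 0)"
    by (rule etrace_epow_diff[OF K(1) rho_split J(1)])
      (use w in \<open>auto simp: emult_def rhoJ_def less_top[symmetric]\<close>)
  finally show ?thesis by (simp add: J(3) mult_left_mono)
qed

text \<open>The weight is at least 1 everywhere and equal to 1 on \<open>J\<close>, so a column
  indexed by \<open>J\<close> has plain sum at most \<open>A\<close>. The function \<open>u\<close>
  is built from such a column.\<close>

lemma column_le:
  assumes "col_bound w a A" "r \<in> J"
  shows "esum (\<lambda>s. a s r) \<le> A"
proof -
  have "esum (\<lambda>s. a s r) \<le> esum (\<lambda>s. w s * a s r)"
  proof (rule esum_mono)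
    fix s show "a s r \<le> w s * a s r" using mult_right_mono[OF w(1)[of s], of "a s r"] by simp
  qed
  also have "\<dots> \<le> A * w r" using assms(1) by (simp add: col_bound_def)
  finally show ?thesis using assms(2) by (simp add: w_def)
qed

lemma column_bound:
  assumes Y: "majorized Y y" and K: "col_bound w (emult rho y) K" and r: "r \<in> J"
  shows "esum (\<lambda>s. ennreal (cmod (contour_integral (circlepath (of_real \<mu>) d)
      (\<lambda>z. zmult (zpow (zmult (R z) Y) n) (R z) s r)))) \<le> ennreal (2 * pi * d) * (K ^ n * (ennreal (4 / d) + 1))"
proof -
  have "majorized (zmult (zpow (zmult (R z) Y) n) (R z)) (emult (epow (emult rho y) n) rho)"
    if "z \<in> sphere (of_real \<mu>) d" for z
    using that by (intro majorized_zmult majorized_zpow majorized_R Y) (auto simp: dist_norm norm_minus_commute)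
  then have "esum (\<lambda>s. ennreal (cmod (contour_integral (circlepath (of_real \<mu>) d)
      (\<lambda>z. zmult (zpow (zmult (R z) Y) n) (R z) s r)))) \<le>
      esum (\<lambda>s. ennreal (2 * pi * d) * emult (epow (emult rho y) n) rho s r)"
    by (intro esum_mono contour_integral_majorized d_pos)
  also have "\<dots> = ennreal (2 * pi * d) * esum (\<lambda>s. emult (epow (emult rho y) n) rho s r)"
    by (simp add: nn_integral_cmult)
  also have "\<dots> \<le> ennreal (2 * pi * d) * (K ^ n * (ennreal (4 / d) + 1))"
    by (intro mult_left_mono column_le[OF _ r] col_bound_emult col_bound_epow col_bound_rho K) simp
  finally show ?thesis .
qed

lemma column_diff_bound:
  assumes Y: "majorized Y y" "majorized Y' y'" "majorized (\<lambda>s r. Y s r - Y' s r) yd"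
    and K: "col_bound w (emult rho y) K" "col_bound w (emult rho y') K" "K \<noteq> top"
    and L: "col_bound w (emult rho yd) L" "L \<noteq> top" and r: "r \<in> J"
  shows "esum (\<lambda>s. ennreal (cmod (
      contour_integral (circlepath (of_real \<mu>) d) (\<lambda>z. zmult (zpow (zmult (R z) Y) n) (R z) s r) -
      contour_integral (circlepath (of_real \<mu>) d) (\<lambda>z. zmult (zpow (zmult (R z) Y') n) (R z) s r))))
    \<le> ennreal (2 * pi * d) * (of_nat n * K ^ (n - 1) * L * (ennreal (4 / d) + 1))"
proof -
  let ?C = "circlepath (of_real \<mu>) d" and ?a = "emult rho y" and ?a' = "emult rho y'" and ?c = "emult rho yd"
  let ?T = "\<lambda>z. zmult (R z) Y" and ?T' = "\<lambda>z. zmult (R z) Y'"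
  have b: "col_bounded w ?a" "col_bounded w ?a'" "col_bounded w ?c"
    using col_boundedI[OF K(1,3)] col_boundedI[OF K(2,3)] col_boundedI[OF L] by auto
  have fin: "?a s r \<noteq> top" "?a' s r \<noteq> top" for s r
    using col_bounded_finite[OF b(1)] col_bounded_finite[OF b(2)] by blast+
  have fin': "emult (epow ?a n) rho s r \<noteq> top" "emult (epow ?a' n) rho s r \<noteq> top" for s r
    by (intro col_bounded_finite[of w] col_bounded_emult col_bounded_epow b col_bounded_rho)+
  have F: "(\<lambda>z. zmult (zpow (zmult (R z) X) n) (R z) s r) contour_integrable_on ?C"
    if "majorized X x" "col_bounded w (emult rho x)" for X x s
  proof (rule contour_integrable_majorized[OF majorized_on_zmult[OF majorized_on_zpow[OF majorized_on_zmult] majorized_on_R] d_pos])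
    show "majorized_on (sphere (of_real \<mu>) d) R rho" by (rule majorized_on_R)
    show "majorized_on (sphere (of_real \<mu>) d) (\<lambda>_. X) x" by (rule majorized_on_const[OF that(1)])
    show "col_bounded w (emult rho x)" by fact
    show "emult rho x s r \<noteq> top" for s r by (rule col_bounded_finite[OF that(2)])
    show "emult (epow (emult rho x) n) rho s r \<noteq> top" for s r
      by (intro col_bounded_finite[of w] col_bounded_emult col_bounded_epow that col_bounded_rho)
  qed
  have maj: "majorized (\<lambda>s r. zmult (zpow (?T z) n) (R z) s r - zmult (zpow (?T' z) n) (R z) s r)
      (emult (epow_diff ?a' ?c ?a n) rho)" if z: "z \<in> sphere (of_real \<mu>) d" for z
  proof -
    have z': "cmod (z - of_real \<mu>) = d" using z by (simp add: dist_norm norm_minus_commute)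
    note R = majorized_R[OF z']
    have T: "majorized (?T z) ?a" "majorized (?T' z) ?a'"
      by (intro majorized_zmult R Y)+
    have "?T z s r - ?T' z s r = zmult (R z) (\<lambda>s r. Y s r - Y' s r) s r" for s r
      by (rule zmult_diff_right[OF R Y(1,2) fin, symmetric])
    then have "majorized (\<lambda>s r. ?T z s r - ?T' z s r) ?c"
      using majorized_zmult[OF R Y(3)] by simp
    then have D: "majorized (\<lambda>s r. zpow (?T z) n s r - zpow (?T' z) n s r) (epow_diff ?a' ?c ?a n)"
      by (rule majorized_zpow_diff[OF T _ b])
    have "zmult (zpow (?T z) n) (R z) s r - zmult (zpow (?T' z) n) (R z) s r =
        zmult (\<lambda>s r. zpow (?T z) n s r - zpow (?T' z) n s r) (R z) s r" for s r
      by (rule zmult_diff_left[OF R majorized_zpow[OF T(1)] majorized_zpow[OF T(2)] fin', symmetric])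
    then show ?thesis using majorized_zmult[OF D R] by simp
  qed
  have "esum (\<lambda>s. ennreal (cmod (
      contour_integral ?C (\<lambda>z. zmult (zpow (?T z) n) (R z) s r) - contour_integral ?C (\<lambda>z. zmult (zpow (?T' z) n) (R z) s r))))
    \<le> esum (\<lambda>s. ennreal (2 * pi * d) * emult (epow_diff ?a' ?c ?a n) rho s r)"
    unfolding contour_integral_diff[OF F[OF Y(1) b(1)] F[OF Y(2) b(2)], symmetric]
    by (intro esum_mono contour_integral_majorized[OF maj d_pos])
  also have "\<dots> = ennreal (2 * pi * d) * esum (\<lambda>s. emult (epow_diff ?a' ?c ?a n) rho s r)"
    by (simp add: nn_integral_cmult)
  also have "\<dots> \<le> ennreal (2 * pi * d) * (of_nat n * K ^ (n - 1) * L * (ennreal (4 / d) + 1))"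
    by (intro mult_left_mono column_le[OF _ r] col_bound_emult col_bound_epow_diff col_bound_rho K L) simp
  finally show ?thesis .
qed

end

section \<open>Transfer of the abstract bounds to the perturbation series and the nonlinear
  iteration\<close>

section \<open>Eigenvalue, projection and iteration\<close>

lemma esum_shift: "esum (\<lambda>s::int^'n. f (s - r)) = esum f"
  by (rule nn_integral_bij_count_space) (rule bij_betwI[where g="\<lambda>s. s + r"], auto)

locale model =
  fixes l :: nat and V :: "real ^ 'n \<Rightarrow> real" and q j :: "int ^ 'n" and \<epsilon> :: real and t :: "real ^ 'n"
    and g :: real
  assumes V: "V \<in> star_space" "fourier V 0 = 0" and q: "q \<noteq> 0" "fourier V q \<noteq> 0"
    and \<epsilon>: "\<epsilon> \<in> {1, -1}" and g1: "g \<ge> 1"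
    and gap_lamhat: "\<And>s. s \<noteq> j \<Longrightarrow> s \<noteq> j - q \<Longrightarrow>
      \<bar>pt s t ^ (2 * l) - lamhat l V q \<epsilon> j t\<bar> \<ge> g + cmod (fourier V q) / 10"
begin

text \<open>The second eigenvalue is \<open>lamhat\<close> with the opposite sign, so one argument
  covers both choices of sign.\<close>

sublocale two_level j "j - q" "\<lambda>s. pt s t ^ (2 * l)" "fourier V q" "lamhat l V q \<epsilon> j t" "lamhat l V q (- \<epsilon>) j t" g
proof
  let ?x = "pt j t ^ (2 * l)" and ?y = "pt (j - q) t ^ (2 * l)"
  define a where "a = (?x + ?y) / 2"
  define b where "b = sqrt (4 * (cmod (fourier V q))\<^sup>2 + (?x - ?y)\<^sup>2) / 2"
  have "b * b = (cmod (fourier V q))\<^sup>2 + (?x - ?y)\<^sup>2 / 4"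
    by (simp add: b_def add_divide_distrib)
  moreover have "lamhat l V q \<epsilon> j t = a + \<epsilon> * b" "lamhat l V q (- \<epsilon>) j t = a - \<epsilon> * b"
    by (simp_all add: lamhat_def a_def b_def)
  ultimately have "lamhat l V q \<epsilon> j t * lamhat l V q (- \<epsilon>) j t = a * a - ((cmod (fourier V q))\<^sup>2 + (?x - ?y)\<^sup>2 / 4)"
    using \<epsilon> by (auto simp: algebra_simps)
  moreover have "a * a - (?x - ?y)\<^sup>2 / 4 = ?x * ?y"
    by (simp add: a_def power2_eq_square field_simps)
  ultimately show "lamhat l V q \<epsilon> j t * lamhat l V q (- \<epsilon>) j t = ?x * ?y - (cmod (fourier V q))\<^sup>2"
    by simp
qed (use q g1 gap_lamhat in \<open>auto simp: lamhat_def\<close>)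

lemma d_eq: "radius_d V q = d"
  by (simp add: radius_d_def d_def)

text \<open>The vanishing mean of \<open>V\<close> removes the diagonal of \<open>PVP\<close>, and
  since \<open>V\<close> is real the two off-diagonal entries are conjugate.\<close>

lemma Hhat_eq: "Hhat l V q j t = H"
  using q V fourier_uminus_index[of V q]
  by (intro ext) (auto simp: Hhat_def H0_def PVP_def H_def mult_op_def)

lemma C1_eq: "C1 l V q \<epsilon> j t = circlepath (of_real (lamhat l V q \<epsilon> j t)) d"
  by (simp add: C1_def d_eq)

lemma Ehat_eq: "Ehat l V q \<epsilon> j t = E (lamhat l V q (- \<epsilon>) j t)"
  unfolding Ehat_def Hhat_eq by (metis J_def spec_proj_H)

lemma resolvent_eq:
  "z \<in> path_image (circlepath (of_real (lamhat l V q \<epsilon> j t)) d) \<Longrightarrow> resolvent l V q j t z = R z"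
  unfolding resolvent_def Hhat_eq using d_pos
  by (intro resolvent_H) (auto simp: dist_norm norm_minus_commute)

abbreviation "Y W \<equiv> Yop V q j W"

lemma Ghat_eq: "Ghat l V q \<epsilon> j t W r s s' = (-1) ^ (r + 1) / (2 * complex_of_real pi * \<i>) *
     contour_integral (circlepath (of_real (lamhat l V q \<epsilon> j t)) d)
       (\<lambda>z. zmult (zpow (zmult (R z) (Y W)) r) (R z) s s')"
  unfolding Ghat_def C1_eq by (intro arg_cong2[where f="(*)"] refl contour_integral_eq) (simp add: resolvent_eq)

lemma ghat_eq: "ghat l V q \<epsilon> j t W r = (-1) ^ r / (2 * complex_of_real pi * \<i> * of_nat r) *
     (\<Sum>\<^sub>\<infinity>s. contour_integral (circlepath (of_real (lamhat l V q \<epsilon> j t)) d)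
       (\<lambda>z. zpow (zmult (R z) (Y W)) r s s))"
  unfolding ghat_def C1_eq
  by (intro arg_cong2[where f="(*)"] refl infsum_cong contour_integral_eq) (simp add: resolvent_eq)

definition y :: "(real ^ 'n \<Rightarrow> real) \<Rightarrow> (int ^ 'n) emat" where
  "y W s r = ennreal (cmod (Y W s r))"

lemma Y_eq: "Y W s r = fourier W (s - r) - (if s \<in> J \<and> r \<in> J then fourier V (s - r) else 0)"
  by (simp add: Yop_def PVP_def mult_op_def J_def)

lemma majorized_Y: "majorized (Y W) (y W)"
  by (simp add: majorized_def y_def)

text \<open>The bound of \<open>col_bound_rho_mult\<close> with block part \<open>\<eta>\<close> and
  column sums \<open>\<eta> + star_norm V\<close>. The factor \<open>4 / d\<close> counts the two
  rows of \<open>J\<close>, each with entries \<open>2 / d\<close>.\<close>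

definition kappa :: "real \<Rightarrow> real" where
  "kappa \<eta> = 4 / d * (\<eta> + (\<eta> + star_norm V) / sqrt g) + (\<eta> + star_norm V) / sqrt g"

lemma star_norm_nonneg: "star_norm V \<ge> 0"
  by (simp add: star_norm_def infsum_nonneg)

lemma col_sum_le:
  assumes "\<And>s r. y' s r \<le> ennreal (cmod (c (s - r)))"
  shows "esum (\<lambda>s. y' s r) \<le> fnorm c" "y' j r + y' (j - q) r \<le> fnorm c"
proof -
  show le: "esum (\<lambda>s. y' s r) \<le> fnorm c" 
    using esum_mono[of "\<lambda>s. y' s r" "\<lambda>s. ennreal (cmod (c (s - r)))"] assms
      esum_shift[of "\<lambda>m. ennreal (cmod (c m))" r] by (simp add: fnorm_def)
  have "y' j r + y' (j - q) r = esum (\<lambda>s. if s \<in> J then y' s r else 0)"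
    by (simp add: esum_J)
  also have "\<dots> \<le> esum (\<lambda>s. y' s r)"
    by (intro esum_mono) auto
  finally show "y' j r + y' (j - q) r \<le> fnorm c" using le by (rule order_trans)
qed

lemma col_bound_kappa:
  assumes W: "fnorm (\<lambda>m. fourier W m - fourier V m) \<le> ennreal \<eta>" and \<eta>: "\<eta> \<ge> 0"
  shows "col_bound w (emult rho (y W)) (ennreal (kappa \<eta>))"
proof -
  let ?\<Delta> = "\<lambda>m. fourier W m - fourier V m"
  have "esum (\<lambda>s. y W s r) \<le> ennreal (\<eta> + star_norm V)" for r
  proof -
    have "esum (\<lambda>s. y W s r) \<le> esum (\<lambda>s. ennreal (cmod (?\<Delta> (s - r))) + ennreal (cmod (fourier V (s - r))))"
    proof (rule esum_mono)
      fix s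
      have "cmod (Y W s r) \<le> cmod (?\<Delta> (s - r)) + cmod (fourier V (s - r))"
        using norm_triangle_ineq[of "?\<Delta> (s - r)" "fourier V (s - r)"] by (auto simp: Y_eq)
      then show "y W s r \<le> ennreal (cmod (?\<Delta> (s - r))) + ennreal (cmod (fourier V (s - r)))"
        by (simp add: y_def ennreal_leI flip: ennreal_plus)
    qed
    also have "\<dots> = fnorm ?\<Delta> + fnorm (fourier V)"
      using esum_shift[of "\<lambda>m. ennreal (cmod (?\<Delta> m))" r] esum_shift[of "\<lambda>m. ennreal (cmod (fourier V m))" r]
      by (simp add: nn_integral_add fnorm_def)
    also have "\<dots> \<le> ennreal \<eta> + ennreal (star_norm V)"
      using W star_space_fnorm(1)[OF V(1)] by (intro add_mono) auto
    finally show ?thesis using \<eta> star_norm_nonneg by simp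
  qed
  moreover have "y W j r + y W (j - q) r \<le> ennreal \<eta>" if "r \<in> J" for r
  proof -
    \<comment> \<open>Restricted to the block, \<open>Y W\<close> has the coefficients of
      \<open>W - V\<close>, so the estimate for differences applies; outside the block it would
      not.\<close>
    define y' where "y' s r = (if s \<in> J \<and> r \<in> J then y W s r else 0)" for s r
    have "y' j r + y' (j - q) r \<le> fnorm ?\<Delta>"
      by (rule col_sum_le(2)) (auto simp: y'_def y_def Y_eq)
    then show ?thesis using that W J(2) by (auto simp: y'_def)
  qed
  ultimately have "col_bound w (emult rho (y W)) (ennreal (4 / d) *
      (ennreal \<eta> + ennreal (\<eta> + star_norm V) * ennreal (1 / sqrt g)) + ennreal (\<eta> + star_norm V) * ennreal (1 / sqrt g))"
    by (rule col_bound_rho_mult)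
  also have "ennreal (4 / d) *
      (ennreal \<eta> + ennreal (\<eta> + star_norm V) * ennreal (1 / sqrt g)) + ennreal (\<eta> + star_norm V) * ennreal (1 / sqrt g) = ennreal (kappa \<eta>)"
    using \<eta> star_norm_nonneg d_pos g1 by (simp add: kappa_def flip: ennreal_mult ennreal_plus)
  finally show ?thesis .
qed

lemma lam_W_bound:
  assumes K: "col_bound w (emult rho (y W)) (ennreal \<kappa>)" and \<kappa>: "0 \<le> \<kappa>" "\<kappa> \<le> 1 / 4"
  shows "cmod (lam_W l V q \<epsilon> j t W - of_real (lamhat l V q \<epsilon> j t)) \<le> 3 * d * \<kappa>"
proof -
  have gh: "cmod (ghat l V q \<epsilon> j t W (Suc i)) \<le> 2 * d * \<kappa> * (1 / 4) ^ i" for i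
  proof -
    let ?S = "\<Sum>\<^sub>\<infinity>s. contour_integral (circlepath (of_real (lamhat l V q \<epsilon> j t)) d)
       (\<lambda>z. zpow (zmult (R z) (Y W)) (Suc i) s s)"
    have "ennreal (cmod ?S) \<le> ennreal (2 * pi * d) * (of_nat (Suc i) * 2 * ennreal \<kappa> ^ Suc i)"
      by (rule trace_bound[OF majorized_Y K]) simp
    also have "\<dots> = ennreal (2 * pi * d * (real (Suc i) * 2 * \<kappa> ^ Suc i))"
      using \<kappa> d_pos by (simp add: ennreal_power ennreal_of_nat_eq_real_of_nat ennreal_numeral[symmetric]
          del: ennreal_numeral power_Suc of_nat_Suc flip: ennreal_mult)
    finally have "cmod ?S \<le> 2 * pi * d * (real (Suc i) * 2 * \<kappa> ^ Suc i)"
      using \<kappa> d_pos by (subst (asm) ennreal_le_iff) auto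
    \<comment> \<open>The number of terms \<open>Suc i\<close> in the trace bound cancels the factor
      \<open>1 / r\<close> of the eigenvalue series, so a geometric series remains, with sum
      \<open>8 / 3 * d * \<kappa>\<close>.\<close>
    then have "cmod (ghat l V q \<epsilon> j t W (Suc i)) \<le> 1 / (2 * pi * real (Suc i)) * (2 * pi * d * (real (Suc i) * 2 * \<kappa> ^ Suc i))"
      unfolding ghat_eq norm_mult
      by (intro mult_mono) (auto simp: norm_divide norm_mult norm_power simp del: of_nat_Suc)
    also have "\<dots> = 2 * d * \<kappa> * \<kappa> ^ i"
      by (simp del: of_nat_Suc)
    also have "\<dots> \<le> 2 * d * \<kappa> * (1 / 4) ^ i"
      using \<kappa> d_pos by (intro mult_left_mono power_mono) auto
    finally show ?thesis .
  qed
  have s: "summable (\<lambda>i. 2 * d * \<kappa> * (1 / 4) ^ i)"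
    by (intro summable_mult summable_geometric) simp
  have "cmod (\<Sum>i. ghat l V q \<epsilon> j t W (Suc i)) \<le> (\<Sum>i. 2 * d * \<kappa> * (1 / 4) ^ i)"
    by (rule norm_suminf_le[OF gh s])
  also have "\<dots> = 2 * d * \<kappa> * (4 / 3)"
    by (subst suminf_mult) (auto simp: suminf_geometric)
  also have "\<dots> \<le> 3 * d * \<kappa>"
    using \<kappa> d_pos by simp
  finally show ?thesis by (simp add: lam_W_def)
qed

lemma rho_const: "ennreal (4 / d) + 1 = ennreal (4 / d + 1)"
  using d_pos by (simp add: ennreal_1[symmetric] del: ennreal_1 flip: ennreal_plus)

text \<open>\<open>4 + d\<close> is \<open>d * (4 / d + 1)\<close>: the length of the circle over
  \<open>2 * pi\<close>, times the norm bound for the last resolvent factor.\<close>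

lemma Ghat_column:
  assumes K: "col_bound w (emult rho (y W)) (ennreal \<kappa>)" and \<kappa>: "0 \<le> \<kappa>" "\<kappa> \<le> 1 / 4"
  shows "esum (\<lambda>s. ennreal (cmod (Ghat l V q \<epsilon> j t W n s j))) \<le> ennreal ((4 + d) * (1 / 4) ^ n)"
proof -
  let ?I = "\<lambda>s. contour_integral (circlepath (of_real (lamhat l V q \<epsilon> j t)) d)
       (\<lambda>z. zmult (zpow (zmult (R z) (Y W)) n) (R z) s j)"
  have "esum (\<lambda>s. ennreal (cmod (Ghat l V q \<epsilon> j t W n s j))) = esum (\<lambda>s. ennreal (1 / (2 * pi)) * ennreal (cmod (?I s)))"
    by (simp add: Ghat_eq norm_mult norm_divide norm_power flip: ennreal_mult)
  also have "\<dots> = ennreal (1 / (2 * pi)) * esum (\<lambda>s. ennreal (cmod (?I s)))"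
    by (simp add: nn_integral_cmult)
  also have "\<dots> \<le> ennreal (1 / (2 * pi)) * (ennreal (2 * pi * d) * (ennreal \<kappa> ^ n * (ennreal (4 / d) + 1)))"
    by (intro mult_left_mono column_bound[OF majorized_Y K]) (auto simp: J)
  also have "\<dots> = ennreal (1 / (2 * pi) * (2 * pi * d * (\<kappa> ^ n * (4 / d + 1))))"
    using \<kappa> d_pos unfolding rho_const by (simp add: ennreal_power del: ennreal_plus flip: ennreal_mult)
  also have "1 / (2 * pi) * (2 * pi * d * (\<kappa> ^ n * (4 / d + 1))) = (4 + d) * \<kappa> ^ n"
    using d_pos by (simp add: field_simps)
  also have "ennreal \<dots> \<le> ennreal ((4 + d) * (1 / 4) ^ n)"
    using \<kappa> d_pos by (intro ennreal_leI mult_left_mono power_mono) auto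
  finally show ?thesis .
qed

lemma suminf_Ghat_finite:
  assumes "col_bound w (emult rho (y W)) (ennreal \<kappa>)" "0 \<le> \<kappa>" "\<kappa> \<le> 1 / 4"
  shows "(\<Sum>i. ennreal (cmod (Ghat l V q \<epsilon> j t W (Suc i) s j))) < \<infinity>"
    and "(\<Sum>i. esum (\<lambda>s. ennreal (cmod (Ghat l V q \<epsilon> j t W (Suc i) s j)))) \<le> ennreal (2 + d)"
proof -
  have "(\<Sum>i. esum (\<lambda>s. ennreal (cmod (Ghat l V q \<epsilon> j t W (Suc i) s j)))) \<le> (\<Sum>i. ennreal ((4 + d) * (1 / 4) ^ Suc i))"
    by (intro suminf_le Ghat_column[OF assms]) auto
  also have "\<dots> = ennreal (\<Sum>i. ((4 + d) / 4) * (1 / 4) ^ i)"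
    using d_pos by (subst suminf_ennreal2) (auto intro!: summable_mult summable_geometric)
  also have "(\<Sum>i. ((4 + d) / 4) * (1 / 4) ^ i) = ((4 + d) / 4) * (4 / 3)"
    by (subst suminf_mult) (auto simp: suminf_geometric)
  also have "ennreal (((4 + d) / 4) * (4 / 3)) \<le> ennreal (2 + d)"
    using d_pos by (intro ennreal_leI) auto
  finally show le: "(\<Sum>i. esum (\<lambda>s. ennreal (cmod (Ghat l V q \<epsilon> j t W (Suc i) s j)))) \<le> ennreal (2 + d)" .
  have "(\<Sum>i. ennreal (cmod (Ghat l V q \<epsilon> j t W (Suc i) s j))) \<le> (\<Sum>i. esum (\<lambda>s. ennreal (cmod (Ghat l V q \<epsilon> j t W (Suc i) s j))))"
    by (intro suminf_le esum_point_le[of "\<lambda>s. ennreal (cmod (Ghat l V q \<epsilon> j t W (Suc _) s j))"]) auto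
  also note le
  finally show "(\<Sum>i. ennreal (cmod (Ghat l V q \<epsilon> j t W (Suc i) s j))) < \<infinity>"
    by (rule order_le_less_trans) simp
qed

abbreviation "e W \<equiv> \<lambda>s. E_W l V q \<epsilon> j t W s j"

text \<open>The model projection contributes 2, for its two entries in the column, and the series
  contributes \<open>(4 + d) / 3\<close>, rounded up to \<open>2 + d\<close>.\<close>

lemma e_fnorm:
  assumes "col_bound w (emult rho (y W)) (ennreal \<kappa>)" "0 \<le> \<kappa>" "\<kappa> \<le> 1 / 4"
  shows "fnorm (e W) \<le> ennreal (4 + d)"
proof -
  have "fnorm (e W) \<le> fnorm (\<lambda>s. Ehat l V q \<epsilon> j t s j) + fnorm (\<lambda>s. \<Sum>i. Ghat l V q \<epsilon> j t W (Suc i) s j)"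
    unfolding E_W_def by (rule fnorm_triangle)
  also have "fnorm (\<lambda>s. Ehat l V q \<epsilon> j t s j) \<le> esum (\<lambda>s. if s \<in> J then 1 else 0)"
    unfolding fnorm_def Ehat_eq using E_le_1(1)[of _ j]
    by (intro esum_mono) (auto simp: E_out ennreal_1[symmetric] simp del: ennreal_1)
  also have "\<dots> = 2" by (simp add: esum_J)
  also have "fnorm (\<lambda>s. \<Sum>i. Ghat l V q \<epsilon> j t W (Suc i) s j) \<le>
      esum (\<lambda>s. \<Sum>i. ennreal (cmod (Ghat l V q \<epsilon> j t W (Suc i) s j)))"
    unfolding fnorm_def by (intro esum_mono suminf_le_esum(2) suminf_Ghat_finite(1)[OF assms])
  also have "\<dots> = (\<Sum>i. esum (\<lambda>s. ennreal (cmod (Ghat l V q \<epsilon> j t W (Suc i) s j))))"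
    by (rule nn_integral_suminf) simp
  also have "\<dots> \<le> ennreal (2 + d)"
    by (rule suminf_Ghat_finite(2)[OF assms])
  finally have "fnorm (e W) \<le> 2 + ennreal (2 + d)" by (simp add: add_mono)
  also have "\<dots> = ennreal (4 + d)"
    using d_pos by (simp add: ennreal_numeral[symmetric] del: ennreal_numeral flip: ennreal_plus)
  finally show ?thesis .
qed

text \<open>In \<open>Y W - Y W'\<close> the subtracted block cancels and \<open>W - W'\<close>
  remains, including its entries on \<open>J\<close>. Hence the bound is Lipschitz in
  \<open>\<zeta>\<close> without a small factor from \<open>g\<close>; smallness will come from the
  amplitude \<open>S\<close>.\<close>

lemma Ghat_column_diff:
  assumes K: "col_bound w (emult rho (y W)) (ennreal \<kappa>)" "col_bound w (emult rho (y W')) (ennreal \<kappa>)"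
    and \<kappa>: "0 \<le> \<kappa>" "\<kappa> \<le> 1 / 4"
    and \<zeta>: "fnorm (\<lambda>m. fourier W m - fourier W' m) \<le> ennreal \<zeta>" "\<zeta> \<ge> 0"
  shows "esum (\<lambda>s. ennreal (cmod (Ghat l V q \<epsilon> j t W (Suc i) s j - Ghat l V q \<epsilon> j t W' (Suc i) s j)))
    \<le> ennreal ((4 + d) * (8 / d + 1) * \<zeta> * (1 / 2) ^ i)"
proof -
  define L where "L = (8 / d + 1) * \<zeta>"
  have L: "L \<ge> 0" using d_pos \<zeta> by (simp add: L_def)
  define yd where "yd s r = ennreal (cmod (Y W s r - Y W' s r))" for s r
  let ?I = "\<lambda>W s. contour_integral (circlepath (of_real (lamhat l V q \<epsilon> j t)) d)
       (\<lambda>z. zmult (zpow (zmult (R z) (Y W)) (Suc i)) (R z) s j)"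
  have yd: "yd s r \<le> ennreal (cmod ((\<lambda>m. fourier W m - fourier W' m) (s - r)))" for s r
    by (simp add: yd_def Y_eq)
  have "col_bound w (emult rho yd) (ennreal (4 / d) *
      (ennreal \<zeta> + ennreal \<zeta> * ennreal (1 / sqrt g)) + ennreal \<zeta> * ennreal (1 / sqrt g))"
    by (rule col_bound_rho_mult)
      (rule order_trans[OF col_sum_le(1)[of yd "\<lambda>m. fourier W m - fourier W' m", OF yd] \<zeta>(1)],
        rule order_trans[OF col_sum_le(2)[of yd "\<lambda>m. fourier W m - fourier W' m", OF yd] \<zeta>(1)])
  moreover have "ennreal (4 / d) * (ennreal \<zeta> + ennreal \<zeta> * ennreal (1 / sqrt g)) + ennreal \<zeta> * ennreal (1 / sqrt g)
      \<le> ennreal L"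
  proof -
    have "\<zeta> * (1 / sqrt g) \<le> \<zeta> * 1" using g1 \<zeta> by (intro mult_left_mono) auto
    then have "4 / d * (\<zeta> + \<zeta> * (1 / sqrt g)) + \<zeta> * (1 / sqrt g) \<le> 4 / d * (\<zeta> + \<zeta>) + \<zeta>"
      using d_pos by (intro add_mono mult_left_mono) auto
    also have "\<dots> = L" by (simp add: L_def algebra_simps)
    finally show ?thesis
      using \<zeta> d_pos g1 by (simp add: ennreal_leI flip: ennreal_mult ennreal_plus)
  qed
  ultimately have cL: "col_bound w (emult rho yd) (ennreal L)"
    by (rule col_bound_mono[OF _ order_refl])
  have "esum (\<lambda>s. ennreal (cmod (Ghat l V q \<epsilon> j t W (Suc i) s j - Ghat l V q \<epsilon> j t W' (Suc i) s j))) =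
    esum (\<lambda>s. ennreal (1 / (2 * pi)) * ennreal (cmod (?I W s - ?I W' s)))"
  proof (rule nn_integral_cong)
    fix s
    let ?c = "(-1) ^ (Suc i + 1) / (2 * complex_of_real pi * \<i>)"
    have "Ghat l V q \<epsilon> j t W (Suc i) s j - Ghat l V q \<epsilon> j t W' (Suc i) s j = ?c * (?I W s - ?I W' s)"
      unfolding Ghat_eq by (rule right_diff_distrib[symmetric])
    moreover have "cmod ?c = 1 / (2 * pi)"
      by (simp add: norm_divide norm_mult norm_power)
    ultimately show "ennreal (cmod (Ghat l V q \<epsilon> j t W (Suc i) s j - Ghat l V q \<epsilon> j t W' (Suc i) s j)) =
        ennreal (1 / (2 * pi)) * ennreal (cmod (?I W s - ?I W' s))"
      by (simp only: norm_mult) (rule ennreal_mult, simp_all)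
  qed
  also have "\<dots> = ennreal (1 / (2 * pi)) * esum (\<lambda>s. ennreal (cmod (?I W s - ?I W' s)))"
    by (simp add: nn_integral_cmult)
  also have "\<dots> \<le> ennreal (1 / (2 * pi)) *
      (ennreal (2 * pi * d) * (of_nat (Suc i) * ennreal \<kappa> ^ (Suc i - 1) * ennreal L * (ennreal (4 / d) + 1)))"
    by (intro mult_left_mono column_diff_bound[OF majorized_Y majorized_Y _ K _ cL]) (auto simp: J majorized_def yd_def)
  also have "\<dots> = ennreal (1 / (2 * pi) * (2 * pi * d * (real (Suc i) * \<kappa> ^ i * L * (4 / d + 1))))"
    using \<kappa> d_pos L unfolding rho_const
    by (simp add: ennreal_power ennreal_of_nat_eq_real_of_nat del: of_nat_Suc ennreal_plus flip: ennreal_mult)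
  also have "1 / (2 * pi) * (2 * pi * d * (real (Suc i) * \<kappa> ^ i * L * (4 / d + 1))) = (4 + d) * L * (real (Suc i) * \<kappa> ^ i)"
    using d_pos by (simp add: field_simps)
  also have "ennreal \<dots> \<le> ennreal ((4 + d) * L * (1 / 2) ^ i)"
  proof (intro ennreal_leI mult_left_mono)
    \<comment> \<open>The factor \<open>Suc i\<close> from differentiating a power is absorbed by
      weakening the ratio from 1/4 to 1/2.\<close>
    have "Suc i \<le> 2 ^ i" by (induction i) auto
    then have "real (Suc i) \<le> 2 ^ i" by (metis of_nat_le_iff of_nat_numeral of_nat_power)
    moreover have "\<kappa> ^ i \<le> (1 / 4) ^ i" using \<kappa> by (intro power_mono) auto
    ultimately have "real (Suc i) * \<kappa> ^ i \<le> 2 ^ i * (1 / 4) ^ i" using \<kappa> by (intro mult_mono) auto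
    also have "2 ^ i * (1 / 4 :: real) ^ i = (1 / 2) ^ i" by (simp flip: power_mult_distrib)
    finally show "real (Suc i) * \<kappa> ^ i \<le> (1 / 2) ^ i" .
  qed (use d_pos L in auto)
  finally show ?thesis by (simp add: L_def mult.assoc)
qed

text \<open>The model projection does not depend on the potential and drops out; the factor 2 is the
  sum of the geometric series.\<close>

lemma e_lipschitz:
  assumes K: "col_bound w (emult rho (y W)) (ennreal \<kappa>)" "col_bound w (emult rho (y W')) (ennreal \<kappa>)"
    and \<kappa>: "0 \<le> \<kappa>" "\<kappa> \<le> 1 / 4"
    and \<zeta>: "fnorm (\<lambda>m. fourier W m - fourier W' m) \<le> ennreal \<zeta>" "\<zeta> \<ge> 0"
  shows "fnorm (\<lambda>s. e W s - e W' s) \<le> ennreal (2 * (4 + d) * (8 / d + 1) * \<zeta>)"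
proof -
  let ?D = "\<lambda>i s. Ghat l V q \<epsilon> j t W (Suc i) s j - Ghat l V q \<epsilon> j t W' (Suc i) s j"
  let ?b = "(4 + d) * (8 / d + 1) * \<zeta>"
  have b: "?b \<ge> 0" using d_pos \<zeta> by auto
  have eq: "e W s - e W' s = (\<Sum>i. ?D i s)" for s
    using suminf_diff[OF suminf_le_esum(1)[OF suminf_Ghat_finite(1)[OF K(1) \<kappa>], of s]
        suminf_le_esum(1)[OF suminf_Ghat_finite(1)[OF K(2) \<kappa>], of s]]
    by (simp add: E_W_def)
  have "(\<Sum>i. esum (\<lambda>s. ennreal (cmod (?D i s)))) \<le> (\<Sum>i. ennreal (?b * (1 / 2) ^ i))"
    by (intro suminf_le Ghat_column_diff[OF K \<kappa> \<zeta>]) auto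
  also have "\<dots> = ennreal (\<Sum>i. ?b * (1 / 2) ^ i)"
    using b by (intro suminf_ennreal2 summable_mult summable_geometric) auto
  also have "(\<Sum>i. ?b * (1 / 2) ^ i) = 2 * (4 + d) * (8 / d + 1) * \<zeta>"
    by (subst suminf_mult) (auto simp: suminf_geometric)
  finally have le: "(\<Sum>i. esum (\<lambda>s. ennreal (cmod (?D i s)))) \<le> ennreal (2 * (4 + d) * (8 / d + 1) * \<zeta>)" .
  have fin: "(\<Sum>i. ennreal (cmod (?D i s))) < \<infinity>" for s
  proof -
    have "(\<Sum>i. ennreal (cmod (?D i s))) \<le> (\<Sum>i. esum (\<lambda>s. ennreal (cmod (?D i s))))"
      by (intro suminf_le esum_point_le[of "\<lambda>s. ennreal (cmod (?D _ s))"]) auto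
    also note le
    finally show ?thesis by (rule order_le_less_trans) simp
  qed
  have "fnorm (\<lambda>s. e W s - e W' s) \<le> esum (\<lambda>s. \<Sum>i. ennreal (cmod (?D i s)))"
    unfolding fnorm_def eq by (intro esum_mono suminf_le_esum(2) fin)
  also have "\<dots> = (\<Sum>i. esum (\<lambda>s. ennreal (cmod (?D i s))))"
    by (rule nn_integral_suminf) simp
  finally show ?thesis using le by (rule order_trans)
qed

text \<open>The first smallness assumption keeps every iterate in the ball of radius
  \<open>S * (4 + d)\<^sup>2\<close> about \<open>V\<close>, on which \<open>kappa\<close> is at
  most 1/4. The left side of the second is the product of the Lipschitz constants of the quadratic
  map and of \<open>e\<close>, so successive differences at least halve.\<close>

lemma W_lim_fnorm:
  fixes \<sigma> :: real and A :: complex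
  defines "S \<equiv> \<bar>\<sigma>\<bar> * (cmod A)\<^sup>2"
  assumes \<kappa>: "kappa (S * (4 + d)\<^sup>2) \<le> 1 / 4"
    and contr: "S * (2 * (4 + d)) * (2 * (4 + d) * (8 / d + 1)) \<le> 1 / 2"
  shows "fnorm (\<lambda>m. fourier (W_lim l V q \<sigma> A \<epsilon> j t) m - fourier V m) \<le> ennreal (S * (4 + d)\<^sup>2)"
proof -
  let ?M = "Mhat l V q \<sigma> A \<epsilon> j t"
  define \<eta> where "\<eta> = S * (4 + d)\<^sup>2"
  have S: "S \<ge> 0" by (simp add: S_def)
  have \<eta>: "\<eta> \<ge> 0" using S by (simp add: \<eta>_def)
  have \<kappa>0: "0 \<le> kappa \<eta>"
    using \<eta> d_pos star_norm_nonneg g1 by (simp add: kappa_def)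
  define W where "W m = (?M ^^ m) V" for m
  \<comment> \<open>Starting with the zero column gives \<open>W 0 = V\<close> the same form as the
    later iterates, so a single difference formula covers the first step too.\<close>
  define es where "es m = (case m of 0 \<Rightarrow> \<lambda>_. 0 | Suc k \<Rightarrow> e (W k))" for m
  have W_eq: "W m x = V x + \<sigma> * (cmod (A * (\<Sum>\<^sub>\<infinity>s. es m s * cis (Pt s t \<bullet> x))))\<^sup>2" for m x
    by (cases m) (simp_all add: W_def es_def Mhat_def u_W_def)
  have zero: "fnorm (\<lambda>_. 0) = 0" by (simp add: fnorm_def)
  have inv: "W m \<in> star_space \<and> fnorm (\<lambda>i. fourier (W m) i - fourier V i) \<le> ennreal \<eta> \<and> fnorm (es m) \<le> ennreal (4 + d)" for m
  proof (induction m)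
    case 0
    show ?case using V by (simp add: W_def es_def zero)
  next
    case (Suc m)
    then have es: "fnorm (es (Suc m)) \<le> ennreal (4 + d)"
      using e_fnorm[OF col_bound_kappa[OF _ \<eta>] \<kappa>0 \<kappa>[folded \<eta>_def]] by (simp add: es_def)
    then have fin: "fnorm (es (Suc m)) \<noteq> top" by (auto simp: top_unique)
    \<comment> \<open>The sign is reversed so that the next iterate is a difference
      \<open>V - ?f\<close>, the form treated by \<open>star_space_diff\<close>.\<close>
    let ?f = "\<lambda>x. - \<sigma> * (cmod (A * (\<Sum>\<^sub>\<infinity>s. es (Suc m) s * cis (Pt s t \<bullet> x))))\<^sup>2"
    have zero_fin: "fnorm (\<lambda>_::int^'n. 0) \<noteq> top" by (simp add: zero)
    note D = norm_cis_series_squared_diff[OF fin zero_fin, where \<sigma> = "- \<sigma>" and A = A]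
    have "esum (\<lambda>p. ennreal (cmod ((\<lambda>(s, r). of_real (- \<sigma> * (cmod A)\<^sup>2) * (es (Suc m) s * cnj (es (Suc m) r) - 0 * cnj 0)) p)))
      \<le> ennreal S * (fnorm (es (Suc m)) * fnorm (es (Suc m)))"
      using D(2) by (simp add: S_def zero)
    also have "\<dots> \<le> ennreal S * (ennreal (4 + d) * ennreal (4 + d))"
      using es by (intro mult_left_mono mult_mono) auto
    also have "\<dots> = ennreal \<eta>"
      using S d_pos by (simp add: \<eta>_def power2_eq_square del: ennreal_plus flip: ennreal_mult)
    finally have le: "esum (\<lambda>p. ennreal (cmod ((\<lambda>(s, r). of_real (- \<sigma> * (cmod A)\<^sup>2) * (es (Suc m) s * cnj (es (Suc m) r) - 0 * cnj 0)) p)))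
      \<le> ennreal \<eta>" .
    then have fin': "esum (\<lambda>p. ennreal (cmod ((\<lambda>(s, r). of_real (- \<sigma> * (cmod A)\<^sup>2) * (es (Suc m) s * cnj (es (Suc m) r) - 0 * cnj 0)) p)))
      \<noteq> top" by (auto simp: top_unique)
    have ser: "complex_of_real (?f x) = (\<Sum>\<^sub>\<infinity>p. (\<lambda>(s, r). of_real (- \<sigma> * (cmod A)\<^sup>2) * (es (Suc m) s * cnj (es (Suc m) r) - 0 * cnj 0)) p *
        cis (rvec (fst p - snd p) \<bullet> x))" for x
      using D(1)[of t x] by simp
    note f = cis_series_star_space(1,3)[OF ser fin']
    have W': "W (Suc m) = (\<lambda>x. V x - ?f x)" by (simp add: W_eq fun_eq_iff)
    have "fnorm (\<lambda>i. fourier (W (Suc m)) i - fourier V i) = fnorm (fourier ?f)"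
      unfolding W' star_space_diff(2)[OF V(1) f(1)] by (simp add: fnorm_def)
    then show ?case
      using star_space_diff(1)[OF V(1) f(1)] f(2) le es by (auto simp: W')
  qed
  have fin: "fnorm (es m) \<noteq> top" for m using inv[of m] by (auto simp: top_unique)
  define c where "c i = (\<lambda>(s, r). complex_of_real (\<sigma> * (cmod A)\<^sup>2) *
      (es (Suc i) s * cnj (es (Suc i) r) - es i s * cnj (es i r)))" for i
  define B where "B i = S * (4 + d) * (2 * (4 + d)) * (1 / 2) ^ i" for i :: nat
  have B: "B i \<ge> 0" for i using S d_pos by (simp add: B_def)
  have step: "complex_of_real (W (Suc i) x - W i x) = (\<Sum>\<^sub>\<infinity>p. c i p * cis (rvec (fst p - snd p) \<bullet> x))" for i x
    using norm_cis_series_squared_diff(1)[OF fin[of "Suc i"] fin[of i], of \<sigma> A t x] unfolding W_eq c_def by simp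
  have c_le: "esum (\<lambda>p. ennreal (cmod (c i p))) \<le> ennreal (S * \<beta> * (2 * (4 + d)))"
    if "fnorm (\<lambda>s. es (Suc i) s - es i s) \<le> ennreal \<beta>" "\<beta> \<ge> 0" for i \<beta>
  proof -
    have "esum (\<lambda>p. ennreal (cmod (c i p))) \<le>
       ennreal S * (fnorm (\<lambda>m. es (Suc i) m - es i m) * (fnorm (es (Suc i)) + fnorm (es i)))"
      unfolding c_def S_def by (rule norm_cis_series_squared_diff(2)[OF fin fin])
    also have "\<dots> \<le> ennreal S * (ennreal \<beta> * (ennreal (4 + d) + ennreal (4 + d)))"
      using that inv[of i] inv[of "Suc i"] by (intro mult_left_mono mult_mono add_mono) auto
    also have "\<dots> = ennreal (S * \<beta> * (2 * (4 + d)))"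
      using S d_pos that by (simp add: mult.assoc algebra_simps flip: ennreal_mult ennreal_plus)
    finally show ?thesis .
  qed
  have cB: "esum (\<lambda>p. ennreal (cmod (c i p))) \<le> ennreal (B i)" for i
  proof (induction i)
    case 0
    have "fnorm (\<lambda>s. es (Suc 0) s - es 0 s) \<le> ennreal (4 + d)"
      using inv[of "Suc 0"] by (simp add: es_def)
    from c_le[OF this] show ?case using d_pos by (simp add: B_def)
  next
    case (Suc i)
    have "fnorm (\<lambda>m. fourier (W (Suc i)) m - fourier (W i) m) \<le> ennreal (B i)"
    proof -
      have "esum (\<lambda>p. ennreal (cmod (c i p))) \<noteq> top" using Suc by (auto simp: top_unique)
      from cis_series_star_space(3)[OF step this]
      show ?thesis using Suc inv[of i] inv[of "Suc i"] by (auto simp: star_space_diff(2) intro: order_trans)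
    qed
    from e_lipschitz[OF _ _ \<kappa>0 \<kappa>[folded \<eta>_def] this B]
    have "fnorm (\<lambda>s. es (Suc (Suc i)) s - es (Suc i) s) \<le> ennreal (2 * (4 + d) * (8 / d + 1) * B i)"
      using col_bound_kappa[OF _ \<eta>] inv by (simp add: es_def)
    then have "esum (\<lambda>p. ennreal (cmod (c (Suc i) p))) \<le> ennreal (S * (2 * (4 + d) * (8 / d + 1) * B i) * (2 * (4 + d)))"
      using d_pos B[of i] by (intro c_le) auto
    also have "S * (2 * (4 + d) * (8 / d + 1) * B i) * (2 * (4 + d)) = (S * (2 * (4 + d)) * (2 * (4 + d) * (8 / d + 1))) * B i"
      by simp
    also have "ennreal \<dots> \<le> ennreal (1 / 2 * B i)"
      using contr B[of i] by (intro ennreal_leI mult_right_mono)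
    finally show ?case by (simp add: B_def mult_ac)
  qed
  have "summable B"
    unfolding B_def by (intro summable_mult summable_geometric) simp
  moreover have "W 0 \<in> star_space" using V by (simp add: W_def)
  ultimately have "fnorm (\<lambda>i. fourier (star_limit W) i - fourier V i) \<le> ennreal \<eta>"
    using inv step cB B V(1)
    by (intro star_limit_correct(2)[where W = W and c = c and \<phi> = "\<lambda>p. fst p - snd p" and B = B and V = V]) auto
  moreover have "W_lim l V q \<sigma> A \<epsilon> j t = star_limit W"
    unfolding W_lim_def by (rule arg_cong[where f = star_limit]) (simp add: W_def fun_eq_iff)
  ultimately show ?thesis by (simp add: \<eta>_def)
qed

lemma lam_bound:
  fixes \<sigma> :: real and A :: complex
  defines "S \<equiv> \<bar>\<sigma>\<bar> * (cmod A)\<^sup>2"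
  assumes "kappa (S * (4 + d)\<^sup>2) \<le> 1 / 4" "S * (2 * (4 + d)) * (2 * (4 + d) * (8 / d + 1)) \<le> 1 / 2"
  shows "cmod (lam l V q \<sigma> A \<epsilon> j t - of_real (lamhat l V q \<epsilon> j t)) \<le> 3 * d * kappa (S * (4 + d)\<^sup>2)"
proof -
  have "S * (4 + d)\<^sup>2 \<ge> 0" by (simp add: S_def)
  moreover from this have "0 \<le> kappa (S * (4 + d)\<^sup>2)"
    using d_pos star_norm_nonneg g1 by (simp add: kappa_def)
  ultimately show ?thesis
    unfolding lam_def using assms(2,3) W_lim_fnorm[of \<sigma> A] unfolding S_def
    by (intro lam_W_bound col_bound_kappa) auto
qed

end

section \<open>Level sets of the model eigenvalue\<close>

lemma sqrt_add_square_lipschitz: "\<bar>sqrt (4 * c\<^sup>2 + x\<^sup>2) - sqrt (4 * c\<^sup>2 + y\<^sup>2)\<bar> \<le> \<bar>x - y\<bar>"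
  for c x y :: real
proof -
  have "sqrt (4 * c\<^sup>2 + x\<^sup>2) = norm (2 * c, x)" for x
    by (simp add: norm_Pair power_mult_distrib)
  then show ?thesis
    using norm_triangle_ineq3[of "(2 * c, x)" "(2 * c, y)"] by (simp add: norm_Pair)
qed

text \<open>The root is 1-Lipschitz in the difference of the two diagonal entries. With either sign
  the eigenvalue thus grows by at least half the sum of the two increments minus half their
  distance, which is the smaller increment.\<close>

lemma lamhat_mono:
  assumes "\<epsilon> \<in> {1, -1}" "pt j t' ^ (2 * l) \<ge> pt j t ^ (2 * l) + S"
    "pt (j - q) t' ^ (2 * l) \<ge> pt (j - q) t ^ (2 * l) + S"
  shows "lamhat l V q \<epsilon> j t' \<ge> lamhat l V q \<epsilon> j t + S"
proof -
  let ?r = "\<lambda>t. sqrt (4 * (cmod (fourier V q))\<^sup>2 + (pt j t ^ (2 * l) - pt (j - q) t ^ (2 * l))\<^sup>2)"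
  have "\<bar>?r t' - ?r t\<bar> \<le> \<bar>(pt j t' ^ (2 * l) - pt (j - q) t' ^ (2 * l)) - (pt j t ^ (2 * l) - pt (j - q) t ^ (2 * l))\<bar>"
    by (rule sqrt_add_square_lipschitz)
  moreover have "(u + v) / 2 + \<epsilon> * (r / 2) + S \<le> (u' + v') / 2 + \<epsilon> * (r' / 2)"
    if "\<bar>r' - r\<bar> \<le> \<bar>(u' - v') - (u - v)\<bar>" "u' \<ge> u + S" "v' \<ge> v + S" for u v u' v' r r' :: real
    using that assms(1) by (auto simp: abs_if field_simps split: if_splits)
  ultimately show ?thesis
    using assms(2,3) unfolding lamhat_def by blast
qed

text \<open>The squared norm grows by at least \<open>\<tau> * c\<close>, and the remaining
  \<open>l - 1\<close> squared factors are each at least \<open>c\<^sup>2\<close>.\<close>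

lemma norm_power_radial_increase:
  fixes x e :: "'a::real_inner"
  assumes e: "norm e = 1" and c: "c > 0" "c \<le> x \<bullet> e" and \<tau>: "\<tau> \<ge> 0" and l: "l > 0"
  shows "norm (x + \<tau> *\<^sub>R e) ^ (2 * l) \<ge> norm x ^ (2 * l) + \<tau> * c ^ (2 * l - 1)"
proof -
  obtain n where n: "l = Suc n" using l by (cases l) auto
  have pow: "a ^ (2 * l) = a\<^sup>2 * (a\<^sup>2) ^ n" for a :: real
    unfolding n power_mult by simp
  have "2 * l - 1 = Suc (2 * n)" using n by simp
  then have pow': "c ^ (2 * l - 1) = c * (c\<^sup>2) ^ n"
    by (simp only: power_Suc power_mult)
  have cx: "c \<le> norm x"
    using c(2) norm_cauchy_schwarz[of x e] e by simp
  have ee: "e \<bullet> e = 1" using e by (simp add: dot_square_norm)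
  have "(norm (x + \<tau> *\<^sub>R e))\<^sup>2 = (norm x)\<^sup>2 + 2 * (\<tau> * (x \<bullet> e)) + \<tau>\<^sup>2"
    by (simp add: power2_norm_eq_inner inner_add_left inner_add_right inner_commute ee)
      (simp add: power2_eq_square)
  moreover have "\<tau> * c \<le> \<tau> * (x \<bullet> e)" using c \<tau> by (intro mult_left_mono)
  moreover have "0 \<le> \<tau> * c" "0 \<le> \<tau>\<^sup>2" using c \<tau> by auto
  ultimately have sq: "(norm x)\<^sup>2 + \<tau> * c \<le> (norm (x + \<tau> *\<^sub>R e))\<^sup>2"
    by linarith
  have "norm x ^ (2 * l) + \<tau> * c ^ (2 * l - 1) = (norm x)\<^sup>2 * ((norm x)\<^sup>2) ^ n + \<tau> * c * (c\<^sup>2) ^ n"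
    unfolding pow pow' by simp
  also have "\<dots> \<le> (norm x)\<^sup>2 * ((norm x)\<^sup>2) ^ n + \<tau> * c * ((norm x)\<^sup>2) ^ n"
    using cx c \<tau> by (intro add_left_mono mult_left_mono power_mono) auto
  also have "\<dots> = ((norm x)\<^sup>2 + \<tau> * c) * ((norm x)\<^sup>2) ^ n"
    by (simp add: distrib_right)
  also have "\<dots> \<le> (norm (x + \<tau> *\<^sub>R e))\<^sup>2 * ((norm (x + \<tau> *\<^sub>R e))\<^sup>2) ^ n"
    using \<open>0 \<le> \<tau> * c\<close> order_trans[OF _ sq, of "(norm x)\<^sup>2"] by (intro mult_mono sq power_mono) auto
  also have "\<dots> = norm (x + \<tau> *\<^sub>R e) ^ (2 * l)"
    by (rule pow[symmetric])
  finally show ?thesis .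
qed

text \<open>Move along the ray through \<open>Pt j t\<close>: both unperturbed eigenvalues grow there at the rate
  \<open>c ^ (2 * l - 1)\<close>, hence so does \<open>lamhat\<close>, whichever the sign.\<close>

lemma lamhat_level_near:
  assumes l: "l > 0" and \<epsilon>: "\<epsilon> \<in> {1, -1}" and c: "c > 0" and h: "h \<ge> 0"
    and r: "norm (rvec q) + h + c \<le> pt j t"
    and \<Lambda>: "\<bar>lamhat l V q \<epsilon> j t - \<Lambda>\<bar> \<le> h * c ^ (2 * l - 1)"
  shows "\<exists>s. lamhat l V q \<epsilon> j s = \<Lambda> \<and> dist s t \<le> h"
proof -
  define e where "e = Pt j t /\<^sub>R pt j t"
  have pos: "pt j t > 0" using r c h norm_ge_zero[of "rvec q"] by linarith
  have e: "norm e = 1" using pos by (simp add: e_def pt_def)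
  have xe: "Pt j t \<bullet> e = pt j t"
    using pos by (simp add: e_def pt_def dot_square_norm power2_eq_square)
  have qe: "rvec q \<bullet> e \<le> norm (rvec q)"
    using norm_cauchy_schwarz[of "rvec q" e] e by simp
  define \<phi> where "\<phi> \<tau> = lamhat l V q \<epsilon> j (t + \<tau> *\<^sub>R e)" for \<tau>
  \<comment> \<open>Passing from \<open>j\<close> to \<open>j - q\<close> costs at most
    \<open>norm (rvec q)\<close> of the radial component and moving inwards costs at most
    \<open>h\<close>; by hypothesis \<open>c\<close> is still left. The cases
    \<open>\<tau> = - h\<close> and \<open>\<tau> = 0\<close> then enclose
    \<open>\<Lambda>\<close>.\<close>
  have inc: "\<phi> (\<tau> + h) \<ge> \<phi> \<tau> + h * c ^ (2 * l - 1)" if "\<tau> \<ge> - h" for \<tau>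
  proof -
    have ee: "e \<bullet> e = 1" using e by (simp add: dot_square_norm)
    have b: "c \<le> Pt i (t + \<tau> *\<^sub>R e) \<bullet> e" if "i = j \<or> i = j - q" for i
    proof -
      have "Pt i (t + \<tau> *\<^sub>R e) \<bullet> e = Pt i t \<bullet> e + \<tau>"
        by (simp add: Pt_def inner_add_left ee)
      moreover have "Pt (j - q) t \<bullet> e = Pt j t \<bullet> e - rvec q \<bullet> e"
        by (simp add: Pt_def inner_add_left inner_diff_left)
      moreover from this have "Pt i t \<bullet> e \<ge> pt j t - norm (rvec q)"
        using that xe qe by auto
      ultimately show ?thesis
        using r \<open>\<tau> \<ge> - h\<close> by linarith
    qed
    have "pt i (t + (\<tau> + h) *\<^sub>R e) ^ (2 * l) \<ge> pt i (t + \<tau> *\<^sub>R e) ^ (2 * l) + h * c ^ (2 * l - 1)"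
      if "i = j \<or> i = j - q" for i
    proof -
      have "Pt i (t + (\<tau> + h) *\<^sub>R e) = Pt i (t + \<tau> *\<^sub>R e) + h *\<^sub>R e"
        by (simp add: Pt_def scaleR_left.add add.assoc)
      then show ?thesis
        using norm_power_radial_increase[OF e c b[OF that] h l] by (simp add: pt_def)
    qed
    then show ?thesis unfolding \<phi>_def by (intro lamhat_mono \<epsilon>) auto
  qed
  have "continuous_on {- h..h} \<phi>"
    unfolding \<phi>_def lamhat_def pt_def Pt_def by (intro continuous_intros) auto
  moreover have "\<phi> (- h) \<le> \<Lambda>" "\<Lambda> \<le> \<phi> h"
    using inc[of "- h"] inc[of 0] h \<Lambda> by (auto simp: \<phi>_def abs_le_iff)
  ultimately obtain \<tau> where "- h \<le> \<tau>" "\<tau> \<le> h" "\<phi> \<tau> = \<Lambda>"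
    using IVT'[of \<phi> "- h" \<Lambda> h] h by auto
  then show ?thesis
    using e by (intro exI[of _ "t + \<tau> *\<^sub>R e"]) (auto simp: \<phi>_def dist_norm)
qed

section \<open>The isoenergetic surface\<close>

text \<open>The hypothesis speaks of the circle only. At its two real points it shows that
  \<open>p\<close> is not inside, since an inner point is within \<open>d < g\<close> of one of
  them; outside, the radius adds to the gap. This excludes further poles from the disc.\<close>

lemma gap_from_circle:
  fixes p \<mu> :: real
  assumes "\<And>z. cmod (z - of_real \<mu>) = d \<Longrightarrow> g \<le> cmod (of_real p - z)" "0 \<le> d" "d < g"
  shows "g + d \<le> \<bar>p - \<mu>\<bar>"
proof -
  have "g \<le> cmod (of_real p - of_real x)" if "\<bar>x - \<mu>\<bar> = d" for x :: real
    using that by (intro assms(1)) (simp flip: of_real_diff)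
  then have "g \<le> \<bar>p - x\<bar>" if "\<bar>x - \<mu>\<bar> = d" for x :: real
    using that by (simp flip: of_real_diff)
  from this[of "\<mu> + d"] this[of "\<mu> - d"] show ?thesis
    using assms(2,3) by auto
qed

lemma cmod_fourier_le: "W \<in> star_space \<Longrightarrow> cmod (fourier W m) \<le> star_norm W"
  using esum_point_le[of "\<lambda>m. ennreal (cmod (fourier W m))" m] star_space_fnorm(1)[of W]
  by (simp add: fnorm_def star_norm_def infsum_nonneg)

lemma resonant_nbhd_norm:
  assumes "t \<in> resonant_nbhd q k \<delta> X j \<rho>"
  shows "pt j t \<ge> k - \<rho>"
proof -
  obtain t\<^sub>0 where t0: "pt j t\<^sub>0 = k" "dist t t\<^sub>0 < \<rho>"
    using assms by (auto simp: resonant_nbhd_def resonant_index_def Sq_def pt_def)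
  have "pt j t\<^sub>0 \<le> pt j t + dist t t\<^sub>0"
    using norm_triangle_ineq[of "Pt j t" "t\<^sub>0 - t"] by (simp add: pt_def Pt_def dist_norm norm_minus_commute)
  with t0 show ?thesis by simp
qed

lemma kappa_le:
  fixes d m Nv \<eta> \<theta> :: real
  assumes "0 < m" "m \<le> d" "0 \<le> Nv" "0 \<le> \<eta>" "\<eta> \<le> 1" "0 \<le> \<theta>"
  shows "4 / d * (\<eta> + (\<eta> + Nv) * \<theta>) + (\<eta> + Nv) * \<theta> \<le> (4 / m + 1) * (Nv + 1) * (\<eta> + \<theta>)"
proof -
  have 1: "(\<eta> + Nv) * \<theta> \<le> (Nv + 1) * \<theta>" using assms by (intro mult_right_mono) auto
  have 2: "\<eta> \<le> (Nv + 1) * \<eta>" using assms by (simp add: distrib_right)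
  have "4 / d * (\<eta> + (\<eta> + Nv) * \<theta>) + (\<eta> + Nv) * \<theta> \<le> 4 / m * ((Nv + 1) * (\<eta> + \<theta>)) + (Nv + 1) * (\<eta> + \<theta>)"
  proof (rule add_mono[OF mult_mono])
    show "\<eta> + (\<eta> + Nv) * \<theta> \<le> (Nv + 1) * (\<eta> + \<theta>)" using 1 2 by (simp add: distrib_left)
    show "(\<eta> + Nv) * \<theta> \<le> (Nv + 1) * (\<eta> + \<theta>)" using 1 2 assms(4) by (simp add: distrib_left)
  qed (use assms in \<open>auto simp: frac_le\<close>)
  moreover have "(x + 1) * y * z = x * (y * z) + y * z" for x y z :: real
    by (simp add: algebra_simps)
  ultimately show ?thesis by (simp only:)
qed

text \<open>Every occurrence of \<open>d\<close> in the bound and in the smallness conditions is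
  replaced through \<open>m \<le> d\<close> and \<open>d \<le> star_norm V\<close>, which makes them
  uniform in \<open>q\<close>.\<close>

lemma lam_near_lamhat:
  fixes V :: "real ^ 'n \<Rightarrow> real" and \<sigma> :: real and A :: complex
  assumes V: "V \<in> star_space" "fourier V 0 = 0" and q: "q \<noteq> 0" "fourier V q \<noteq> 0"
    and \<epsilon>: "\<epsilon> \<in> {1, -1}" and g: "g \<ge> 1" "radius_d V q < g"
    and gap: "\<And>z s. cmod (z - of_real (lamhat l V q \<epsilon> j t)) = radius_d V q \<Longrightarrow> s \<noteq> j \<Longrightarrow> s \<noteq> j - q \<Longrightarrow>
      g \<le> cmod (of_real (pt s t ^ (2 * l)) - z)"
    and m: "0 < m" "m \<le> radius_d V q"
  defines "U \<equiv> 4 + star_norm V" and "K \<equiv> (4 / m + 1) * (star_norm V + 1)" and "S \<equiv> \<bar>\<sigma>\<bar> * (cmod A)\<^sup>2"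
  assumes S: "S * U\<^sup>2 \<le> 1" "K * (S * U\<^sup>2 + 1 / sqrt g) \<le> 1 / 4" "S * (4 * U\<^sup>2 * (8 / m + 1)) \<le> 1 / 2"
  shows "cmod (lam l V q \<sigma> A \<epsilon> j t - of_real (lamhat l V q \<epsilon> j t)) \<le> 3 * star_norm V * K * (S * U\<^sup>2 + 1 / sqrt g)"
proof -
  interpret model l V q j \<epsilon> t g
  proof
    show "g + cmod (fourier V q) / 10 \<le> \<bar>pt s t ^ (2 * l) - lamhat l V q \<epsilon> j t\<bar>"
      if "s \<noteq> j" "s \<noteq> j - q" for s
      using gap_from_circle[of "lamhat l V q \<epsilon> j t" "radius_d V q" g "pt s t ^ (2 * l)"] gap[OF _ that] g
      by (auto simp: radius_d_def)
  qed (use V q \<epsilon> g in auto)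
  have N: "star_norm V \<ge> 0" by (rule star_norm_nonneg)
  have d: "m \<le> d" "d \<le> star_norm V"
    using m(2) cmod_fourier_le[OF V(1), of q] N by (auto simp: d_eq d_def)
  have S0: "S \<ge> 0" by (simp add: S_def)
  define \<eta> where "\<eta> = S * (4 + d)\<^sup>2"
  have \<eta>: "0 \<le> \<eta>" "\<eta> \<le> S * U\<^sup>2"
    using S0 d d_pos by (auto simp: \<eta>_def U_def intro!: mult_left_mono power_mono)
  have K: "K \<ge> 0" using m N by (simp add: K_def)
  have "kappa \<eta> \<le> K * (\<eta> + 1 / sqrt g)"
    using kappa_le[OF m(1) d(1) N \<eta>(1), of "1 / sqrt g"] \<eta>(2) S(1) g by (simp add: kappa_def K_def)
  also have "\<dots> \<le> K * (S * U\<^sup>2 + 1 / sqrt g)"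
    using \<eta>(2) K by (intro mult_left_mono) auto
  finally have \<kappa>: "kappa \<eta> \<le> K * (S * U\<^sup>2 + 1 / sqrt g)" .
  have "S * (2 * (4 + d)) * (2 * (4 + d) * (8 / d + 1)) = S * (4 * (4 + d)\<^sup>2 * (8 / d + 1))"
    by (simp add: power2_eq_square) (simp add: algebra_simps)
  also have "\<dots> \<le> S * (4 * U\<^sup>2 * (8 / m + 1))"
    using S0 d d_pos m by (intro mult_left_mono mult_mono power_mono add_mono divide_left_mono mult_pos_pos) (auto simp: U_def)
  also note S(3)
  finally have contr: "S * (2 * (4 + d)) * (2 * (4 + d) * (8 / d + 1)) \<le> 1 / 2" .
  have "kappa \<eta> \<le> 1 / 4" using \<kappa> S(2) by linarith
  with contr have "cmod (lam l V q \<sigma> A \<epsilon> j t - of_real (lamhat l V q \<epsilon> j t)) \<le> 3 * d * kappa \<eta>"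
    using lam_bound[of \<sigma> A] unfolding \<eta>_def S_def by blast
  also have "\<dots> \<le> 3 * star_norm V * (K * (S * U\<^sup>2 + 1 / sqrt g))"
    using \<kappa> d d_pos N \<eta>(1) g by (intro mult_mono) (auto simp: kappa_def)
  finally show ?thesis by (simp add: mult.assoc)
qed

lemma trig_polynomial_fourier:
  fixes V :: "real ^ 'n \<Rightarrow> real" and v :: "int ^ 'n \<Rightarrow> complex"
  assumes V: "\<And>x. complex_of_real (V x) =
           (\<Sum>m | 0 < norm (rvec m) \<and> norm (rvec m) \<le> R\<^sub>0. v m * cis (rvec m \<bullet> x))"
    and nz: "\<exists>x. V x \<noteq> 0"
  shows "V \<in> star_space" "fourier V 0 = 0" "finite {m. fourier V m \<noteq> 0}"
    and "\<And>m. fourier V m \<noteq> 0 \<Longrightarrow> norm (rvec m) \<le> R\<^sub>0"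
proof -
  let ?F = "{m::int ^ 'n. 0 < norm (rvec m) \<and> norm (rvec m) \<le> R\<^sub>0}"
  \<comment> \<open>A sum over an infinite set is 0 by convention, which would make \<open>V\<close>
    vanish identically; no lattice points have to be counted.\<close>
  have fin: "finite ?F"
  proof (rule ccontr)
    assume "infinite ?F"
    then have "complex_of_real (V x) = 0" for x by (subst V) (rule sum.infinite)
    with nz show False by simp
  qed
  note f = trig_polynomial_star_space[OF fin V]
  show "V \<in> star_space" by (rule f(1))
  show "fourier V 0 = 0" by (simp add: f(2))
  show "finite {m. fourier V m \<noteq> 0}"
    by (rule finite_subset[OF _ fin]) (auto simp: f(2) split: if_splits)
  show "norm (rvec m) \<le> R\<^sub>0" if "fourier V m \<noteq> 0" for m
    using that by (simp add: f(2) split: if_splits)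
qed

theorem theorem29:
  fixes l :: nat
    and V :: "real ^ 'n \<Rightarrow> real"
    and v :: "int ^ 'n \<Rightarrow> complex"
    and R\<^sub>0 :: real
  assumes "l > 0"
    and "2 * l > CARD('n)"
    and "\<And>x. complex_of_real (V x) =
           (\<Sum>m | 0 < norm (rvec m) \<and> norm (rvec m) \<le> R\<^sub>0. v m * cis (rvec m \<bullet> x))"
    and "\<exists>x. V x \<noteq> 0"
  shows "\<exists>C>0. \<forall>\<gamma>\<^sub>2>0. \<forall>\<delta>. 0 < 9 * \<delta> \<and> 9 * \<delta> < 2 * real l - real CARD('n) \<longrightarrow>
    (\<exists>k\<^sub>0>0. \<forall>q \<sigma> A \<Lambda> X \<epsilon> j.
       let \<gamma>\<^sub>1 = (2 * real l - real CARD('n) - 8 * \<delta>) / 2;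
           \<gamma> = min \<gamma>\<^sub>1 \<gamma>\<^sub>2;
           \<gamma>h = (2 * real l - 1 + \<gamma>) / (2 * real l);
           k = \<Lambda> powr (1 / (2 * real l))
       in q \<noteq> 0 \<longrightarrow> fourier V q \<noteq> 0 \<longrightarrow>
          \<Lambda> > k\<^sub>0 ^ (2 * l) \<longrightarrow>
          \<bar>\<sigma>\<bar> * (cmod A)\<^sup>2 < k powr (- \<gamma>\<^sub>2) \<longrightarrow>
          resonant_set l V q k \<delta> X \<longrightarrow>
          \<epsilon> \<in> {1, -1} \<longrightarrow>
          {t \<in> resonant_nbhd q k \<delta> X j (k powr (- real CARD('n) + 1 - 7 * \<delta>)).
             lam l V q \<sigma> A \<epsilon> j t = complex_of_real \<Lambda>}
          \<subseteq> (\<Union>s\<in>{s. lamhat l V q \<epsilon> j s = \<Lambda>}. ball s (C * \<Lambda> powr (- \<gamma>h))))"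
proof -
  note V = trig_polynomial_fourier[OF assms(3,4)]
  define N where "N = star_norm V"
  have N: "N \<ge> 0" by (simp add: N_def star_norm_def infsum_nonneg)
  \<comment> \<open>Inserting 1 keeps the minimum well defined without first exhibiting a nonzero
    coefficient.\<close>
  define m where "m = Min (insert 1 ((\<lambda>q. radius_d V q) ` {q. fourier V q \<noteq> 0}))"
  have m: "m > 0"
    unfolding m_def using V(3) by (subst Min_gr_iff) (auto simp: radius_d_def)
  have mq: "m \<le> radius_d V q" if "fourier V q \<noteq> 0" for q
    unfolding m_def using V(3) that by (intro Min_le) auto
  define U where "U = 4 + N"
  define K where "K = (4 / m + 1) * (N + 1)"
  define P where "P = 8 / m + 1"
  have U: "U\<^sup>2 \<ge> 1" using N by (simp add: U_def)
  have P: "P \<ge> 1" using m by (simp add: P_def)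
  have K: "K \<ge> 1" using mult_mono[of 1 "4 / m + 1" 1 "N + 1"] m N by (simp add: K_def)
  define C1 where "C1 = 3 * N * K * (U\<^sup>2 + 2)"
  \<comment> \<open>The factor \<open>4 ^ (2 * l - 1)\<close> pays for the growth rate being taken
    at \<open>k / 4\<close>; the extra 1 makes the final inequality strict, as the open ball
    requires.\<close>
  define C where "C = C1 * 4 ^ (2 * l - 1) + 1"
  have C1: "C1 \<ge> 0" using N K by (simp add: C1_def)
  have C: "C > C1 * 4 ^ (2 * l - 1)" "C \<ge> 1" using C1 by (simp_all add: C_def)
  show ?thesis
  proof (rule exI[of _ C], intro conjI allI impI)
    show "C > 0" using C by simp
    fix \<gamma>\<^sub>2 \<delta> :: real
    assume \<gamma>\<^sub>2: "\<gamma>\<^sub>2 > 0" and \<delta>: "0 < 9 * \<delta> \<and> 9 * \<delta> < 2 * real l - real CARD('n)"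
    define \<beta> where "\<beta> = 2 * real l - real CARD('n) - 6 * \<delta>"
    define \<gamma>\<^sub>1 where "\<gamma>\<^sub>1 = (2 * real l - real CARD('n) - 8 * \<delta>) / 2"
    define \<gamma> where "\<gamma> = min \<gamma>\<^sub>1 \<gamma>\<^sub>2"
    have \<beta>: "\<beta> > 0" "\<gamma> \<le> \<beta> / 2" "\<gamma> > 0" "\<gamma> \<le> \<gamma>\<^sub>2"
      using \<delta> \<gamma>\<^sub>2 by (auto simp: \<beta>_def \<gamma>_def \<gamma>\<^sub>1_def min_def)
    \<comment> \<open>Since \<open>U\<^sup>2\<close>, \<open>K\<close> and \<open>P\<close> are at
      least 1, this one threshold yields all three smallness conditions on the amplitude, by
      dropping factors.\<close>
    define a where "a = 1 / (8 * U\<^sup>2 * K * P)"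
    \<comment> \<open>The bound on \<open>k powr \<beta>\<close> gives \<open>g \<ge> 1\<close>, a
      radius below \<open>g\<close>, and \<open>8 * K \<le> sqrt g\<close>. From
      \<open>k > C\<close> follows \<open>h \<le> 1\<close>, and the remaining terms leave a radial
      component of \<open>k / 4\<close> on the ray.\<close>
    define good where "good k \<longleftrightarrow> k powr (- \<gamma>\<^sub>2) < a \<and> k powr \<beta> > 2 * (1 + N + (8 * K)\<^sup>2) \<and> k > C + 2 * \<bar>R\<^sub>0\<bar> + 4" for k
    have "8 * U\<^sup>2 * K * P > 0" using U K P by (intro mult_pos_pos) linarith+
    note UKP = this
    have a: "a > 0" using UKP by (simp add: a_def)
    have "eventually good at_top"
      unfolding good_def
    proof (intro eventually_conj)
      show "\<forall>\<^sub>F k in at_top. k powr (- \<gamma>\<^sub>2) < a"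
        using tendsto_neg_powr[OF _ filterlim_ident, of "- \<gamma>\<^sub>2"] \<gamma>\<^sub>2 a by (auto simp: order_tendsto_iff)
      show "\<forall>\<^sub>F k in at_top. k powr \<beta> > 2 * (1 + N + (8 * K)\<^sup>2)"
      proof (rule eventually_mono[OF eventually_gt_at_top])
        fix k assume k: "k > (2 * (1 + N + (8 * K)\<^sup>2)) powr (1 / \<beta>)"
        have "2 * (1 + N + (8 * K)\<^sup>2) > 0" using N by (intro mult_pos_pos add_pos_nonneg) auto
        then have "2 * (1 + N + (8 * K)\<^sup>2) = ((2 * (1 + N + (8 * K)\<^sup>2)) powr (1 / \<beta>)) powr \<beta>"
          using \<beta>(1) by (simp add: powr_powr)
        also have "\<dots> < k powr \<beta>"
          using k \<beta>(1) by (intro powr_less_mono2) auto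
        finally show "k powr \<beta> > 2 * (1 + N + (8 * K)\<^sup>2)" .
      qed
    qed (rule eventually_gt_at_top)
    then obtain k\<^sub>1 where k\<^sub>1: "\<And>k. k \<ge> k\<^sub>1 \<Longrightarrow> good k" by (auto simp: eventually_at_top_linorder)
    define k\<^sub>0 where "k\<^sub>0 = max k\<^sub>1 1"
    have k\<^sub>0: "k\<^sub>0 > 0" "\<And>k. k > k\<^sub>0 \<Longrightarrow> good k" using k\<^sub>1 by (auto simp: k\<^sub>0_def)
    have main: "t \<in> (\<Union>s\<in>{s. lamhat l V q \<epsilon> j s = \<Lambda>}. ball s (C * \<Lambda> powr (- ((2 * real l - 1 + \<gamma>) / (2 * real l)))))"
      if q: "q \<noteq> 0" "fourier V q \<noteq> 0" and \<Lambda>: "\<Lambda> > k\<^sub>0 ^ (2 * l)" and k: "k = \<Lambda> powr (1 / (2 * real l))"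
        and S: "\<bar>\<sigma>\<bar> * (cmod A)\<^sup>2 < k powr (- \<gamma>\<^sub>2)" and X: "resonant_set l V q k \<delta> X" and \<epsilon>: "\<epsilon> \<in> {1, -1}"
        and t: "t \<in> resonant_nbhd q k \<delta> X j (k powr (- real CARD('n) + 1 - 7 * \<delta>))"
        and lam: "lam l V q \<sigma> A \<epsilon> j t = complex_of_real \<Lambda>" for q j \<sigma> A \<Lambda> X \<epsilon> t k
    proof -
      have \<Lambda>0: "\<Lambda> > 0" using \<Lambda> k\<^sub>0(1) by (smt (verit) zero_less_power)
      have "k\<^sub>0 = (k\<^sub>0 ^ (2 * l)) powr (1 / (2 * real l))"
        using k\<^sub>0(1) assms(1) by (simp add: powr_realpow[symmetric] powr_powr)
      also have "\<dots> < k"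
        unfolding k using \<Lambda> k\<^sub>0(1) assms(1) by (intro powr_less_mono2) auto
      finally have "good k" by (rule k\<^sub>0(2))
      then have good: "k powr (- \<gamma>\<^sub>2) < a" "k powr \<beta> > 2 * (1 + N + (8 * K)\<^sup>2)" "k > C + 2 * \<bar>R\<^sub>0\<bar> + 4"
        by (auto simp: good_def)
      have k1: "k \<ge> 1" using good(3) C by linarith
      have k\<Lambda>: "\<Lambda> powr x = k powr (2 * real l * x)" for x
        unfolding k using assms(1) by (simp add: powr_powr)
      let ?S = "\<bar>\<sigma>\<bar> * (cmod A)\<^sup>2"
      define g where "g = k powr \<beta> / 2"
      have K2: "(8 * K)\<^sup>2 \<ge> 1" using K by (intro one_le_power) auto
      have g: "g > 1 + N + (8 * K)\<^sup>2" using good(2) by (simp add: g_def)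
      then have g1: "g \<ge> 1" "g > N" using N K2 by auto
      have rN: "radius_d V q \<le> N"
        using cmod_fourier_le[OF V(1), of q] N by (simp add: radius_d_def N_def)
      have nbhd: "t \<in> resonant_nbhd q k \<delta> X j (2 * k powr (- real CARD('n) + 1 - 7 * \<delta>))"
      proof -
        obtain t\<^sub>0 where "t \<in> Kcell" "t\<^sub>0 \<in> X" "resonant_index q k \<delta> t\<^sub>0 j"
          "dist t t\<^sub>0 < k powr (- real CARD('n) + 1 - 7 * \<delta>)"
          using t by (auto simp: resonant_nbhd_def)
        moreover have "k powr (- real CARD('n) + 1 - 7 * \<delta>) \<le> 2 * k powr (- real CARD('n) + 1 - 7 * \<delta>)"
          by simp
        ultimately show ?thesis unfolding resonant_nbhd_def by (blast intro: less_le_trans)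
      qed
      have gap: "g \<le> cmod (of_real (pt s t ^ (2 * l)) - z)"
        if "cmod (z - of_real (lamhat l V q \<epsilon> j t)) = radius_d V q" "s \<noteq> j" "s \<noteq> j - q" for z s
      proof -
        have "2 * cmod (of_real (pt s t ^ (2 * l)) - z) \<ge> k powr (2 * real l - real CARD('n) - 6 * \<delta>)"
          using X nbhd \<epsilon> that unfolding resonant_set_def by blast
        then show ?thesis by (simp add: g_def \<beta>_def)
      qed
      have Sa: "?S * (8 * U\<^sup>2 * K * P) \<le> 1"
      proof -
        have "?S \<le> 1 / (8 * U\<^sup>2 * K * P)" using S good(1) unfolding a_def by linarith
        then show ?thesis using UKP by (simp only: pos_le_divide_eq)
      qed
      have S0: "?S \<ge> 0" by simp
      have SUK: "?S * U\<^sup>2 * K \<le> 1 / 8"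
      proof -
        have "?S * U\<^sup>2 * K * 1 \<le> ?S * U\<^sup>2 * K * P"
          using P S0 K by (intro mult_left_mono) auto
        moreover have "?S * (8 * U\<^sup>2 * K * P) = 8 * (?S * U\<^sup>2 * K * P)" by simp
        ultimately show ?thesis using Sa by linarith
      qed
      have SU: "?S * U\<^sup>2 \<le> 1"
        using mult_left_mono[OF K, of "?S * U\<^sup>2"] SUK S0 by simp
      have SUP: "?S * (4 * U\<^sup>2 * P) \<le> 1 / 2"
      proof -
        have "?S * U\<^sup>2 * P * 1 \<le> ?S * U\<^sup>2 * P * K"
          using P S0 K by (intro mult_left_mono) auto
        moreover have "?S * (8 * U\<^sup>2 * K * P) = 8 * (?S * U\<^sup>2 * P * K)" by simp
        moreover have "?S * (4 * U\<^sup>2 * P) = 4 * (?S * U\<^sup>2 * P)" by simp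
        ultimately show ?thesis using Sa by linarith
      qed
      have \<theta>K: "K * (1 / sqrt g) \<le> 1 / 8"
      proof -
        have "8 * K \<le> sqrt g" using g N K by (intro real_le_rsqrt) auto
        moreover have "sqrt g > 0" using g1 by simp
        ultimately show ?thesis by (simp add: field_simps)
      qed
      have "cmod (lam l V q \<sigma> A \<epsilon> j t - of_real (lamhat l V q \<epsilon> j t)) \<le> 3 * N * K * (?S * U\<^sup>2 + 1 / sqrt g)"
      proof (rule lam_near_lamhat[OF V(1,2) q \<epsilon> g1(1) _ gap m mq[OF q(2)], folded N_def, folded K_def U_def P_def])
        show "radius_d V q < g" using rN g1(2) by linarith
        have "K * (?S * U\<^sup>2 + 1 / sqrt g) = ?S * U\<^sup>2 * K + K * (1 / sqrt g)"
          by (simp only: distrib_left mult.commute)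
        then show "K * (?S * U\<^sup>2 + 1 / sqrt g) \<le> 1 / 4" using SUK \<theta>K by linarith
      qed (rule SU SUP | assumption)+
      also have "\<dots> \<le> 3 * N * K * ((U\<^sup>2 + 2) * k powr (- \<gamma>))"
      proof (rule mult_left_mono)
        have "?S \<le> k powr (- \<gamma>)"
          using S \<beta>(4) k1 powr_mono[of "- \<gamma>\<^sub>2" "- \<gamma>" k] by linarith
        then have "?S * U\<^sup>2 \<le> U\<^sup>2 * k powr (- \<gamma>)"
          using mult_left_mono[of ?S "k powr (- \<gamma>)" "U\<^sup>2"] by (simp add: mult.commute)
        moreover have "1 / sqrt g \<le> 2 * k powr (- \<gamma>)"
        proof -
          have "k powr (\<beta> / 2) = sqrt (k powr \<beta>)"
            using k1 by (simp add: powr_half_sqrt[symmetric] powr_powr)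
          then have "1 / sqrt g = sqrt 2 * k powr (- (\<beta> / 2))"
            using k1 by (simp add: g_def real_sqrt_divide powr_minus_divide)
          also have "\<dots> \<le> 2 * k powr (- \<gamma>)"
            using \<beta>(2) k1 by (intro mult_mono powr_mono) (auto intro: real_le_lsqrt)
          finally show ?thesis .
        qed
        ultimately show "?S * U\<^sup>2 + 1 / sqrt g \<le> (U\<^sup>2 + 2) * k powr (- \<gamma>)"
          by (simp add: distrib_right)
      qed (use N K in auto)
      also have "\<dots> = C1 * k powr (- \<gamma>)" by (simp add: C1_def mult.assoc)
      finally have near: "\<bar>lamhat l V q \<epsilon> j t - \<Lambda>\<bar> \<le> C1 * k powr (- \<gamma>)"
        unfolding lam by (simp add: abs_minus_commute flip: of_real_diff)
      \<comment> \<open>The eigenvalue error \<open>C1 * k powr (- \<gamma>)\<close> divided by the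
        growth rate \<open>(k / 4) ^ (2 * l - 1)\<close>.\<close>
      define h where "h = C1 * 4 ^ (2 * l - 1) * k powr (- (2 * real l - 1 + \<gamma>))"
      have h0: "h \<ge> 0" using C1 by (simp add: h_def)
      have h: "h < C * k powr (- (2 * real l - 1 + \<gamma>))"
        unfolding h_def using C(1) k1 by (intro mult_strict_right_mono) auto
      have "k powr (- (2 * real l - 1 + \<gamma>)) \<le> k powr (- 1)"
        using assms(1) \<beta>(3) k1 by (intro powr_mono) auto
      then have "C * k powr (- (2 * real l - 1 + \<gamma>)) \<le> C * (1 / k)"
        using C(2) k1 by (intro mult_left_mono) (auto simp: powr_minus_divide)
      also have "\<dots> \<le> 1" using good(3) k1 C by simp
      finally have h1: "h \<le> 1" using h by linarith
      have hc: "h * (k / 4) ^ (2 * l - 1) = C1 * k powr (- \<gamma>)"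
      proof -
        have "k ^ (2 * l - 1) = k powr (2 * real l - 1)"
          using k1 assms(1) by (simp add: powr_realpow[symmetric] of_nat_diff)
        then have "h * (k / 4) ^ (2 * l - 1) = C1 * (k powr (- (2 * real l - 1 + \<gamma>)) * k powr (2 * real l - 1))"
          by (simp add: h_def power_divide)
        then show ?thesis by (simp add: powr_add[symmetric])
      qed
      have "real CARD('n) \<ge> 1" by (simp add: Suc_le_eq)
      then have "k powr (- real CARD('n) + 1 - 7 * \<delta>) \<le> k powr 0"
        using \<delta> k1 by (intro powr_mono) linarith+
      then have "pt j t \<ge> k - 1" using resonant_nbhd_norm[OF t] k1 by simp
      then have "norm (rvec q) + h + k / 4 \<le> pt j t"
        using V(4)[OF q(2)] h1 good(3) C by linarith
      from lamhat_level_near[OF assms(1) \<epsilon> _ h0 this, of V \<Lambda>, unfolded hc] near k1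
      obtain s where s: "lamhat l V q \<epsilon> j s = \<Lambda>" "dist s t \<le> h" by auto
      moreover have "\<Lambda> powr (- ((2 * real l - 1 + \<gamma>) / (2 * real l))) = k powr (- (2 * real l - 1 + \<gamma>))"
        unfolding k\<Lambda> using assms(1) by simp
      ultimately show ?thesis using h by auto
    qed
    show "\<exists>k\<^sub>0>0. \<forall>q \<sigma> A \<Lambda> X \<epsilon> j.
       let \<gamma>\<^sub>1 = (2 * real l - real CARD('n) - 8 * \<delta>) / 2;
           \<gamma> = min \<gamma>\<^sub>1 \<gamma>\<^sub>2;
           \<gamma>h = (2 * real l - 1 + \<gamma>) / (2 * real l);
           k = \<Lambda> powr (1 / (2 * real l))
       in q \<noteq> 0 \<longrightarrow> fourier V q \<noteq> 0 \<longrightarrow>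
          \<Lambda> > k\<^sub>0 ^ (2 * l) \<longrightarrow>
          \<bar>\<sigma>\<bar> * (cmod A)\<^sup>2 < k powr (- \<gamma>\<^sub>2) \<longrightarrow>
          resonant_set l V q k \<delta> X \<longrightarrow>
          \<epsilon> \<in> {1, -1} \<longrightarrow>
          {t \<in> resonant_nbhd q k \<delta> X j (k powr (- real CARD('n) + 1 - 7 * \<delta>)).
             lam l V q \<sigma> A \<epsilon> j t = complex_of_real \<Lambda>}
          \<subseteq> (\<Union>s\<in>{s. lamhat l V q \<epsilon> j s = \<Lambda>}. ball s (C * \<Lambda> powr (- \<gamma>h)))"
      unfolding Let_def \<gamma>\<^sub>1_def[symmetric] \<gamma>_def[symmetric]
      by (intro exI[of _ k\<^sub>0] conjI allI impI subsetI k\<^sub>0(1), elim CollectE conjE, rule main[OF _ _ _ refl])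
  qed
qed

end
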